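(* Assume that $\nu>(1-\lambda)\,\|R^{\flat}\|_{\mathbb R^2}^2$. For $T>0$ let $u^{(\delta,T)}\in(L^2(0,T))^2$ denote a solution of the dynamic problem with integer constraint (IP$_T$) described in the context. There exists a constant $\bar C>0$ that is independent of $T$ such that for $T>0$ sufficiently large, there exists a solution $u^{(\sigma)}$ of the static problem with integer constraint (IS) described in the context with $u_+^{(\delta,T)}(t)=u_+^{(\sigma)}$ for all $t\in[0,T]$ and $$\frac1T\int_0^T\left\|u^{(\delta,T)}(t)-u^{(\sigma)}\right\|_{\mathbb R^2}^2\,dt\le\frac{\bar C}{T}.$$ Moreover, for the corresponding optimal states, $r^{(\delta,T)}$ generated by $u^{(\delta,T)}$ and $r^{(\sigma)}$ generated by $u^{(\sigma)}$, there is a constant $\tilde D>0$ independent of $T$ such that $$\int_0^T\int_0^L\left\|r^{(\delta,T)}(\tau,x)-r^{(\sigma)}(x)\right\|_{\mathbb R^2}^2\,dx\,d\tau\le\tilde D .$$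
   Context: Standing data. Let $L>0$, let $d_-,d_+:[0,L]\to\mathbb R$ be continuously differentiable with $d_-(x)<0<d_+(x)$ for all $x\in[0,L]$, and put $D(x)=\mathrm{diag}(d_+(x),d_-(x))$, $D'(x)=\mathrm{diag}(d_+'(x),d_-'(x))$. Let $M(x)$, $x\in[0,L]$, be a real $2\times2$ matrix depending continuously on $x$, and let $\eta_0\le 0$ be a real number. For real $\mu_+,\mu_-$ let $E(x)=\mathrm{diag}(\exp(-\mu_+x),\exp(\mu_-x))$. It is assumed that: (i) there exist $\mu_+>0$, $\mu_->0$ and $\nu_a<0$ such that for all $x\in[0,L]$ $$\sup_{v:\,v^\top E(x)v=1}v^\top\Big[\tfrac{d}{dx}\big(E(x)D(x)\big)-|\eta_0|\big(E(x)M(x)+M(x)^\top E(x)\big)\Big]v\le\nu_a;$$ (ii) there exist $\mu_+<0$, $\mu_-<0$ and $\nu_0>0$ such that for all $x\in[0,L]$ $$\inf_{v:\,v^\top E(x)v=1}v^\top\Big[E'(x)D(x)-E(x)D'(x)+|\eta_0|\big(E(x)M(x)+M(x)^\top E(x)\big)\Big]v\ge\nu_0.$$ Dynamic system. For $T>0$ and $u=(u_+,u_-)\in L^2(0,T)\times L^2(0,T)$, the state $r=(r_+,r_-)^\top$ generated by $u$ is the solution $r\in C([0,T],L^2((0,L);\mathbb R^2))$ (in the sense of integration along characteristic curves) of $$r(0,x)=0,\quad r_t+D\,r_x=\eta_0\,M\,r,\quad r_+(t,0)=u_+(t),\quad r_-(t,L)=u_-(t),\qquad (t,x)\in(0,T)\times(0,L).$$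 Its boundary traces satisfy $r_+(\cdot,L),\,r_-(\cdot,0)\in L^2(0,T)$. Static system. For $u^{(\sigma)}=(u_+^{(\sigma)},u_-^{(\sigma)})^\top\in\mathbb R^2$, the state $R^{(\sigma)}=(R_+^{(\sigma)},R_-^{(\sigma)})^\top$ generated by $u^{(\sigma)}$ solves $D\,R_x^{(\sigma)}(x)=\eta_0\,M\,R^{(\sigma)}(x)$ for $x\in(0,L)$, $R_+^{(\sigma)}(0)=u_+^{(\sigma)}$, $R_-^{(\sigma)}(L)=u_-^{(\sigma)}$. Objectives. Let $\lambda\in(0,1)$, $R^\flat=(R_+^\flat,R_-^\flat)^\top\in\mathbb R^2$ and $\nu>0$ be given, and let $\mathcal F$ be a finite set of integers that contains $0$. Let $\|\cdot\|_{\mathbb R^2}$ be the Euclidean norm. Set $$J(u,r)=\int_0^T(1-\lambda)\left\|\begin{pmatrix}r_+(t,L)-R_+^\flat\\ r_-(t,0)-R_-^\flat\end{pmatrix}\right\|_{\mathbb R^2}^2+\lambda\left\|\begin{pmatrix}u_+(t)\\ u_-(t)\end{pmatrix}\right\|_{\mathbb R^2}^2dt,$$ $$J_0(u^{(\sigma)},R^{(\sigma)})=(1-\lambda)\left\|\begin{pmatrix}R_+^{(\sigma)}(L)-R_+^\flat\\ R_-^{(\sigma)}(0)-R_-^\flat\end{pmatrix}\right\|_{\mathbb R^2}^2+\lambda\,\|u^{(\sigma)}\|_{\mathbb R^2}^2 .$$ Let $\mathrm{Var}(u_+)=\sup_P\sum_i|u_+(t_{i+1})-u_+(t_i)|$,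 the supremum being over all finite partitions $P$ of $[0,T]$ (total variation; here $u_+$ is regarded as a function defined at every point of $[0,T]$). Dynamic problem (IP$_T$): minimize $J(u,r)+\nu\,T\,\mathrm{Var}(u_+)$ over $u\in(L^2(0,T))^2$, where $r$ is the state generated by $u$, subject to $u_+(t)\in\mathcal F$ for almost every $t\in(0,T)$. Static problem (IS): minimize $J_0(u^{(\sigma)},R^{(\sigma)})$ over $u_+^{(\sigma)}\in\mathcal F$, $u_-^{(\sigma)}\in\mathbb R$, where $R^{(\sigma)}$ is the static state generated by $u^{(\sigma)}$. *)

theory Defs
  imports "HOL-Analysis.Analysis"
begin

definition diag2 :: "real \<Rightarrow> real \<Rightarrow> real^2^2" where
  "diag2 a b = vector [vector [a, 0], vector [0, b]]"

definition weight :: "real \<Rightarrow> real \<Rightarrow> real \<Rightarrow> real^2^2" where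
  "weight \<mu>p \<mu>m x = diag2 (exp (- \<mu>p * x)) (exp (\<mu>m * x))"

definition L2_on :: "real set \<Rightarrow> (real \<Rightarrow> 'a::euclidean_space) \<Rightarrow> bool" where
  "L2_on S f \<longleftrightarrow> f \<in> borel_measurable (lebesgue_on S) \<and>
     integrable (lebesgue_on S) (\<lambda>x. (norm (f x))\<^sup>2)"

text \<open>
  Pairs are encoded as vectors: component \<open>1\<close> is the plus component (speed \<open>dp > 0\<close>, inflow
  boundary \<open>x = 0\<close>), component \<open>2\<close> is the minus component (speed \<open>dm < 0\<close>, inflow boundary
  \<open>x = L\<close>).

  The equation of the \<open>i\<close>-th component integrated along its characteristic curve \<open>\<xi>\<close> through
  \<open>(t, x)\<close>. Backwards in time the curve is followed until a time \<open>a\<close> at which it meets either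
  the initial line (\<open>a = 0\<close>, where the state vanishes) or the inflow boundary \<open>x = b\<close> (where the
  state equals the control). In the corner case \<open>a = 0\<close>, \<open>\<xi> 0 = b\<close>, which concerns a single
  curve, the initial value is used.
\<close>
definition char_eq ::
  "real \<Rightarrow> real \<Rightarrow> (real \<Rightarrow> real^2^2) \<Rightarrow> (real \<Rightarrow> real) \<Rightarrow> real \<Rightarrow> 2 \<Rightarrow>
   (real \<Rightarrow> real^2) \<Rightarrow> (real \<Rightarrow> real \<Rightarrow> real^2) \<Rightarrow> real \<Rightarrow> real \<Rightarrow> bool" where
  "char_eq L \<eta>0 M d b i u r t x \<longleftrightarrow>
     (\<exists>a \<xi>. 0 \<le> a \<and> a \<le> t \<and>
        (\<forall>s\<in>{a..t}. \<xi> s \<in> {0..L} \<and> (\<xi> has_real_derivative d (\<xi> s)) (at s within {a..t})) \<and>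
        \<xi> t = x \<and> (a = 0 \<or> \<xi> a = b) \<and>
        has_bochner_integral (lebesgue_on {a..t}) (\<lambda>s. \<eta>0 * (M (\<xi> s) *v r s (\<xi> s)) $ i)
          (r t x $ i - (if a = 0 then 0 else u a $ i)))"

text \<open>
  \<open>r\<close> is a jointly measurable representative of an element of \<open>C([0,T], L\<^sup>2((0,L); \<real>\<^sup>2))\<close>. The
  integrated equations hold at every time for almost every point. They are also imposed on the
  two boundary lines for almost every time: at the inflow end this is the boundary condition, and
  at the outflow end it makes \<open>r t L $ 1\<close> and \<open>r t 0 $ 2\<close> the boundary traces of the solution
  (which would otherwise be values on null sets).
\<close>
definition dynamic_state ::
  "real \<Rightarrow> (real \<Rightarrow> real) \<Rightarrow> (real \<Rightarrow> real) \<Rightarrow> real \<Rightarrow> (real \<Rightarrow> real^2^2) \<Rightarrow> real \<Rightarrow>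
   (real \<Rightarrow> real^2) \<Rightarrow> (real \<Rightarrow> real \<Rightarrow> real^2) \<Rightarrow> bool" where
  "dynamic_state L dp dm \<eta>0 M T u r \<longleftrightarrow>
     (\<lambda>(t, x). r t x) \<in> borel_measurable (lebesgue_on ({0..T} \<times> {0..L})) \<and>
     (\<forall>t\<in>{0..T}. L2_on {0..L} (r t)) \<and>
     (\<forall>t\<in>{0..T}. ((\<lambda>s. LINT x|lebesgue_on {0..L}. (norm (r s x - r t x))\<^sup>2) \<longlongrightarrow> 0)
        (at t within {0..T})) \<and>
     (\<forall>t\<in>{0..T}. AE x in lebesgue_on {0..L}.
        char_eq L \<eta>0 M dp 0 1 u r t x \<and> char_eq L \<eta>0 M dm L 2 u r t x) \<and>
     (\<forall>x\<in>{0, L}. AE t in lebesgue_on {0..T}.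
        char_eq L \<eta>0 M dp 0 1 u r t x \<and> char_eq L \<eta>0 M dm L 2 u r t x) \<and>
     L2_on {0..T} (\<lambda>t. r t L $ 1) \<and> L2_on {0..T} (\<lambda>t. r t 0 $ 2)"

definition static_state ::
  "real \<Rightarrow> (real \<Rightarrow> real) \<Rightarrow> (real \<Rightarrow> real) \<Rightarrow> real \<Rightarrow> (real \<Rightarrow> real^2^2) \<Rightarrow>
   real^2 \<Rightarrow> (real \<Rightarrow> real^2) \<Rightarrow> bool" where
  "static_state L dp dm \<eta>0 M u R \<longleftrightarrow>
     continuous_on {0..L} R \<and>
     (\<forall>x\<in>{0<..<L}. \<exists>R'. (R has_vector_derivative R') (at x) \<and>
        diag2 (dp x) (dm x) *v R' = \<eta>0 *\<^sub>R (M x *v R x)) \<and>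
     R 0 $ 1 = u $ 1 \<and> R L $ 2 = u $ 2"

definition J :: "real \<Rightarrow> real \<Rightarrow> real^2 \<Rightarrow> real \<Rightarrow> (real \<Rightarrow> real^2) \<Rightarrow> (real \<Rightarrow> real \<Rightarrow> real^2) \<Rightarrow> real" where
  "J L lam Rb T u r = (LINT t|lebesgue_on {0..T}.
     (1 - lam) * (norm (vector [r t L $ 1 - Rb $ 1, r t 0 $ 2 - Rb $ 2] :: real^2))\<^sup>2
     + lam * (norm (u t))\<^sup>2)"

definition J0 :: "real \<Rightarrow> real \<Rightarrow> real^2 \<Rightarrow> real^2 \<Rightarrow> (real \<Rightarrow> real^2) \<Rightarrow> real" where
  "J0 L lam Rb u R =
     (1 - lam) * (norm (vector [R L $ 1 - Rb $ 1, R 0 $ 2 - Rb $ 2] :: real^2))\<^sup>2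
     + lam * (norm u)\<^sup>2"

definition total_variation :: "real \<Rightarrow> (real \<Rightarrow> real) \<Rightarrow> ennreal" where
  "total_variation T f =
     (SUP (n, p) \<in> {(n::nat, p::nat \<Rightarrow> real). p 0 = 0 \<and> p n = T \<and> (\<forall>i<n. p i < p (Suc i))}.
        \<Sum>i<n. ennreal \<bar>f (p (Suc i)) - f (p i)\<bar>)"

text \<open>
  The objective takes values in \<^typ>\<open>ennreal\<close>, so that controls of infinite variation are
  admissible with infinite cost.
\<close>
definition dynamic_cost ::
  "real \<Rightarrow> real \<Rightarrow> real^2 \<Rightarrow> real \<Rightarrow> real \<Rightarrow> (real \<Rightarrow> real^2) \<Rightarrow> (real \<Rightarrow> real \<Rightarrow> real^2) \<Rightarrow> ennreal" where
  "dynamic_cost L lam Rb \<nu> T u r =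
     ennreal (J L lam Rb T u r) + ennreal (\<nu> * T) * total_variation T (\<lambda>t. u t $ 1)"

definition dynamic_feasible ::
  "real \<Rightarrow> (real \<Rightarrow> real) \<Rightarrow> (real \<Rightarrow> real) \<Rightarrow> real \<Rightarrow> (real \<Rightarrow> real^2^2) \<Rightarrow> int set \<Rightarrow> real \<Rightarrow>
   (real \<Rightarrow> real^2) \<Rightarrow> (real \<Rightarrow> real \<Rightarrow> real^2) \<Rightarrow> bool" where
  "dynamic_feasible L dp dm \<eta>0 M F T u r \<longleftrightarrow>
     L2_on {0..T} u \<and> (AE t in lebesgue_on {0..T}. u t $ 1 \<in> of_int ` F) \<and>
     dynamic_state L dp dm \<eta>0 M T u r"

definition solves_dynamic ::
  "real \<Rightarrow> (real \<Rightarrow> real) \<Rightarrow> (real \<Rightarrow> real) \<Rightarrow> real \<Rightarrow> (real \<Rightarrow> real^2^2) \<Rightarrow> real \<Rightarrow> real^2 \<Rightarrow> real \<Rightarrow>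
   int set \<Rightarrow> real \<Rightarrow> (real \<Rightarrow> real^2) \<Rightarrow> (real \<Rightarrow> real \<Rightarrow> real^2) \<Rightarrow> bool" where
  "solves_dynamic L dp dm \<eta>0 M lam Rb \<nu> F T u r \<longleftrightarrow>
     dynamic_feasible L dp dm \<eta>0 M F T u r \<and>
     (\<forall>v q. dynamic_feasible L dp dm \<eta>0 M F T v q \<longrightarrow>
        dynamic_cost L lam Rb \<nu> T u r \<le> dynamic_cost L lam Rb \<nu> T v q)"

definition static_feasible ::
  "real \<Rightarrow> (real \<Rightarrow> real) \<Rightarrow> (real \<Rightarrow> real) \<Rightarrow> real \<Rightarrow> (real \<Rightarrow> real^2^2) \<Rightarrow> int set \<Rightarrow>
   real^2 \<Rightarrow> (real \<Rightarrow> real^2) \<Rightarrow> bool" where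
  "static_feasible L dp dm \<eta>0 M F u R \<longleftrightarrow>
     u $ 1 \<in> of_int ` F \<and> static_state L dp dm \<eta>0 M u R"

definition solves_static ::
  "real \<Rightarrow> (real \<Rightarrow> real) \<Rightarrow> (real \<Rightarrow> real) \<Rightarrow> real \<Rightarrow> (real \<Rightarrow> real^2^2) \<Rightarrow> real \<Rightarrow> real^2 \<Rightarrow>
   int set \<Rightarrow> real^2 \<Rightarrow> (real \<Rightarrow> real^2) \<Rightarrow> bool" where
  "solves_static L dp dm \<eta>0 M lam Rb F u R \<longleftrightarrow>
     static_feasible L dp dm \<eta>0 M F u R \<and>
     (\<forall>v S. static_feasible L dp dm \<eta>0 M F v S \<longrightarrow> J0 L lam Rb u R \<le> J0 L lam Rb v S)"

end

theory Submission
  imports Defs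
begin

text \<open>
  The penalty forces the integer control to be constant: the zero control is feasible, so an optimal
  control costs at most \<open>T (1 - lam) \<parallel>Rb\<parallel>\<^sup>2\<close>, and since \<open>\<nu>\<close> is larger than \<open>(1 - lam) \<parallel>Rb\<parallel>\<^sup>2\<close> its variation
  is less than one. Its values are integers almost everywhere, hence equal to some \<open>c\<close>, and deviations on a null
  set could be removed at no cost (\<open>optimal_plus_control_constant\<close>).

  For fixed \<open>c\<close> both problems are convex and quadratic in the minus control. Let \<open>(w, R)\<close> be the static optimum
  with plus control \<open>c\<close>, let \<open>jc\<close> be its value, \<open>z = r - R\<close>, and let \<open>X\<close> be the integral of the squared
  distance of the control to \<open>w\<close>. The dynamic cost is \<open>T jc + 2 \<Lambda>\<close> plus nonnegative quadratic terms that
  include \<open>lam X\<close>, where \<open>\<Lambda>\<close> is linear in \<open>z\<close> and the control. Two identities control it. Testing the equation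
  of \<open>z\<close> with the static adjoint state (\<open>adjoint_balance\<close>) shows, by static optimality, that \<open>\<Lambda>\<close> consists of
  pairings with \<open>z\<close> at the times \<open>0\<close> and \<open>T\<close> only. Testing it with the weighted \<open>z\<close> itself
  (\<open>energy_balance\<close>) yields, from the bound on the supremum with positive weight exponents, that the final energy,
  the outflow traces and the integral of \<open>\<parallel>z\<parallel>\<^sup>2\<close> are at most a constant times \<open>1 + X\<close>. Hence
  (\<open>turnpike_estimates\<close>) the cost is at least \<open>T jc - K + (lam / 2) X\<close>, and the constant control \<open>w\<close> costs at most
  \<open>T jc + K\<close>. Comparing the optimal control with constant controls bounds \<open>X\<close> and thereby the integral of
  \<open>\<parallel>z\<parallel>\<^sup>2\<close>. It also shows that, for large \<open>T\<close>, \<open>c\<close> minimizes \<open>jc\<close> over the finite set \<open>F\<close>, since otherwise a better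
  integer would gain linearly in \<open>T\<close>.

  Both identities are instances of one balance law for products of quantities transported along
  characteristics (\<open>balance_law\<close>). It is proved by following almost every characteristic, where the
  quantities are absolutely continuous, and integrating over the labels of the characteristics. The comparison
  requires that constant controls generate states, which is a Volterra fixed point problem
  (\<open>ex_dynamic_state_constant_control\<close>), and that the static boundary value problem and its adjoint are solvable,
  which follows from the same dissipation inequality (\<open>ex_optimal_static\<close>).
\<close>

section \<open>Lebesgue measure and absolutely continuous functions\<close>

lemma AE_lebesgue_on_iff:
  fixes S :: "'a::euclidean_space set"
  assumes "S \<in> sets borel"
  shows "(AE x in lebesgue_on S. P x) \<longleftrightarrow> (AE x in lborel. x \<in> S \<longrightarrow> P x)"
  using assms by (subst AE_restrict_space_iff) (auto simp: AE_completion_iff)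

text \<open>
  Fubini's theorem is used for the product of two copies of \<^term>\<open>lborel\<close>, while states and controls are
  merely Lebesgue measurable. Passing to a Borel representative bridges the two.
\<close>

lemma borel_representative:
  fixes f :: "'a::euclidean_space \<Rightarrow> real"
  assumes "f \<in> borel_measurable (lebesgue_on S)" "S \<in> sets borel"
  obtains F where "F \<in> borel_measurable borel" "AE x in lborel. x \<in> S \<longrightarrow> f x = F x"
proof -
  have "(\<lambda>x. if x \<in> S then f x else 0) \<in> borel_measurable (completion lborel)"
    using assms by (intro borel_measurable_if_I) auto
  from completion_ex_borel_measurable_real[OF this] obtain F where
    F: "F \<in> borel_measurable lborel" "AE x in lborel. (if x \<in> S then f x else 0) = F x" by auto
  have "AE x in lborel. x \<in> S \<longrightarrow> f x = F x"
    using F(2) by eventually_elim auto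
  with F(1) show ?thesis by (intro that) auto
qed

lemma borel_measurable_lebesgue_on_AE:
  fixes f F :: "'a::euclidean_space \<Rightarrow> real"
  assumes S: "S \<in> sets borel" and F[measurable]: "F \<in> borel_measurable borel"
    and ae: "AE x in lborel. x \<in> S \<longrightarrow> f x = F x"
  shows "f \<in> borel_measurable (lebesgue_on S)"
proof -
  have "(\<lambda>x. indicator S x * F x) \<in> borel_measurable lborel" using S by measurable
  then have 1: "(\<lambda>x. indicator S x * F x) \<in> borel_measurable lebesgue" 
    by (rule measurable_completion)
  have "(\<lambda>x. if x \<in> S then f x else 0) \<in> borel_measurable lebesgue"
    by (rule borel_measurable_AE[OF 1 AE_completion])
       (use ae in \<open>eventually_elim, auto split: split_indicator\<close>)
  then show ?thesis using S by (intro borel_measurable_if_D) auto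
qed

lemma has_bochner_integral_lebesgue_on_iff:
  fixes f F :: "'a::euclidean_space \<Rightarrow> real"
  assumes S: "S \<in> sets borel" and F[measurable]: "F \<in> borel_measurable borel"
    and ae: "AE x in lborel. x \<in> S \<longrightarrow> f x = F x"
  shows "has_bochner_integral (lebesgue_on S) f v \<longleftrightarrow>
    has_bochner_integral lborel (\<lambda>x. indicator S x * F x) v"
proof -
  have mf: "f \<in> borel_measurable (lebesgue_on S)"
    by (rule borel_measurable_lebesgue_on_AE[OF assms])
  have mF: "F \<in> borel_measurable (lebesgue_on S)"
    using F by (intro measurable_restrict_space1 measurable_completion) auto
  have 1: "(\<lambda>x. indicator S x * F x) \<in> borel_measurable lborel" using S by measurable
  have "AE x in lebesgue_on S. f x = F x"
    using ae AE_lebesgue_on_iff[OF S] by blast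
  then have "has_bochner_integral (lebesgue_on S) f v \<longleftrightarrow> has_bochner_integral (lebesgue_on S) F v"
    by (rule has_bochner_integral_cong_AE[OF mf mF])
  also have "\<dots> \<longleftrightarrow> has_bochner_integral lebesgue (\<lambda>x. indicator S x *\<^sub>R F x) v"
    using S by (intro has_bochner_integral_restrict_space) auto
  also have "\<dots> \<longleftrightarrow> has_bochner_integral lborel (\<lambda>x. indicator S x * F x) v"
    using 1 by (simp add: has_bochner_integral_iff integrable_completion integral_completion)
  finally show ?thesis .
qed

lemma integrable_lebesgue_on_iff:
  fixes f F :: "'a::euclidean_space \<Rightarrow> real"
  assumes "S \<in> sets borel" "F \<in> borel_measurable borel" "AE x in lborel. x \<in> S \<longrightarrow> f x = F x"
  shows "integrable (lebesgue_on S) f \<longleftrightarrow> integrable lborel (\<lambda>x. indicator S x * F x)"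
  using has_bochner_integral_lebesgue_on_iff[OF assms]
  by (metis has_bochner_integral_iff)

lemma LINT_lebesgue_on_eq:
  fixes f F :: "'a::euclidean_space \<Rightarrow> real"
  assumes "S \<in> sets borel" "F \<in> borel_measurable borel" "AE x in lborel. x \<in> S \<longrightarrow> f x = F x"
  shows "(LINT x|lebesgue_on S. f x) = (LINT x|lborel. indicator S x * F x)"
  using has_bochner_integral_lebesgue_on_iff[OF assms] integrable_lebesgue_on_iff[OF assms]
  by (metis has_bochner_integral_iff not_integrable_integral_eq)

text \<open>
  The factors are absolutely continuous but in general not differentiable everywhere, so the product
  rule is derived from Fubini's theorem instead of pointwise derivatives: the integral of
  \<open>f x * g y\<close> over a square is split along the diagonal, and on each triangle the inner integral is an
  indefinite integral.
\<close>

lemma product_rule_indefinite_integrals: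
  fixes f g :: "real \<Rightarrow> real"
  assumes f: "integrable lborel (\<lambda>x. indicator {a..b} x * f x)"
    and g: "integrable lborel (\<lambda>x. indicator {a..b} x * g x)"
    and [measurable]: "f \<in> borel_measurable borel" "g \<in> borel_measurable borel"
    and "a \<le> b"
    and F: "\<And>s. s \<in> {a..b} \<Longrightarrow> F s = F0 + (LINT x|lborel. indicator {a..s} x * f x)"
    and G: "\<And>s. s \<in> {a..b} \<Longrightarrow> G s = G0 + (LINT x|lborel. indicator {a..s} x * g x)"
  shows "has_bochner_integral lborel (\<lambda>s. indicator {a..b} s * (f s * G s + F s * g s))
    (F b * G b - F0 * G0)"
proof -
  define f' where "f' x = indicator {a..b} x * f x" for x
  define g' where "g' x = indicator {a..b} x * g x" for x
  have fi: "integrable lborel f'" and gi: "integrable lborel g'"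
    using f g by (simp_all add: f'_def[abs_def] g'_def[abs_def])
  have [measurable]: "f' \<in> borel_measurable borel" "g' \<in> borel_measurable borel"
    using fi gi by auto
  let ?P = "\<lambda>(x, y). f' x * g' y"
  have P: "integrable (lborel \<Otimes>\<^sub>M lborel) ?P"
  proof (rule lborel_pair.Fubini_integrable)
    show "integrable lborel (\<lambda>x. LINT y|lborel. norm (case (x, y) of (x, y) \<Rightarrow> f' x * g' y))"
      using fi by (auto simp: abs_mult)
    show "AE x in lborel. integrable lborel (\<lambda>y. case (x, y) of (x, y) \<Rightarrow> f' x * g' y)"
      using gi by auto
  qed (simp add: split_beta)
  have P1: "integrable (lborel \<Otimes>\<^sub>M lborel) (\<lambda>(x, y). if x \<le> y then f' x * g' y else 0)"
    by (rule Bochner_Integration.integrable_bound[OF P])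
       (auto simp: split_beta split: split_indicator)
  have P2: "integrable (lborel \<Otimes>\<^sub>M lborel) (\<lambda>(x, y). if y < x then f' x * g' y else 0)"
    by (rule Bochner_Integration.integrable_bound[OF P])
       (auto simp: split_beta split: split_indicator)
  \<comment> \<open>On the triangles below and above the diagonal the inner integrals are the two primitives.\<close>
  have Fs: "(LINT x|lborel. indicator {..s} x * f' x) = F s - F0" if "s \<in> {a..b}" for s
  proof -
    have "(\<lambda>x. indicator {..s} x * f' x) = (\<lambda>x. indicator {a..s} x * f x)"
      using that by (auto simp: f'_def split: split_indicator)
    then show ?thesis using that by (simp add: F)
  qed
  have Gs: "(LINT y|lborel. indicator {..<s} y * g' y) = G s - G0" if "s \<in> {a..b}" for s
  proof -
    have "AE x in lborel. indicator {..<s} x * g' x = indicator {a..s} x * g x"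
      using AE_lborel_singleton[of s] 
      by eventually_elim (use that in \<open>auto simp: g'_def split: split_indicator\<close>)
    then show ?thesis using that by (subst G) (auto intro!: integral_cong_AE)
  qed
  have Fb: "(LINT x|lborel. f' x) = F b - F0" and Gb: "(LINT x|lborel. g' x) = G b - G0"
    using \<open>a \<le> b\<close> by (simp_all add: F G f'_def g'_def)
  have 1: "has_bochner_integral lborel (\<lambda>y. indicator {a..b} y * ((F y - F0) * g y))
     (LINT p|(lborel \<Otimes>\<^sub>M lborel). (\<lambda>(x, y). if x \<le> y then f' x * g' y else 0) p)"
  proof -
    have eq: "(LINT x|lborel. (\<lambda>(x, y). if x \<le> y then f' x * g' y else 0) (x, y))
       = indicator {a..b} y * ((F y - F0) * g y)" for y
    proof -
      have "(LINT x|lborel. (\<lambda>(x, y). if x \<le> y then f' x * g' y else 0) (x, y))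
         = (LINT x|lborel. (indicator {..y} x * f' x) * g' y)"
        by (intro Bochner_Integration.integral_cong) (auto split: split_indicator)
      also have "\<dots> = (LINT x|lborel. indicator {..y} x * f' x) * g' y"
        by (rule integral_mult_left_zero)
      finally have "(LINT x|lborel. (\<lambda>(x, y). if x \<le> y then f' x * g' y else 0) (x, y))
         = (LINT x|lborel. indicator {..y} x * f' x) * g' y" .
      then show ?thesis using Fs by (auto simp: g'_def split: split_indicator)
    qed
    show ?thesis
      using lborel_pair.integrable_snd[OF P1] lborel_pair.integral_snd[OF P1]
      unfolding has_bochner_integral_iff by (simp add: eq[unfolded prod.case] split_beta')
  qed
  have 2: "has_bochner_integral lborel (\<lambda>x. indicator {a..b} x * (f x * (G x - G0)))
     (LINT p|(lborel \<Otimes>\<^sub>M lborel). (\<lambda>(x, y). if y < x then f' x * g' y else 0) p)"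
  proof -
    have eq: "(LINT y|lborel. (\<lambda>(x, y). if y < x then f' x * g' y else 0) (x, y))
       = indicator {a..b} x * (f x * (G x - G0))" for x
    proof -
      have "(LINT y|lborel. (\<lambda>(x, y). if y < x then f' x * g' y else 0) (x, y))
         = (LINT y|lborel. f' x * (indicator {..<x} y * g' y))"
        by (intro Bochner_Integration.integral_cong) (auto split: split_indicator)
      also have "\<dots> = f' x * (LINT y|lborel. indicator {..<x} y * g' y)"
        by (rule integral_mult_right_zero)
      finally have "(LINT y|lborel. (\<lambda>(x, y). if y < x then f' x * g' y else 0) (x, y))
         = f' x * (LINT y|lborel. indicator {..<x} y * g' y)" .
      then show ?thesis using Gs by (auto simp: f'_def split: split_indicator)
    qed
    show ?thesis
      using lborel_pair.integrable_fst'[OF P2, unfolded eq] lborel_pair.integral_fst'[OF P2, unfolded eq]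
      unfolding has_bochner_integral_iff by simp
  qed
  have "(LINT p|(lborel \<Otimes>\<^sub>M lborel). (\<lambda>(x, y). if x \<le> y then f' x * g' y else 0) p)
     + (LINT p|(lborel \<Otimes>\<^sub>M lborel). (\<lambda>(x, y). if y < x then f' x * g' y else 0) p)
     = (LINT p|(lborel \<Otimes>\<^sub>M lborel). ?P p)"
    by (subst Bochner_Integration.integral_add[symmetric, OF P1 P2])
       (auto intro!: Bochner_Integration.integral_cong split: split_indicator)
  also have "\<dots> = (F b - F0) * (G b - G0)"
    using lborel_pair.integral_fst'[OF P, symmetric] by (simp add: Fb Gb)
  finally have sum: "(LINT p|(lborel \<Otimes>\<^sub>M lborel). (\<lambda>(x, y). if x \<le> y then f' x * g' y else 0) p)
     + (LINT p|(lborel \<Otimes>\<^sub>M lborel). (\<lambda>(x, y). if y < x then f' x * g' y else 0) p)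
     = (F b - F0) * (G b - G0)" .
  have hf: "has_bochner_integral lborel (\<lambda>x. indicator {a..b} x * f x) (F b - F0)"
    using f \<open>a \<le> b\<close> by (simp add: has_bochner_integral_iff F)
  have hg: "has_bochner_integral lborel (\<lambda>x. indicator {a..b} x * g x) (G b - G0)"
    using g \<open>a \<le> b\<close> by (simp add: has_bochner_integral_iff G)
  have "has_bochner_integral lborel (\<lambda>s. indicator {a..b} s * ((F s - F0) * g s)
      + indicator {a..b} s * (f s * (G s - G0)) + F0 * (indicator {a..b} s * g s)
      + G0 * (indicator {a..b} s * f s))
    ((F b - F0) * (G b - G0) + F0 * (G b - G0) + G0 * (F b - F0))"
    unfolding sum[symmetric]
    by (intro has_bochner_integral_add has_bochner_integral_mult_right 1 2 hf hg)
  then show ?thesis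
    by (rule has_bochner_integral_cong[THEN iffD1, rotated -1]) (auto simp: algebra_simps)
qed

lemma AE_lborel_swap:
  assumes "AE s in (lborel :: real measure). AE k in (lborel :: real measure). P s k"
    and "Measurable.pred (lborel \<Otimes>\<^sub>M lborel) (\<lambda>p. P (fst p) (snd p))"
  shows "AE k in lborel. AE s in lborel. P s k"
  using lborel_pair.AE_commute[OF predE[OF assms(2)]] assms(1) by blast

text \<open>
  Null sets are pulled back along \<open>h\<close> because its inverse \<open>j\<close> is differentiable and differentiable
  images of null sets are null.
\<close>

lemma AE_lborel_compose:
  fixes h j :: "real \<Rightarrow> real"
  assumes P: "AE x in lborel. P x" and j: "\<And>y. j (h y) = y"
    and d: "\<And>x. (j has_real_derivative j' x) (at x)"
  shows "AE y in lborel. P (h y)"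
proof -
  have "negligible {x. \<not> P x}"
    using P AE_completion_iff[of P lborel] 
    by (auto simp: negligible_iff_null_sets completion.AE_iff_null_sets)
  then have "negligible (j ` {x. \<not> P x})"
    using d by (intro negligible_differentiable_image_negligible)
      (auto simp: differentiable_on_def real_differentiable_def intro: has_field_derivative_at_within)
  moreover have "{y. \<not> P (h y)} \<subseteq> j ` {x. \<not> P x}"
    using j by (metis (mono_tags, lifting) image_eqI mem_Collect_eq subsetI)
  ultimately have "negligible {y. \<not> P (h y)}"
    by (rule negligible_subset)
  then show ?thesis
    using AE_completion_iff[of "\<lambda>y. P (h y)" lborel]
    by (auto simp: negligible_iff_null_sets completion.AE_iff_null_sets)
qed

lemma has_bochner_integral_lebesgue_on_iff_integral:
  fixes f :: "real \<Rightarrow> real"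
  assumes "S \<in> sets lebesgue"
  shows "has_bochner_integral (lebesgue_on S) f v \<longleftrightarrow> f absolutely_integrable_on S \<and> integral S f = v"
  using assms lebesgue_integral_eq_integral[of S f]
  by (auto simp: has_bochner_integral_iff set_integrable_def integrable_restrict_space)

section \<open>Characteristic curves of one transport equation\<close>

text \<open>
  One equation of the system. The travel time \<open>\<theta> x\<close> from the inflow end \<open>b\<close> to \<open>x\<close> satisfies
  \<open>\<theta>' = 1 / d\<close> whatever the sign of the speed, so both families of characteristics are covered at once:
  the curve through \<open>(t, x)\<close> is \<open>s \<mapsto> \<xi> (s - k)\<close> with the constant label \<open>k = t - \<theta> x\<close>. It enters through
  the inflow boundary at time \<open>k\<close> if \<open>k > 0\<close> and starts on the initial line if \<open>k \<le> 0\<close>; it reaches the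
  outflow end \<open>b'\<close> at time \<open>k + \<Theta>\<close>. The speed is defined on the whole line, which makes \<open>\<theta>\<close> and \<open>\<xi>\<close>
  globally differentiable inverses of each other and spares one-sided arguments at the two ends.
\<close>

locale characteristics =
  fixes L \<Theta> b b' :: real and d \<theta> \<xi> :: "real \<Rightarrow> real"
  assumes L_pos: "0 < L" and \<Theta>_pos: "0 < \<Theta>"
    and \<xi>_\<theta> [simp]: "\<xi> (\<theta> x) = x" and \<theta>_\<xi> [simp]: "\<theta> (\<xi> \<sigma>) = \<sigma>"
    and \<theta>_deriv: "(\<theta> has_real_derivative 1 / d x) (at x)"
    and \<xi>_deriv: "(\<xi> has_real_derivative d (\<xi> \<sigma>)) (at \<sigma>)"
    and d_cont: "continuous_on UNIV d" and d_nz: "d x \<noteq> 0"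
    and \<theta>_range: "\<theta> x \<in> {0..\<Theta>} \<longleftrightarrow> x \<in> {0..L}"
    and \<xi>_0: "\<xi> 0 = b" and \<xi>_\<Theta>: "\<xi> \<Theta> = b'"
begin

lemma \<xi>_range: "\<xi> \<sigma> \<in> {0..L} \<longleftrightarrow> \<sigma> \<in> {0..\<Theta>}"
  using \<theta>_range[of "\<xi> \<sigma>"] by simp

lemma \<theta>_b: "\<theta> b = 0" and \<theta>_b': "\<theta> b' = \<Theta>"
  using \<theta>_\<xi> \<xi>_0 \<xi>_\<Theta> by metis+

lemma b_in: "b \<in> {0..L}" and b'_in: "b' \<in> {0..L}"
  using \<xi>_range[of 0] \<xi>_range[of \<Theta>] \<Theta>_pos by (auto simp: \<xi>_0 \<xi>_\<Theta>)

lemma cont_\<theta>: "continuous_on A \<theta>"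
  by (metis \<theta>_deriv continuous_at_imp_continuous_on DERIV_isCont)

lemma cont_\<xi>: "continuous_on A \<xi>"
  by (metis \<xi>_deriv continuous_at_imp_continuous_on DERIV_isCont)

lemma \<xi>_borel [measurable]: "\<xi> \<in> borel_measurable borel"
  by (rule borel_measurable_continuous_onI[OF cont_\<xi>])

lemma d_borel [measurable]: "d \<in> borel_measurable borel"
  by (rule borel_measurable_continuous_onI[OF d_cont])

lemma AE_label:
  assumes "AE x in lborel. P x"
  shows "AE k in lborel. P (\<xi> (t - k))"
  by (rule AE_lborel_compose[OF assms, where j = "\<lambda>x. t - \<theta> x" and j' = "\<lambda>x. - (1 / d x)"])
     (auto intro!: derivative_eq_intros \<theta>_deriv)

lemma AE_position:
  assumes "AE k in lborel. P k"
  shows "AE x in lborel. P (t - \<theta> x)"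
  by (rule AE_lborel_compose[OF assms, where j = "\<lambda>k. \<xi> (t - k)" and j' = "\<lambda>k. - d (\<xi> (t - k))"])
     (auto intro!: derivative_eq_intros DERIV_chain'[OF _ \<xi>_deriv, THEN DERIV_cong])

lemma has_bochner_integral_label:
  fixes h :: "real \<Rightarrow> real"
  shows "has_bochner_integral (lebesgue_on {0..L}) (\<lambda>x. h x / \<bar>d x\<bar>) v \<longleftrightarrow>
    has_bochner_integral (lebesgue_on {t - \<Theta>..t}) (\<lambda>k. h (\<xi> (t - k))) v"
proof -
  have im: "(\<lambda>x. t - \<theta> x) ` {0..L} = {t - \<Theta>..t}"
  proof safe
    fix k assume "k \<in> {t - \<Theta>..t}"
    then show "k \<in> (\<lambda>x. t - \<theta> x) ` {0..L}"
      by (intro image_eqI[of _ _ "\<xi> (t - k)"]) (use \<xi>_range[of "t - k"] in auto)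
  qed (use \<theta>_range in auto)
  have inj: "inj_on (\<lambda>x. t - \<theta> x) {0..L}"
    by (rule inj_onI) (metis \<xi>_\<theta> diff_diff_eq2 add_diff_cancel_left' diff_add_cancel)
  have "(\<lambda>x. \<bar>- (1 / d x)\<bar> * h (\<xi> (t - (t - \<theta> x)))) absolutely_integrable_on {0..L} \<and>
     integral {0..L} (\<lambda>x. \<bar>- (1 / d x)\<bar> * h (\<xi> (t - (t - \<theta> x)))) = v
     \<longleftrightarrow> (\<lambda>k. h (\<xi> (t - k))) absolutely_integrable_on (\<lambda>x. t - \<theta> x) ` {0..L} \<and>
     integral ((\<lambda>x. t - \<theta> x) ` {0..L}) (\<lambda>k. h (\<xi> (t - k))) = v"
    by (rule has_absolute_integral_change_of_variables_1')
       (auto intro!: derivative_eq_intros DERIV_subset[OF \<theta>_deriv] inj)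
  then show ?thesis
    unfolding im by (simp add: has_bochner_integral_lebesgue_on_iff_integral divide_inverse mult.commute)
qed

lemma has_bochner_integral_label_borel:
  fixes h :: "real \<Rightarrow> real"
  assumes [measurable]: "h \<in> borel_measurable borel"
  shows "has_bochner_integral lborel (\<lambda>x. indicator {0..L} x * (h x / \<bar>d x\<bar>)) v \<longleftrightarrow>
    has_bochner_integral lborel (\<lambda>k. indicator {0..\<Theta>} (t - k) * h (\<xi> (t - k))) v"
proof -
  have "(\<lambda>k. indicator {t - \<Theta>..t} k * h (\<xi> (t - k))) = (\<lambda>k. indicator {0..\<Theta>} (t - k) * h (\<xi> (t - k)))"
    by (auto split: split_indicator)
  then show ?thesis
    using has_bochner_integral_label[of h v t]
    by (subst (asm) (1 2) has_bochner_integral_lebesgue_on_iff[where F = "\<lambda>x. h x / \<bar>d x\<bar>"]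
          has_bochner_integral_lebesgue_on_iff[where F = "\<lambda>k. h (\<xi> (t - k))"]) auto
qed

text \<open>
  The characteristic equation with the curve and its entry time eliminated. General initial values \<open>f0\<close>
  are admitted so that the difference of a state and a stationary state is covered as well.
\<close>

definition carried ::
  "(real \<Rightarrow> real \<Rightarrow> real) \<Rightarrow> (real \<Rightarrow> real \<Rightarrow> real) \<Rightarrow> (real \<Rightarrow> real) \<Rightarrow> (real \<Rightarrow> real) \<Rightarrow>
   real \<Rightarrow> real \<Rightarrow> bool" where
  "carried f g f0 v t x \<longleftrightarrow> (let k = t - \<theta> x in
     has_bochner_integral (lebesgue_on {max 0 k..t}) (\<lambda>s. g s (\<xi> (s - k)))
       (f t x - (if k \<le> 0 then f0 (\<xi> (- k)) else v k)))"

text \<open>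
  Along a characteristic, \<open>\<theta> (\<zeta> s) - s\<close> has derivative zero, hence the curve and its entry time are
  determined by the end point.
\<close>

lemma char_eq_iff_carried:
  assumes d0: "\<And>x. x \<in> {0..L} \<Longrightarrow> d0 x = d x" and x: "x \<in> {0..L}" and t: "0 \<le> t"
  shows "char_eq L \<eta> M d0 b i u r t x \<longleftrightarrow>
    carried (\<lambda>t x. r t x $ i) (\<lambda>t x. \<eta> * (M x *v r t x) $ i) (\<lambda>_. 0) (\<lambda>t. u t $ i) t x"
    (is "?l \<longleftrightarrow> ?r")
proof
  assume ?l
  then obtain a \<zeta> where a: "0 \<le> a" "a \<le> t"
    and \<zeta>: "\<And>s. s \<in> {a..t} \<Longrightarrow> \<zeta> s \<in> {0..L}"
      "\<And>s. s \<in> {a..t} \<Longrightarrow> (\<zeta> has_real_derivative d0 (\<zeta> s)) (at s within {a..t})"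
    and \<zeta>t: "\<zeta> t = x" and ab: "a = 0 \<or> \<zeta> a = b"
    and hb: "has_bochner_integral (lebesgue_on {a..t}) (\<lambda>s. \<eta> * (M (\<zeta> s) *v r s (\<zeta> s)) $ i)
          (r t x $ i - (if a = 0 then 0 else u a $ i))"
    unfolding char_eq_def by blast
  have "((\<lambda>s. \<theta> (\<zeta> s) - s) has_real_derivative 0) (at s within {a..t})" if "s \<in> {a..t}" for s
    using d_nz by (auto intro!: derivative_eq_intros DERIV_chain'[OF \<zeta>(2)[OF that] \<theta>_deriv]
        simp: d0[OF \<zeta>(1)[OF that]])
  then obtain c where c: "\<And>s. s \<in> {a..t} \<Longrightarrow> \<theta> (\<zeta> s) - s = c"
    using has_field_derivative_zero_constant[of "{a..t}" "\<lambda>s. \<theta> (\<zeta> s) - s"] by auto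
  define k where "k = t - \<theta> x"
  have "c = - k" using c[of t] a \<zeta>t by (simp add: k_def)
  then have \<theta>\<zeta>: "\<theta> (\<zeta> s) = s - k" if "s \<in> {a..t}" for s using c[OF that] by simp
  then have \<zeta>_eq: "\<zeta> s = \<xi> (s - k)" if "s \<in> {a..t}" for s using that by (metis \<xi>_\<theta>)
  have a_eq: "a = max 0 k"
  proof (cases "a = 0")
    case True
    then have "0 \<le> 0 - k" using \<theta>\<zeta>[of 0] \<theta>_range[of "\<zeta> 0"] \<zeta>(1)[of 0] a by auto
    then show ?thesis using True by simp
  next
    case False
    then have "a = k" using ab \<theta>\<zeta>[of a] a \<theta>_b by auto
    then show ?thesis using a by simp
  qed
  have "has_bochner_integral (lebesgue_on {max 0 k..t}) (\<lambda>s. \<eta> * (M (\<xi> (s - k)) *v r s (\<xi> (s - k))) $ i)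
          (r t x $ i - (if a = 0 then 0 else u a $ i))"
    using hb unfolding a_eq[symmetric]
    by (rule has_bochner_integral_cong[THEN iffD1, rotated -1]) (auto simp: \<zeta>_eq)
  then show ?r unfolding carried_def Let_def k_def[symmetric]
    using a_eq by (auto simp: max_def split: if_splits)
next
  assume r: ?r
  define k where "k = t - \<theta> x"
  have \<theta>x: "\<theta> x \<in> {0..\<Theta>}" using x \<theta>_range by blast
  have 1: "\<xi> (s - k) \<in> {0..L}" if "s \<in> {max 0 k..t}" for s
    using that \<theta>x \<xi>_range[of "s - k"] by (auto simp: k_def)
  have 2: "((\<lambda>s. \<xi> (s - k)) has_real_derivative d0 (\<xi> (s - k))) (at s within {max 0 k..t})" 
    if "s \<in> {max 0 k..t}" for s
    using d0[OF 1[OF that]] by (auto intro!: derivative_eq_intros DERIV_chain'[OF _ \<xi>_deriv, THEN DERIV_cong])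
  have 3: "r t x $ i - (if k \<le> 0 then 0 else u k $ i) 
      = r t x $ i - (if max 0 k = 0 then 0 else u (max 0 k) $ i)"
    by auto
  show ?l unfolding char_eq_def
  proof (intro exI[of _ "max 0 k"] exI[of _ "\<lambda>s. \<xi> (s - k)"] conjI ballI)
    show "max 0 k \<le> t" using t \<theta>x by (auto simp: k_def)
    show "\<xi> (t - k) = x" by (simp add: k_def)
    show "max 0 k = 0 \<or> \<xi> (max 0 k - k) = b" by (auto simp: \<xi>_0 max_def)
    show "has_bochner_integral (lebesgue_on {max 0 k..t})
     (\<lambda>s. \<eta> * (M (\<xi> (s - k)) *v r s (\<xi> (s - k))) $ i)
     (r t x $ i - (if max 0 k = 0 then 0 else u (max 0 k) $ i))"
      using r 3 unfolding carried_def Let_def k_def[symmetric] by simp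
  qed (use 1 2 in auto)
qed

end

section \<open>Transported quantities along almost every trajectory\<close>

context characteristics begin

definition L2_strip :: "real \<Rightarrow> (real \<times> real \<Rightarrow> real) \<Rightarrow> bool" where
  "L2_strip T f \<longleftrightarrow> f \<in> borel_measurable (lebesgue_on ({0..T} \<times> {0..L})) \<and>
     integrable (lebesgue_on ({0..T} \<times> {0..L})) (\<lambda>p. (f p)\<^sup>2)"

text \<open>
  The abstract hypothesis behind all energy and duality identities: \<open>f\<close> solves a scalar transport equation
  with source \<open>g\<close>, everything is square integrable, and the outflow trace is attained along
  characteristics. It is stable under differences, and stationary profiles satisfy it.
\<close>

definition transported ::
  "real \<Rightarrow> (real \<Rightarrow> real \<Rightarrow> real) \<Rightarrow> (real \<Rightarrow> real \<Rightarrow> real) \<Rightarrow> (real \<Rightarrow> real) \<Rightarrow> (real \<Rightarrow> real) \<Rightarrow> bool"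
where
  "transported T f g f0 v \<longleftrightarrow>
     L2_strip T (case_prod f) \<and> L2_strip T (case_prod g) \<and>
     L2_on {0..L} (f T) \<and> L2_on {0..T} (\<lambda>t. f t b') \<and> L2_on {0..L} f0 \<and> L2_on {0..T} v \<and>
     (\<forall>t\<in>{0..T}. AE x in lebesgue_on {0..L}. carried f g f0 v t x) \<and>
     (AE t in lebesgue_on {0..T}. carried f g f0 v t b')"

text \<open>
  \<open>F\<close> and \<open>G\<close> are Borel representatives of a quantity \<open>f\<close> and its source, \<open>\<iota>\<close> of its values where
  characteristics enter. At the exit time the formula is required for \<open>f\<close> itself, because the exit values are
  traces and do not depend on the choice of a representative.
\<close>

definition trajectory_formula ::
  "real \<Rightarrow> (real \<Rightarrow> real \<Rightarrow> real) \<Rightarrow> (real \<times> real \<Rightarrow> real) \<Rightarrow> (real \<times> real \<Rightarrow> real) \<Rightarrow> (real \<Rightarrow> real) \<Rightarrow>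
   real \<Rightarrow> bool" where
  "trajectory_formula T f F G \<iota> k \<longleftrightarrow>
      integrable lborel (\<lambda>s. indicator {max 0 k..min T (k + \<Theta>)} s * G (s, \<xi> (s - k))) \<and>
      f (min T (k + \<Theta>)) (\<xi> (min T (k + \<Theta>) - k))
        = \<iota> k + (LINT x|lborel. indicator {max 0 k..min T (k + \<Theta>)} x * G (x, \<xi> (x - k))) \<and>
      (AE s in lborel. s \<in> {max 0 k..min T (k + \<Theta>)} \<longrightarrow>
         F (s, \<xi> (s - k)) = \<iota> k + (LINT x|lborel. indicator {max 0 k..s} x * G (x, \<xi> (x - k))))"

text \<open>
  The characteristic equation is given for each time and almost every point; what is needed is, for almost
  every label \<open>k\<close>, an absolutely continuous function of time. The exchange of the quantifiers is Fubini's
  theorem for null sets, after the change of variable from points to labels. At the exit time only the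
  one equation at the final time or at the outflow boundary is used, which also provides the integrability of
  the source over the whole lifetime of the trajectory.
\<close>

lemma trajectories:
  assumes tr: "transported T f g f0 v" and T: "0 < T"
  obtains F G :: "real \<times> real \<Rightarrow> real" and \<iota> :: "real \<Rightarrow> real" where
    "F \<in> borel_measurable borel" "G \<in> borel_measurable borel" "\<iota> \<in> borel_measurable borel"
    "AE p in lborel. p \<in> {0..T} \<times> {0..L} \<longrightarrow> case_prod f p = F p"
    "AE p in lborel. p \<in> {0..T} \<times> {0..L} \<longrightarrow> case_prod g p = G p"
    "AE k in lborel. k \<in> {-\<Theta>..T} \<longrightarrow> \<iota> k = (if k \<le> 0 then f0 (\<xi> (- k)) else v k)"
    "AE k in lborel. k \<in> {-\<Theta>..T} \<longrightarrow>
      trajectory_formula T f F G \<iota> k"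
proof -
  let ?S = "{0..T} \<times> {0..L}"
  have S: "?S \<in> sets (borel :: (real \<times> real) measure)"
    by (intro borel_closed closed_Times) auto
  have L2: "L2_strip T (case_prod f)" "L2_strip T (case_prod g)" "L2_on {0..L} f0" "L2_on {0..T} v"
    and car: "\<And>t. t \<in> {0..T} \<Longrightarrow> AE x in lebesgue_on {0..L}. carried f g f0 v t x"
    and carb: "AE t in lebesgue_on {0..T}. carried f g f0 v t b'"
    using tr by (auto simp: transported_def)
  \<comment> \<open>Borel representatives are fixed first, and the exceptional set is covered by one Borel null set N.\<close>
  obtain F where F[measurable]: "F \<in> borel_measurable borel"
    and Fae: "AE p in lborel. p \<in> ?S \<longrightarrow> case_prod f p = F p"
    using L2(1) borel_representative[OF _ S] unfolding L2_strip_def by blast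
  obtain G where G[measurable]: "G \<in> borel_measurable borel"
    and Gae: "AE p in lborel. p \<in> ?S \<longrightarrow> case_prod g p = G p"
    using L2(2) borel_representative[OF _ S] unfolding L2_strip_def by blast
  have [measurable]: "F \<in> borel_measurable (borel \<Otimes>\<^sub>M borel)" "G \<in> borel_measurable (borel \<Otimes>\<^sub>M borel)"
    using F G by (simp_all add: borel_prod)
  obtain f0' where [measurable]: "f0' \<in> borel_measurable borel"
    and f0ae: "AE x in lborel. x \<in> {0..L} \<longrightarrow> f0 x = f0' x"
    using L2(3) borel_representative[OF _ borel_closed[OF closed_atLeastAtMost], of f0]
    unfolding L2_on_def by blast
  obtain v' where [measurable]: "v' \<in> borel_measurable borel"
    and vae: "AE x in lborel. x \<in> {0..T} \<longrightarrow> v x = v' x"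
    using L2(4) borel_representative[OF _ borel_closed[OF closed_atLeastAtMost], of v]
    unfolding L2_on_def by blast
  define \<iota> where "\<iota> k = (if k \<le> 0 then f0' (\<xi> (- k)) else v' k)" for k
  have \<iota>[measurable]: "\<iota> \<in> borel_measurable borel"
    unfolding \<iota>_def[abs_def] by measurable
  have \<iota>ae: "AE k in lborel. k \<in> {-\<Theta>..T} \<longrightarrow> \<iota> k = (if k \<le> 0 then f0 (\<xi> (- k)) else v k)"
    using AE_label[OF f0ae, of 0] vae
  proof eventually_elim
    case (elim k)
    then show ?case using \<xi>_range[of "- k"] by (auto simp: \<iota>_def)
  qed

  have "AE p in lborel. p \<in> ?S \<longrightarrow> case_prod f p = F p \<and> case_prod g p = G p"
    using Fae Gae by eventually_elim auto
  then obtain N where N: "N \<in> null_sets (lborel :: (real \<times> real) measure)"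
    and Nsub: "{p. \<not> (p \<in> ?S \<longrightarrow> case_prod f p = F p \<and> case_prod g p = G p)} \<subseteq> N"
    by (auto simp: eventually_ae_filter)
  have FG: "f s x = F (s, x)" "g s x = G (s, x)" if "(s, x) \<notin> N" "s \<in> {0..T}" "x \<in> {0..L}" for s x
  proof -
    have "(s, x) \<notin> {p. \<not> (p \<in> ?S \<longrightarrow> case_prod f p = F p \<and> case_prod g p = G p)}"
      using Nsub that(1) by blast
    then show "f s x = F (s, x)" "g s x = G (s, x)" using that(2,3) by auto
  qed
  have Nset[measurable]: "N \<in> sets (borel \<Otimes>\<^sub>M borel)"
    using N unfolding borel_prod by auto
  have "AE p in lborel \<Otimes>\<^sub>M lborel. p \<notin> N"
    using AE_not_in[OF N] unfolding lborel_prod .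
  then have "AE s in lborel. AE x in lborel. (s, x) \<notin> N"
    by (rule lborel_pair.AE_pair)
  then have Nsk: "AE s in lborel. AE k in lborel. (s, \<xi> (s - k)) \<notin> N"
    by eventually_elim (rule AE_label)
  have "Measurable.pred (lborel \<Otimes>\<^sub>M lborel) (\<lambda>p. (fst p, \<xi> (fst p - snd p)) \<notin> N)"
    by measurable
  with Nsk have Nks: "AE k in lborel. AE s in lborel. (s, \<xi> (s - k)) \<notin> N"
    by (rule AE_lborel_swap)

  \<comment> \<open>The equation at a single point can be read off for the representative G, because almost every
    trajectory meets the null set N only at a null set of times.\<close>
  have point: "f t (\<xi> (t - k)) = \<iota> k + (LINT x|lborel. indicator {max 0 k..t} x * G (x, \<xi> (x - k)))"
      "integrable lborel (\<lambda>s. indicator {max 0 k..t} s * G (s, \<xi> (s - k)))"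
    if "carried f g f0 v t (\<xi> (t - k))" "AE s in lborel. (s, \<xi> (s - k)) \<notin> N"
      "\<iota> k = (if k \<le> 0 then f0 (\<xi> (- k)) else v k)" "t \<in> {0..T}" "t - k \<in> {0..\<Theta>}" for t k
  proof -
    have "AE s in lborel. s \<in> {max 0 k..t} \<longrightarrow> g s (\<xi> (s - k)) = G (s, \<xi> (s - k))"
      using that(2)
    proof eventually_elim
      case (elim s)
      then show ?case using FG(2)[OF elim] \<xi>_range[of "s - k"] that(4,5) by auto
    qed
    then have "has_bochner_integral lborel (\<lambda>s. indicator {max 0 k..t} s * G (s, \<xi> (s - k)))
       (f t (\<xi> (t - k)) - \<iota> k)"
      using that(1) unfolding carried_def Let_def \<theta>_\<xi> that(3)
      by (subst (asm) has_bochner_integral_lebesgue_on_iff[where F = "\<lambda>s. G (s, \<xi> (s - k))"]) auto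
    then show "f t (\<xi> (t - k)) = \<iota> k + (LINT x|lborel. indicator {max 0 k..t} x * G (x, \<xi> (x - k)))"
      "integrable lborel (\<lambda>s. indicator {max 0 k..t} s * G (s, \<xi> (s - k)))"
      by (auto simp: has_bochner_integral_iff)
  qed

  have car_k: "AE k in lborel. t - k \<in> {0..\<Theta>} \<longrightarrow> carried f g f0 v t (\<xi> (t - k))" if "t \<in> {0..T}" for t
    using AE_label[OF car[OF that, unfolded AE_lebesgue_on_iff[OF borel_closed[OF closed_atLeastAtMost]]], of t]
    by eventually_elim (use \<xi>_range in blast)

  \<comment> \<open>First for each time and almost every label, where the equation is given; then the quantifiers are swapped.\<close>
  have "AE s in lborel. AE k in lborel. s \<in> {0..T} \<and> s - k \<in> {0..\<Theta>} \<longrightarrow>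
      F (s, \<xi> (s - k)) = \<iota> k + (LINT x|lborel. indicator {max 0 k..s} x * G (x, \<xi> (x - k)))"
    using Nsk
  proof eventually_elim
    case (elim s)
    show ?case
    proof (cases "s \<in> {0..T}")
      case True
      show ?thesis using car_k[OF True] elim Nks \<iota>ae
      proof eventually_elim
        case (elim k)
        show ?case
        proof
          assume s: "s \<in> {0..T} \<and> s - k \<in> {0..\<Theta>}"
          then have "\<iota> k = (if k \<le> 0 then f0 (\<xi> (- k)) else v k)" using elim by auto
          from point(1)[of s k, OF _ _ this] FG(1)[of s "\<xi> (s - k)"] elim s \<xi>_range[of "s - k"]
          show "F (s, \<xi> (s - k)) = \<iota> k + (LINT x|lborel. indicator {max 0 k..s} x * G (x, \<xi> (x - k)))"
            by auto
        qed
      qed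
    qed auto
  qed
  moreover have "Measurable.pred (lborel \<Otimes>\<^sub>M lborel) (\<lambda>p. fst p \<in> {0..T} \<and> fst p - snd p \<in> {0..\<Theta>} \<longrightarrow>
      F (fst p, \<xi> (fst p - snd p)) = \<iota> (snd p) +
        (LINT x|lborel. indicator {max 0 (snd p)..fst p} x * G (x, \<xi> (x - snd p))))"
    unfolding indicator_def atLeastAtMost_iff by measurable
  ultimately have traj: "AE k in lborel. AE s in lborel. s \<in> {0..T} \<and> s - k \<in> {0..\<Theta>} \<longrightarrow>
      F (s, \<xi> (s - k)) = \<iota> k + (LINT x|lborel. indicator {max 0 k..s} x * G (x, \<xi> (x - k)))"
    by (rule AE_lborel_swap)

  have "AE k in lborel. k + \<Theta> \<in> {0..T} \<longrightarrow> carried f g f0 v (k + \<Theta>) b'"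
    by (rule AE_lborel_compose[OF carb[unfolded AE_lebesgue_on_iff[OF borel_closed[OF closed_atLeastAtMost]]],
          where j = "\<lambda>t. t - \<Theta>" and j' = "\<lambda>_. 1"]) (auto intro!: derivative_eq_intros)
  moreover have "AE k in lborel. T - k \<in> {0..\<Theta>} \<longrightarrow> carried f g f0 v T (\<xi> (T - k))"
    using T by (intro car_k) simp
  ultimately have fin: "AE k in lborel. k \<in> {-\<Theta>..T} \<longrightarrow> carried f g f0 v (min T (k + \<Theta>)) (\<xi> (min T (k + \<Theta>) - k))"
    by eventually_elim (auto simp: min_def \<xi>_\<Theta>)

  show ?thesis
  proof (rule that[OF F G \<iota> Fae Gae \<iota>ae])
    show "AE k in lborel. k \<in> {-\<Theta>..T} \<longrightarrow>
      trajectory_formula T f F G \<iota> k"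
      using fin Nks \<iota>ae traj
    proof eventually_elim
      case (elim k)
      show ?case
      proof
        assume k: "k \<in> {-\<Theta>..T}"
        have e: "min T (k + \<Theta>) \<in> {0..T}" "min T (k + \<Theta>) - k \<in> {0..\<Theta>}"
          using k T \<Theta>_pos by (auto simp: min_def)
        have p: "integrable lborel (\<lambda>s. indicator {max 0 k..min T (k + \<Theta>)} s * G (s, \<xi> (s - k)))"
          "f (min T (k + \<Theta>)) (\<xi> (min T (k + \<Theta>) - k))
            = \<iota> k + (LINT x|lborel. indicator {max 0 k..min T (k + \<Theta>)} x * G (x, \<xi> (x - k)))"
          using point[OF _ elim(2) _ e] elim(1,3) k by auto
        have "AE s in lborel. s \<in> {max 0 k..min T (k + \<Theta>)} \<longrightarrow>
         F (s, \<xi> (s - k)) = \<iota> k + (LINT x|lborel. indicator {max 0 k..s} x * G (x, \<xi> (x - k)))"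
          using elim(4) by eventually_elim (auto simp: min_def max_def split: if_splits)
        with p show "trajectory_formula T f F G \<iota> k"
          unfolding trajectory_formula_def by blast
      qed
    qed
  qed
qed

end

section \<open>The balance law for products of transported quantities\<close>

lemma weighted_product_along_trajectory:
  fixes F1 F2 G1 G2 \<Psi> \<Psi>' :: "real \<Rightarrow> real"
  assumes "a \<le> e"
    and [measurable]: "F1 \<in> borel_measurable borel" "G1 \<in> borel_measurable borel"
      "F2 \<in> borel_measurable borel" "G2 \<in> borel_measurable borel"
    and int: "integrable lborel (\<lambda>s. indicator {a..e} s * G1 s)"
      "integrable lborel (\<lambda>s. indicator {a..e} s * G2 s)"
    and F1: "AE s in lborel. s \<in> {a..e} \<longrightarrow> F1 s = P1 s"
    and P1: "\<And>s. P1 s = i1 + (LINT x|lborel. indicator {a..s} x * G1 x)"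
    and F2: "AE s in lborel. s \<in> {a..e} \<longrightarrow> F2 s = P2 s"
    and P2: "\<And>s. P2 s = i2 + (LINT x|lborel. indicator {a..s} x * G2 x)"
    and \<Psi>: "\<And>s. s \<in> {a..e} \<Longrightarrow> (\<Psi> has_real_derivative \<Psi>' s) (at s within {a..e})"
    and \<Psi>': "continuous_on {a..e} \<Psi>'"
  shows "has_bochner_integral lborel
    (\<lambda>s. indicator {a..e} s * (\<Psi>' s * (F1 s * F2 s) + \<Psi> s * (F1 s * G2 s + G1 s * F2 s)))
    (\<Psi> e * (P1 e * P2 e) - \<Psi> a * (i1 * i2))"
proof -
  have \<Psi>_cont: "continuous_on {a..e} \<Psi>"
    using \<Psi> by (meson DERIV_continuous_on)
  define \<psi> where "\<psi> s = indicator {a..e} s * \<Psi> s" for s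
  define \<psi>' where "\<psi>' s = indicator {a..e} s * \<Psi>' s" for s
  have [measurable]: "\<psi> \<in> borel_measurable borel" "\<psi>' \<in> borel_measurable borel"
    using borel_measurable_continuous_on_indicator[OF _ \<Psi>_cont]
      borel_measurable_continuous_on_indicator[OF _ \<Psi>']
    by (simp_all add: \<psi>_def[abs_def] \<psi>'_def[abs_def])
  have [measurable]: "P1 \<in> borel_measurable borel" "P2 \<in> borel_measurable borel"
    unfolding P1[abs_def] P2[abs_def] indicator_def atLeastAtMost_iff by measurable
  have sub: "integrable lborel (\<lambda>s. indicator {a..u} s * h s)"
    if "u \<in> {a..e}" "integrable lborel (\<lambda>s. indicator {a..e} s * h s)" "h \<in> borel_measurable borel"
    for u and h :: "real \<Rightarrow> real"
    using that by (intro Bochner_Integration.integrable_bound[OF that(2)]) (auto split: split_indicator)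
  define h where "h s = G1 s * P2 s + P1 s * G2 s" for s
  have [measurable]: "h \<in> borel_measurable borel" by (simp add: h_def[abs_def])
  have h: "has_bochner_integral lborel (\<lambda>s. indicator {a..u} s * h s) (P1 u * P2 u - i1 * i2)"
    if "u \<in> {a..e}" for u
    unfolding h_def using that
    by (intro product_rule_indefinite_integrals sub[OF that] int P1 P2) auto
  have FTC: "has_bochner_integral lborel (\<lambda>s. indicator {a..u} s * \<psi>' s) (\<Psi> u - \<Psi> a)"
    if "u \<in> {a..e}" for u
  proof -
    have "has_bochner_integral lborel (\<lambda>s. indicator {a..u} s *\<^sub>R \<Psi>' s) (\<Psi> u - \<Psi> a)"
    proof (rule has_bochner_integral_FTC_Icc)
      fix x assume "a \<le> x" "x \<le> u"
      then show "(\<Psi> has_vector_derivative \<Psi>' x) (at x within {a..u})"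
        using that \<Psi>[of x] by (auto simp: has_real_derivative_iff_has_vector_derivative
            intro: has_vector_derivative_within_subset)
    qed (use that \<Psi>' in \<open>auto intro: continuous_on_subset\<close>)
    then show ?thesis
      by (rule has_bochner_integral_cong[THEN iffD1, rotated -1])
         (use that in \<open>auto simp: \<psi>'_def split: split_indicator\<close>)
  qed
  have "has_bochner_integral lborel (\<lambda>s. indicator {a..e} s * (\<psi>' s * (P1 s * P2 s) + \<Psi> s * h s))
    (\<Psi> e * (P1 e * P2 e) - \<Psi> a * (i1 * i2))"
  proof (rule product_rule_indefinite_integrals)
    show "\<Psi> s = \<Psi> a + (LINT x|lborel. indicator {a..s} x * \<psi>' x)" if "s \<in> {a..e}" for s
      using FTC[OF that] by (simp add: has_bochner_integral_iff)
    show "P1 s * P2 s = i1 * i2 + (LINT x|lborel. indicator {a..s} x * h x)" if "s \<in> {a..e}" for s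
      using h[OF that] by (simp add: has_bochner_integral_iff)
  qed (use FTC[of e] h[of e] \<open>a \<le> e\<close> in \<open>auto simp: has_bochner_integral_iff\<close>)
  then have "has_bochner_integral lborel (\<lambda>s. indicator {a..e} s * (\<psi>' s * (P1 s * P2 s) + \<psi> s * h s))
    (\<Psi> e * (P1 e * P2 e) - \<Psi> a * (i1 * i2))"
    by (rule has_bochner_integral_cong[THEN iffD1, rotated -1]) (auto simp: \<psi>_def split: split_indicator)
  moreover have "AE s in lborel. indicator {a..e} s * (\<psi>' s * (P1 s * P2 s) + \<psi> s * h s)
     = indicator {a..e} s * (\<psi>' s * (F1 s * F2 s) + \<psi> s * (F1 s * G2 s + G1 s * F2 s))"
    using F1 F2 by eventually_elim (auto simp: h_def split: split_indicator)
  ultimately have "has_bochner_integral lborel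
    (\<lambda>s. indicator {a..e} s * (\<psi>' s * (F1 s * F2 s) + \<psi> s * (F1 s * G2 s + G1 s * F2 s)))
    (\<Psi> e * (P1 e * P2 e) - \<Psi> a * (i1 * i2))"
    by (subst (asm) has_bochner_integral_cong_AE) auto
  then show ?thesis
    by (rule has_bochner_integral_cong[THEN iffD1, rotated -1])
      (auto simp: \<psi>_def \<psi>'_def split: split_indicator)
qed

lemma continuous_on_Icc_bounded:
  fixes w :: "real \<Rightarrow> real"
  assumes "continuous_on {a..b} w"
  obtains B where "\<And>x. x \<in> {a..b} \<Longrightarrow> \<bar>w x\<bar> \<le> B"
proof -
  have "bounded (w ` {a..b})"
    using assms compact_Icc by (intro compact_imp_bounded compact_continuous_image)
  then obtain B where "\<forall>x\<in>{a..b}. \<bar>w x\<bar> \<le> B" by (auto simp: bounded_iff)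
  then show ?thesis by (intro that) blast
qed

lemma abs_mult_le_sum_squares: "\<bar>x * y\<bar> \<le> x\<^sup>2 + y\<^sup>2" for x y :: real
proof -
  have "2 * (\<bar>x\<bar> * \<bar>y\<bar>) \<le> x\<^sup>2 + y\<^sup>2"
    using sum_squares_bound[of "\<bar>x\<bar>" "\<bar>y\<bar>"] by simp
  then show ?thesis unfolding abs_mult by (smt (verit) mult_nonneg_nonneg abs_ge_zero)
qed

lemma L2_on_mult_integrable:
  fixes f g :: "real \<Rightarrow> real"
  assumes "L2_on S f" "L2_on S g"
  shows "integrable (lebesgue_on S) (\<lambda>p. f p * g p)"
proof (rule Bochner_Integration.integrable_bound)
  show "integrable (lebesgue_on S) (\<lambda>p. (f p)\<^sup>2 + (g p)\<^sup>2)"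
    using assms by (auto simp: L2_on_def)
  show "(\<lambda>p. f p * g p) \<in> borel_measurable (lebesgue_on S)"
    using assms by (auto simp: L2_on_def)
  show "AE p in lebesgue_on S. norm (f p * g p) \<le> norm ((f p)\<^sup>2 + (g p)\<^sup>2)"
    using abs_mult_le_sum_squares by auto
qed

context characteristics begin

lemma strip_borel: "{0..T::real} \<times> {0..L} \<in> sets (borel :: (real \<times> real) measure)"
  by (intro borel_closed closed_Times) auto

lemma strip_lebesgue: "{0..T::real} \<times> {0..L} \<in> sets (lebesgue :: (real \<times> real) measure)"
proof (rule sets_completionI_sets)
  show "{0..T} \<times> {0..L} \<in> sets (lborel :: (real \<times> real) measure)"
    unfolding sets_lborel by (rule strip_borel)
qed

lemma L2_strip_mult_integrable:
  assumes "L2_strip T f" "L2_strip T g"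
  shows "integrable (lebesgue_on ({0..T} \<times> {0..L})) (\<lambda>p. f p * g p)"
proof (rule Bochner_Integration.integrable_bound)
  show "integrable (lebesgue_on ({0..T} \<times> {0..L})) (\<lambda>p. (f p)\<^sup>2 + (g p)\<^sup>2)"
    using assms by (auto simp: L2_strip_def)
  show "(\<lambda>p. f p * g p) \<in> borel_measurable (lebesgue_on ({0..T} \<times> {0..L}))"
    using assms by (auto simp: L2_strip_def)
  show "AE p in lebesgue_on ({0..T} \<times> {0..L}). norm (f p * g p) \<le> norm ((f p)\<^sup>2 + (g p)\<^sup>2)"
    using abs_mult_le_sum_squares by auto
qed

lemma continuous_mult_integrable:
  fixes w :: "real \<Rightarrow> real" and T :: real
  assumes f: "integrable (lebesgue_on ({0..T} \<times> {0..L})) f" and w: "continuous_on {0..L} w"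
  shows "integrable (lebesgue_on ({0..T} \<times> {0..L})) (\<lambda>p. w (snd p) * f p)"
proof -
  obtain B where B: "\<And>x. x \<in> {0..L} \<Longrightarrow> \<bar>w x\<bar> \<le> B"
    by (rule continuous_on_Icc_bounded[OF w]) blast
  have "0 \<le> B" using B[of 0] L_pos by auto
  have "continuous_on ({0..T} \<times> {0..L}) (\<lambda>p. w (snd p))"
    by (rule continuous_on_compose2[OF w]) (auto intro!: continuous_intros)
  then have [measurable]: "(\<lambda>p. w (snd p)) \<in> borel_measurable (lebesgue_on ({0..T} \<times> {0..L}))"
    by (rule continuous_imp_measurable_on_sets_lebesgue) (rule strip_lebesgue)
  have "norm (w (snd p) * f p) \<le> norm (B * f p)" if "p \<in> {0..T} \<times> {0..L}" for p
    using B[of "snd p"] that \<open>0 \<le> B\<close> by (auto simp: abs_mult intro!: mult_right_mono)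
  then have "AE p in lebesgue_on ({0..T} \<times> {0..L}). norm (w (snd p) * f p) \<le> norm (B * f p)"
    by (intro AE_I2) auto
  then show ?thesis
    by (rule Bochner_Integration.integrable_bound[rotated 2]) (use f in auto)
qed

text \<open>
  Integrated form of the transport equation for a product \<open>f1 * f2\<close> with weight \<open>\<psi>\<close>. On almost every
  trajectory the product rule applies, and the identity follows by integrating over the labels:
  the exit values with \<open>k + \<Theta> < T\<close> form the outflow trace and the others the state at time \<open>T\<close>, the entry
  values with \<open>k > 0\<close> are the inflow and the others the initial state. Fubini's theorem together with
  \<open>dk = dx / \<bar>d\<bar>\<close> turns the source into an integral over the strip. Taking \<open>f2 = f1\<close> gives the energy
  identity, taking \<open>f2 = 1\<close> the duality identity.
\<close>

lemma balance_law:
  assumes tr1: "transported T f1 g1 p1 v1" and tr2: "transported T f2 g2 p2 v2" and T: "0 < T"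
    and \<psi>: "\<And>x. x \<in> {0..L} \<Longrightarrow> (\<psi> has_real_derivative \<psi>' x) (at x within {0..L})"
    and \<psi>': "continuous_on {0..L} \<psi>'"
  defines "h \<equiv> \<lambda>(t, x). (\<psi>' x * d x * (f1 t x * f2 t x)
      + \<psi> x * (f1 t x * g2 t x + g1 t x * f2 t x)) / \<bar>d x\<bar>"
  shows "integrable (lebesgue_on ({0..T} \<times> {0..L})) h" (is ?int)
    and "(LINT p|lebesgue_on ({0..T} \<times> {0..L}). h p) =
      (LINT x|lebesgue_on {0..L}. \<psi> x * (f1 T x * f2 T x) / \<bar>d x\<bar>)
      - (LINT x|lebesgue_on {0..L}. \<psi> x * (p1 x * p2 x) / \<bar>d x\<bar>)
      + \<psi> b' * (LINT t|lebesgue_on {0..T}. f1 t b' * f2 t b')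
      - \<psi> b * (LINT t|lebesgue_on {0..T}. v1 t * v2 t)" (is ?eq)
proof -
  let ?S = "{0..T} \<times> {0..L}"
  have \<psi>_cont: "continuous_on {0..L} \<psi>"
    using \<psi> by (meson DERIV_continuous_on)
  have d_cont': "continuous_on A d" for A
    using d_cont continuous_on_subset by blast
  note L2 = tr1[unfolded transported_def] tr2[unfolded transported_def]
  have ff: "integrable (lebesgue_on ?S) (\<lambda>p. case_prod f1 p * case_prod f2 p)"
    and fg: "integrable (lebesgue_on ?S) (\<lambda>p. case_prod f1 p * case_prod g2 p)"
    and gf: "integrable (lebesgue_on ?S) (\<lambda>p. case_prod g1 p * case_prod f2 p)"
    using L2 by (auto intro: L2_strip_mult_integrable)
  have "integrable (lebesgue_on ?S) (\<lambda>p. \<psi>' (snd p) * d (snd p) / \<bar>d (snd p)\<bar> * (case_prod f1 p * case_prod f2 p)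
     + \<psi> (snd p) / \<bar>d (snd p)\<bar> * (case_prod f1 p * case_prod g2 p)
     + \<psi> (snd p) / \<bar>d (snd p)\<bar> * (case_prod g1 p * case_prod f2 p))"
    using d_nz \<psi>' \<psi>_cont
    by (intro Bochner_Integration.integrable_add continuous_mult_integrable ff fg gf)
       (auto intro!: continuous_intros d_cont' \<psi>' \<psi>_cont)
  also have "(\<lambda>p. \<psi>' (snd p) * d (snd p) / \<bar>d (snd p)\<bar> * (case_prod f1 p * case_prod f2 p)
     + \<psi> (snd p) / \<bar>d (snd p)\<bar> * (case_prod f1 p * case_prod g2 p)
     + \<psi> (snd p) / \<bar>d (snd p)\<bar> * (case_prod g1 p * case_prod f2 p)) = h"
    by (auto simp: h_def fun_eq_iff field_simps d_nz)
  finally show hint: ?int .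

  obtain F1 G1 \<iota>1 where [measurable]: "F1 \<in> borel_measurable borel" "G1 \<in> borel_measurable borel" "\<iota>1 \<in> borel_measurable borel"
    and F1: "AE p in lborel. p \<in> ?S \<longrightarrow> case_prod f1 p = F1 p"
    and G1: "AE p in lborel. p \<in> ?S \<longrightarrow> case_prod g1 p = G1 p"
    and \<iota>1: "AE k in lborel. k \<in> {-\<Theta>..T} \<longrightarrow> \<iota>1 k = (if k \<le> 0 then p1 (\<xi> (- k)) else v1 k)"
    and traj1: "AE k in lborel. k \<in> {-\<Theta>..T} \<longrightarrow>
      trajectory_formula T f1 F1 G1 \<iota>1 k"
    by (rule trajectories[OF tr1 T])
  obtain F2 G2 \<iota>2 where [measurable]: "F2 \<in> borel_measurable borel" "G2 \<in> borel_measurable borel" "\<iota>2 \<in> borel_measurable borel"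
    and F2: "AE p in lborel. p \<in> ?S \<longrightarrow> case_prod f2 p = F2 p"
    and G2: "AE p in lborel. p \<in> ?S \<longrightarrow> case_prod g2 p = G2 p"
    and \<iota>2: "AE k in lborel. k \<in> {-\<Theta>..T} \<longrightarrow> \<iota>2 k = (if k \<le> 0 then p2 (\<xi> (- k)) else v2 k)"
    and traj2: "AE k in lborel. k \<in> {-\<Theta>..T} \<longrightarrow>
      trajectory_formula T f2 F2 G2 \<iota>2 k"
    by (rule trajectories[OF tr2 T])
  have [measurable]: "F1 \<in> borel_measurable (borel \<Otimes>\<^sub>M borel)" "G1 \<in> borel_measurable (borel \<Otimes>\<^sub>M borel)"
    "F2 \<in> borel_measurable (borel \<Otimes>\<^sub>M borel)" "G2 \<in> borel_measurable (borel \<Otimes>\<^sub>M borel)"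
    by (simp_all add: borel_prod)
  define w where "w x = indicator {0..L} x * \<psi> x" for x
  define w' where "w' x = indicator {0..L} x * \<psi>' x" for x
  have [measurable]: "w \<in> borel_measurable borel" "w' \<in> borel_measurable borel"
    using borel_measurable_continuous_on_indicator[OF _ \<psi>_cont]
      borel_measurable_continuous_on_indicator[OF _ \<psi>']
    by (simp_all add: w_def[abs_def] w'_def[abs_def])
  define H where "H s x = w' x * d x * (F1 (s, x) * F2 (s, x))
      + w x * (F1 (s, x) * G2 (s, x) + G1 (s, x) * F2 (s, x))" for s x
  have H[measurable]: "(\<lambda>p. H (fst p) (snd p)) \<in> borel_measurable (borel \<Otimes>\<^sub>M borel)"
    unfolding H_def by measurable
  have Hs[measurable]: "(\<lambda>x. H s x) \<in> borel_measurable borel" for s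
    unfolding H_def by measurable
  define Q where "Q p = indicator ?S p * (H (fst p) (snd p) / \<bar>d (snd p)\<bar>)" for p
  have hH: "AE p in lborel. p \<in> ?S \<longrightarrow> h p = H (fst p) (snd p) / \<bar>d (snd p)\<bar>"
    using F1 G1 F2 G2 by eventually_elim (auto simp: h_def H_def w_def w'_def)
  have Hb: "(\<lambda>p. H (fst p) (snd p) / \<bar>d (snd p)\<bar>) \<in> borel_measurable borel"
    unfolding borel_prod[symmetric] by measurable
  have Q: "integrable (lborel \<Otimes>\<^sub>M lborel) Q" "(LINT p|lebesgue_on ?S. h p) = (LINT p|(lborel \<Otimes>\<^sub>M lborel). Q p)"
    using hint LINT_lebesgue_on_eq[OF strip_borel Hb hH] integrable_lebesgue_on_iff[OF strip_borel Hb hH]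
    unfolding lborel_prod Q_def[abs_def] by auto
  \<comment> \<open>Q is the integrand on the strip, K the same integrand as a function of time and label.\<close>
  define K where "K s k = indicator {0..T} s * (indicator {0..\<Theta>} (s - k) * H s (\<xi> (s - k)))" for s k
  have [measurable]: "(\<lambda>p. K (fst p) (snd p)) \<in> borel_measurable (borel \<Otimes>\<^sub>M borel)"
    "(\<lambda>p. K (snd p) (fst p)) \<in> borel_measurable (borel \<Otimes>\<^sub>M borel)"
    unfolding K_def H_def by measurable
  have sect: "AE s in lborel. integrable lborel (K s) \<and>
      (LINT k|lborel. K s k) = (LINT x|lborel. Q (s, x)) \<and>
      (LINT k|lborel. norm (K s k)) = (LINT x|lborel. norm (Q (s, x)))"
    using lborel_pair.AE_integrable_fst'[OF Q(1)]
  proof eventually_elim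
    case (elim s)
    have 1: "has_bochner_integral lborel (\<lambda>x. indicator {0..L} x * (indicator {0..T} s * H s x / \<bar>d x\<bar>)) v \<longleftrightarrow>
       has_bochner_integral lborel (\<lambda>k. indicator {0..\<Theta>} (s - k) * (indicator {0..T} s * H s (\<xi> (s - k)))) v" for v
      by (rule has_bochner_integral_label_borel) measurable
    have 2: "has_bochner_integral lborel (\<lambda>x. indicator {0..L} x * (\<bar>indicator {0..T} s * H s x\<bar> / \<bar>d x\<bar>)) v \<longleftrightarrow>
       has_bochner_integral lborel (\<lambda>k. indicator {0..\<Theta>} (s - k) * \<bar>indicator {0..T} s * H s (\<xi> (s - k))\<bar>) v" for v
      by (rule has_bochner_integral_label_borel) measurable
    have e: "(\<lambda>x. indicator {0..L} x * (indicator {0..T} s * H s x / \<bar>d x\<bar>)) = (\<lambda>x. Q (s, x))"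
      "(\<lambda>x. indicator {0..L} x * (\<bar>indicator {0..T} s * H s x\<bar> / \<bar>d x\<bar>)) = (\<lambda>x. norm (Q (s, x)))"
      "(\<lambda>k. indicator {0..\<Theta>} (s - k) * (indicator {0..T} s * H s (\<xi> (s - k)))) = K s"
      "(\<lambda>k. indicator {0..\<Theta>} (s - k) * \<bar>indicator {0..T} s * H s (\<xi> (s - k))\<bar>) = (\<lambda>k. norm (K s k))"
      by (auto simp: Q_def K_def fun_eq_iff split: split_indicator)
    show ?case using 1 2 elim integrable_norm[OF elim] unfolding e
      by (metis has_bochner_integral_iff)
  qed
  have Kint: "integrable (lborel \<Otimes>\<^sub>M lborel) (\<lambda>p. K (fst p) (snd p))"
  proof (rule lborel_pair.Fubini_integrable)
    show "integrable lborel (\<lambda>x. LINT y|lborel. norm (K (fst (x, y)) (snd (x, y))))"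
    proof (rule integrable_cong_AE_imp)
      show "integrable lborel (\<lambda>s. LINT x|lborel. norm (Q (s, x)))"
        by (rule lborel_pair.integrable_fst'[OF integrable_norm[OF Q(1)]])
      show "(\<lambda>x. LINT y|lborel. norm (K (fst (x, y)) (snd (x, y)))) \<in> borel_measurable lborel"
        by measurable
      show "AE x in lborel. (LINT y|lborel. norm (Q (x, y))) = (LINT y|lborel. norm (K (fst (x, y)) (snd (x, y))))"
        using sect by eventually_elim simp
    qed
    show "AE x in lborel. integrable lborel (\<lambda>y. K (fst (x, y)) (snd (x, y)))"
      using sect by eventually_elim simp
  qed measurable
  have "(LINT p|(lborel \<Otimes>\<^sub>M lborel). Q p) = (LINT s|lborel. LINT x|lborel. Q (s, x))"
    by (rule lborel_pair.integral_fst'[OF Q(1), symmetric])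
  also have "\<dots> = (LINT s|lborel. LINT k|lborel. K s k)"
  proof (rule integral_cong_AE)
    show "(\<lambda>s. LINT x|lborel. Q (s, x)) \<in> borel_measurable lborel"
      using lborel_pair.integrable_fst'[OF Q(1)] by simp
    show "AE x in lborel. (LINT y|lborel. Q (x, y)) = integral\<^sup>L lborel (K x)"
      using sect by eventually_elim simp
    show "(\<lambda>s. integral\<^sup>L lborel (K s)) \<in> borel_measurable lborel"
      using lborel_pair.integrable_fst'[OF Kint] by simp
  qed
  also have "\<dots> = (LINT p|(lborel \<Otimes>\<^sub>M lborel). K (fst p) (snd p))"
    using lborel_pair.integral_fst'[OF Kint] by simp
  also have "\<dots> = (LINT k|lborel. LINT s|lborel. K s k)"
    using lborel_pair.integral_snd[of "\<lambda>s k. K s k"] Kint by (simp add: split_beta')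
  finally have lhs: "(LINT p|lebesgue_on ?S. h p) = (LINT k|lborel. LINT s|lborel. K s k)"
    using Q(2) by simp

  \<comment> \<open>For fixed label, the integral over time is the increment of the weighted product between entry and exit.\<close>
  have tr: "AE k in lborel. k \<in> {-\<Theta>..T} \<longrightarrow> (LINT s|lborel. K s k) =
      \<psi> (\<xi> (min T (k + \<Theta>) - k)) * (f1 (min T (k + \<Theta>)) (\<xi> (min T (k + \<Theta>) - k))
        * f2 (min T (k + \<Theta>)) (\<xi> (min T (k + \<Theta>) - k)))
      - \<psi> (\<xi> (max 0 k - k)) * ((if k \<le> 0 then p1 (\<xi> (- k)) else v1 k) * (if k \<le> 0 then p2 (\<xi> (- k)) else v2 k))"
    using traj1 traj2 \<iota>1 \<iota>2
  proof eventually_elim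
    case (elim k)
    show ?case
    proof
      assume k: "k \<in> {-\<Theta>..T}"
      define a e where "a = max 0 k" and "e = min T (k + \<Theta>)"
      have ae: "a \<le> e" using k T \<Theta>_pos by (auto simp: a_def e_def)
      have iff: "s \<in> {a..e} \<longleftrightarrow> s \<in> {0..T} \<and> s - k \<in> {0..\<Theta>}" for s
        by (auto simp: a_def e_def)
      have x_in: "\<xi> (s - k) \<in> {0..L}" if "s \<in> {a..e}" for s
        using iff that \<xi>_range by blast
      have img: "(\<lambda>s. \<xi> (s - k)) ` {a..e} \<subseteq> {0..L}" using x_in by blast
      have "has_bochner_integral lborel (\<lambda>s. indicator {a..e} s *
          (\<psi>' (\<xi> (s - k)) * d (\<xi> (s - k)) * (F1 (s, \<xi> (s - k)) * F2 (s, \<xi> (s - k)))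
           + \<psi> (\<xi> (s - k)) * (F1 (s, \<xi> (s - k)) * G2 (s, \<xi> (s - k)) + G1 (s, \<xi> (s - k)) * F2 (s, \<xi> (s - k)))))
        (\<psi> (\<xi> (e - k)) * ((\<iota>1 k + (LINT x|lborel. indicator {a..e} x * G1 (x, \<xi> (x - k))))
          * (\<iota>2 k + (LINT x|lborel. indicator {a..e} x * G2 (x, \<xi> (x - k)))))
         - \<psi> (\<xi> (a - k)) * (\<iota>1 k * \<iota>2 k))"
      proof (rule weighted_product_along_trajectory[OF ae _ _ _ _ _ _ _ refl _ refl])
        show "((\<lambda>s. \<psi> (\<xi> (s - k))) has_real_derivative \<psi>' (\<xi> (s - k)) * d (\<xi> (s - k))) (at s within {a..e})"
          if "s \<in> {a..e}" for s
        proof -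
          have "((\<lambda>s. \<xi> (s - k)) has_real_derivative d (\<xi> (s - k))) (at s within {a..e})"
            by (auto intro!: derivative_eq_intros DERIV_chain'[OF _ \<xi>_deriv, THEN DERIV_cong])
          from DERIV_image_chain[OF DERIV_subset[OF \<psi>[OF x_in[OF that]] img] this]
          show ?thesis by (simp add: o_def)
        qed
        show "continuous_on {a..e} (\<lambda>s. \<psi>' (\<xi> (s - k)) * d (\<xi> (s - k)))"
          by (intro continuous_intros continuous_on_compose2[OF \<psi>' _ img]
               continuous_on_compose2[OF d_cont'[of UNIV]] continuous_on_compose2[OF cont_\<xi>[of UNIV]]) auto
      qed (use elim k in \<open>auto simp: a_def e_def trajectory_formula_def\<close>)
      then have "has_bochner_integral lborel (\<lambda>s. K s k)
        (\<psi> (\<xi> (e - k)) * ((\<iota>1 k + (LINT x|lborel. indicator {a..e} x * G1 (x, \<xi> (x - k))))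
          * (\<iota>2 k + (LINT x|lborel. indicator {a..e} x * G2 (x, \<xi> (x - k)))))
         - \<psi> (\<xi> (a - k)) * (\<iota>1 k * \<iota>2 k))"
        by (rule has_bochner_integral_cong[THEN iffD1, rotated -1])
           (use iff x_in in \<open>auto simp: K_def H_def w_def w'_def split: split_indicator\<close>)
      then show "(LINT s|lborel. K s k) =
      \<psi> (\<xi> (min T (k + \<Theta>) - k)) * (f1 (min T (k + \<Theta>)) (\<xi> (min T (k + \<Theta>) - k))
        * f2 (min T (k + \<Theta>)) (\<xi> (min T (k + \<Theta>) - k)))
      - \<psi> (\<xi> (max 0 k - k)) * ((if k \<le> 0 then p1 (\<xi> (- k)) else v1 k) * (if k \<le> 0 then p2 (\<xi> (- k)) else v2 k))"
        using elim k by (auto simp: has_bochner_integral_iff a_def e_def trajectory_formula_def)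
    qed
  qed

  have rep: "\<exists>P. P \<in> borel_measurable borel \<and> (AE x in lborel. x \<in> {0..c} \<longrightarrow> y1 x * y2 x = P x) \<and>
      integrable lborel (\<lambda>x. indicator {0..c} x * P x) \<and>
      (LINT x|lebesgue_on {0..c}. y1 x * y2 x) = (LINT x|lborel. indicator {0..c} x * P x)"
    if y: "L2_on {0..c} y1" "L2_on {0..c} y2" for c :: real and y1 y2 :: "real \<Rightarrow> real"
  proof -
    note i = L2_on_mult_integrable[OF y]
    have b: "{0..c} \<in> sets borel" by simp
    obtain P where P: "P \<in> borel_measurable borel" "AE x in lborel. x \<in> {0..c} \<longrightarrow> y1 x * y2 x = P x"
      by (rule borel_representative[OF borel_measurable_integrable[OF i] b])
    show ?thesis
      using P i LINT_lebesgue_on_eq[OF b P] integrable_lebesgue_on_iff[OF b P] by blast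
  qed
  have wrep: "\<exists>P. P \<in> borel_measurable borel \<and> (AE x in lborel. x \<in> {0..L} \<longrightarrow> \<psi> x * (y1 x * y2 x) = P x) \<and>
      has_bochner_integral lborel (\<lambda>k. indicator {0..\<Theta>} (t - k) * P (\<xi> (t - k)))
       (LINT x|lebesgue_on {0..L}. \<psi> x * (y1 x * y2 x) / \<bar>d x\<bar>)"
    if y: "L2_on {0..L} y1" "L2_on {0..L} y2" for t and y1 y2 :: "real \<Rightarrow> real"
  proof -
    obtain P where P: "P \<in> borel_measurable borel" "AE x in lborel. x \<in> {0..L} \<longrightarrow> y1 x * y2 x = P x"
        "integrable lborel (\<lambda>x. indicator {0..L} x * P x)"
      using rep[OF y] by blast
    note [measurable] = P(1)
    have ae: "AE x in lborel. x \<in> {0..L} \<longrightarrow> \<psi> x * (y1 x * y2 x) = w x * P x"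
      using P(2) by eventually_elim (auto simp: w_def)
    then have ae': "AE x in lborel. x \<in> {0..L} \<longrightarrow> \<psi> x * (y1 x * y2 x) / \<bar>d x\<bar> = w x * P x / \<bar>d x\<bar>"
      by eventually_elim auto
    have "continuous_on {0..L} (\<lambda>x. \<psi> x / \<bar>d x\<bar>)"
      using d_nz by (auto intro!: continuous_intros d_cont' \<psi>_cont)
    then obtain B where B: "\<And>x. x \<in> {0..L} \<Longrightarrow> \<bar>\<psi> x / \<bar>d x\<bar>\<bar> \<le> B"
      by (rule continuous_on_Icc_bounded) blast
    have "integrable lborel (\<lambda>x. indicator {0..L} x * (w x * P x / \<bar>d x\<bar>))"
    proof (rule Bochner_Integration.integrable_bound)
      show "integrable lborel (\<lambda>x. B * (indicator {0..L} x * P x))" using P(3) by simp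
      show "AE x in lborel. norm (indicator {0..L} x * (w x * P x / \<bar>d x\<bar>)) \<le> norm (B * (indicator {0..L} x * P x))"
      proof (intro AE_I2)
        fix x show "norm (indicator {0..L} x * (w x * P x / \<bar>d x\<bar>)) \<le> norm (B * (indicator {0..L} x * P x))"
        proof (cases "x \<in> {0..L}")
          case True
          have "\<bar>\<psi> x / \<bar>d x\<bar>\<bar> * \<bar>P x\<bar> \<le> \<bar>B\<bar> * \<bar>P x\<bar>"
            using B[OF True] by (intro mult_right_mono) auto
          then show ?thesis using True by (simp add: w_def abs_mult)
        qed auto
      qed
    qed measurable
    then have "has_bochner_integral lborel (\<lambda>x. indicator {0..L} x * (w x * P x / \<bar>d x\<bar>))
       (LINT x|lebesgue_on {0..L}. \<psi> x * (y1 x * y2 x) / \<bar>d x\<bar>)"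
      by (subst LINT_lebesgue_on_eq[OF _ _ ae']) (auto simp: has_bochner_integral_iff)
    then have "has_bochner_integral lborel (\<lambda>k. indicator {0..\<Theta>} (t - k) * (w (\<xi> (t - k)) * P (\<xi> (t - k))))
       (LINT x|lebesgue_on {0..L}. \<psi> x * (y1 x * y2 x) / \<bar>d x\<bar>)"
      by (subst (asm) has_bochner_integral_label_borel) measurable
    with ae show ?thesis by (intro exI[of _ "\<lambda>x. w x * P x"]) auto
  qed
  obtain PT where [measurable]: "PT \<in> borel_measurable borel"
    and PT: "AE x in lborel. x \<in> {0..L} \<longrightarrow> \<psi> x * (f1 T x * f2 T x) = PT x"
      "has_bochner_integral lborel (\<lambda>k. indicator {0..\<Theta>} (T - k) * PT (\<xi> (T - k)))
       (LINT x|lebesgue_on {0..L}. \<psi> x * (f1 T x * f2 T x) / \<bar>d x\<bar>)"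
    using wrep[of "f1 T" "f2 T" T] L2 by auto
  obtain P0 where [measurable]: "P0 \<in> borel_measurable borel"
    and P0: "AE x in lborel. x \<in> {0..L} \<longrightarrow> \<psi> x * (p1 x * p2 x) = P0 x"
      "has_bochner_integral lborel (\<lambda>k. indicator {0..\<Theta>} (0 - k) * P0 (\<xi> (0 - k)))
       (LINT x|lebesgue_on {0..L}. \<psi> x * (p1 x * p2 x) / \<bar>d x\<bar>)"
    using wrep[of p1 p2 0] L2 by auto
  obtain Pv where [measurable]: "Pv \<in> borel_measurable borel"
    and Pv: "AE x in lborel. x \<in> {0..T} \<longrightarrow> v1 x * v2 x = Pv x"
      "has_bochner_integral lborel (\<lambda>k. indicator {0..T} k * Pv k)
       (LINT t|lebesgue_on {0..T}. v1 t * v2 t)"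
    using rep[of T v1 v2] L2 by (auto simp: has_bochner_integral_iff)
  obtain Pb where [measurable]: "Pb \<in> borel_measurable borel"
    and Pb: "AE x in lborel. x \<in> {0..T} \<longrightarrow> f1 x b' * f2 x b' = Pb x"
      "has_bochner_integral lborel (\<lambda>k. indicator {0..T} k * Pb k)
       (LINT t|lebesgue_on {0..T}. f1 t b' * f2 t b')"
    using rep[of T "\<lambda>t. f1 t b'" "\<lambda>t. f2 t b'"] L2 by (auto simp: has_bochner_integral_iff)
  have Pb': "has_bochner_integral lborel (\<lambda>k. indicator {0..T} (\<Theta> + 1 * k) * Pb (\<Theta> + 1 * k))
       (LINT t|lebesgue_on {0..T}. f1 t b' * f2 t b')"
    using Pb(2) by (subst (asm) lborel_has_bochner_integral_real_affine_iff[where c = 1 and t = \<Theta>]) auto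
  have Pbk: "AE k in lborel. k + \<Theta> \<in> {0..T} \<longrightarrow> f1 (k + \<Theta>) b' * f2 (k + \<Theta>) b' = Pb (k + \<Theta>)"
    by (rule AE_lborel_compose[OF Pb(1), where j = "\<lambda>t. t - \<Theta>" and j' = "\<lambda>_. 1"])
       (auto intro!: derivative_eq_intros)
  \<comment> \<open>R collects the exit and entry values. At k = 0 and k = T - \<Theta> two of its terms overlap, which affects a
    null set of labels only.\<close>
  define R where "R k = indicator {0..\<Theta>} (T - k) * PT (\<xi> (T - k)) - indicator {0..\<Theta>} (0 - k) * P0 (\<xi> (0 - k))
     + \<psi> b' * (indicator {0..T} (\<Theta> + 1 * k) * Pb (\<Theta> + 1 * k)) - \<psi> b * (indicator {0..T} k * Pv k)" for k
  have "AE k in lborel. R k = (LINT s|lborel. K s k)"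
    using tr AE_label[OF PT(1), of T] AE_label[OF P0(1), of 0] Pv(1) Pbk
      AE_lborel_singleton[of 0] AE_lborel_singleton[of "T - \<Theta>"]
  proof eventually_elim
    case (elim k)
    show ?case
    proof (cases "k \<in> {-\<Theta>..T}")
      case False
      then have "K s k = 0" for s by (auto simp: K_def split: split_indicator)
      moreover have "R k = 0" using False T \<Theta>_pos by (auto simp: R_def split: split_indicator)
      ultimately show ?thesis by simp
    next
      case k: True
      have e: "\<psi> (\<xi> (min T (k + \<Theta>) - k)) * (f1 (min T (k + \<Theta>)) (\<xi> (min T (k + \<Theta>) - k))
        * f2 (min T (k + \<Theta>)) (\<xi> (min T (k + \<Theta>) - k)))
        = indicator {0..\<Theta>} (T - k) * PT (\<xi> (T - k))
          + \<psi> b' * (indicator {0..T} (\<Theta> + 1 * k) * Pb (\<Theta> + 1 * k))"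
      proof (cases "k + \<Theta> < T")
        case True
        then show ?thesis using elim(5) k by (simp add: min_def \<xi>_\<Theta> add.commute)
      next
        case False
        then have "T < k + \<Theta>" using elim(7) by simp
        then show ?thesis using elim(2) k \<xi>_range[of "T - k"] by (simp add: min_def)
      qed
      have a: "\<psi> (\<xi> (max 0 k - k)) * ((if k \<le> 0 then p1 (\<xi> (- k)) else v1 k) * (if k \<le> 0 then p2 (\<xi> (- k)) else v2 k))
        = indicator {0..\<Theta>} (0 - k) * P0 (\<xi> (0 - k)) + \<psi> b * (indicator {0..T} k * Pv k)"
      proof (cases "k < 0")
        case True
        then show ?thesis using elim(3) k \<xi>_range[of "- k"] by (simp add: max_def)
      next
        case False
        then have "0 < k" using elim(6) by simp
        then show ?thesis using elim(4) k by (simp add: max_def \<xi>_0)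
      qed
      show ?thesis using elim(1) k unfolding e a by (simp add: R_def)
    qed
  qed
  moreover have "has_bochner_integral lborel R
      ((LINT x|lebesgue_on {0..L}. \<psi> x * (f1 T x * f2 T x) / \<bar>d x\<bar>)
      - (LINT x|lebesgue_on {0..L}. \<psi> x * (p1 x * p2 x) / \<bar>d x\<bar>)
      + \<psi> b' * (LINT t|lebesgue_on {0..T}. f1 t b' * f2 t b')
      - \<psi> b * (LINT t|lebesgue_on {0..T}. v1 t * v2 t))"
    unfolding R_def
    by (intro has_bochner_integral_add has_bochner_integral_diff has_bochner_integral_mult_right PT P0 Pb' Pv)
  moreover have "(\<lambda>k. LINT s|lborel. K s k) \<in> borel_measurable lborel"
    by measurable
  ultimately show ?eq
    using lhs integral_cong_AE[of R lborel "\<lambda>k. LINT s|lborel. K s k"]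
    by (auto simp: has_bochner_integral_iff)
qed

end

section \<open>Volterra fixed points and linear differential equations\<close>

text \<open>
  Picard iteration in the norm weighted by \<open>W\<close>. It is stated for a class \<open>C\<close> of functions closed under
  uniform limits, since it serves both for continuous solutions of linear differential equations and for
  the discontinuous solutions of the hyperbolic system.
\<close>

lemma volterra_fixed_point:
  fixes \<Phi> :: "('p \<Rightarrow> 'b::banach) \<Rightarrow> 'p \<Rightarrow> 'b" and W :: "'p \<Rightarrow> real"
  assumes f0: "f0 \<in> C" and pres: "\<And>f. f \<in> C \<Longrightarrow> \<Phi> f \<in> C"
    and lim: "\<And>F f. (\<And>n. F n \<in> C) \<Longrightarrow> uniform_limit UNIV F f sequentially \<Longrightarrow> f \<in> C"
    and W: "\<And>p. 1 \<le> W p" "\<And>p. W p \<le> w"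
    and contr: "\<And>f h B p. f \<in> C \<Longrightarrow> h \<in> C \<Longrightarrow> 0 \<le> B \<Longrightarrow> (\<And>p. norm (f p - h p) \<le> B * W p)
      \<Longrightarrow> norm (\<Phi> f p - \<Phi> h p) \<le> B / 2 * W p"
    and init: "\<And>p. norm (\<Phi> f0 p - f0 p) \<le> B0"
  obtains f where "f \<in> C" "\<Phi> f = f"
proof -
  define F where "F n = (\<Phi> ^^ n) f0" for n
  have F_Suc: "F (Suc n) = \<Phi> (F n)" for n by (simp add: F_def)
  have FC: "F n \<in> C" for n by (induction n) (auto simp: F_def f0 pres)
  have B0: "0 \<le> B0" using order_trans[OF norm_ge_zero init] .
  have step: "norm (F (Suc n) p - F n p) \<le> B0 / 2 ^ n * W p" for n p
  proof (induction n arbitrary: p)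
    case 0
    have "B0 * 1 \<le> B0 * W p" using B0 W by (intro mult_left_mono) auto
    then show ?case using init[of p] by (simp add: F_def)
  next
    case (Suc n)
    have "norm (\<Phi> (F (Suc n)) p - \<Phi> (F n) p) \<le> B0 / 2 ^ n / 2 * W p"
      using Suc B0 by (intro contr FC) auto
    then show ?case by (simp add: F_Suc field_simps)
  qed
  have "w \<ge> 0" using W[of undefined] by linarith
  have "uniform_limit UNIV (\<lambda>n p. \<Sum>i<n. F (Suc i) p - F i p) (\<lambda>p. \<Sum>i. F (Suc i) p - F i p) sequentially"
  proof (rule Weierstrass_m_test)
    show "norm (F (Suc n) p - F n p) \<le> B0 * w * (1 / 2) ^ n" for n p
    proof -
      have "B0 / 2 ^ n * W p \<le> B0 / 2 ^ n * w" using B0 W by (intro mult_left_mono) auto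
      then show ?thesis using step[of n p] by (simp add: field_simps power_one_over)
    qed
    show "summable (\<lambda>n. B0 * w * (1 / 2) ^ n)" by (intro summable_mult summable_geometric) auto
  qed
  then have "uniform_limit UNIV (\<lambda>n p. f0 p + (\<Sum>i<n. F (Suc i) p - F i p)) 
      (\<lambda>p. f0 p + (\<Sum>i. F (Suc i) p - F i p)) sequentially"
    by (intro uniform_limit_add uniform_limit_const)
  moreover have "f0 p + (\<Sum>i<n. F (Suc i) p - F i p) = F n p" for n p
    by (subst sum_lessThan_telescope) (simp add: F_def)
  ultimately obtain f where f: "uniform_limit UNIV F f sequentially" by auto
  have fC: "f \<in> C" by (rule lim[OF FC f])
  have "\<Phi> f p = f p" for p
  proof (rule ccontr)
    assume ne: "\<Phi> f p \<noteq> f p"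
    define \<epsilon> where "\<epsilon> = norm (\<Phi> f p - f p) / (2 + w)"
    have \<epsilon>: "\<epsilon> > 0" using ne \<open>w \<ge> 0\<close> by (auto simp: \<epsilon>_def)
    obtain N where N: "\<And>n p. n \<ge> N \<Longrightarrow> dist (F n p) (f p) < \<epsilon>"
      using f \<epsilon> unfolding uniform_limit_sequentially_iff by blast
    have b: "norm (f p - F N p) \<le> \<epsilon> * W p" for p
    proof -
      have "\<epsilon> * 1 \<le> \<epsilon> * W p" using \<epsilon> W by (intro mult_left_mono) auto
      then show ?thesis using N[of N p] by (simp add: dist_norm norm_minus_commute)
    qed
    have "norm (\<Phi> f p - F (Suc N) p) \<le> \<epsilon> / 2 * W p"
      unfolding F_Suc using b \<epsilon> by (intro contr fC FC) auto
    also have "\<dots> \<le> \<epsilon> / 2 * w" using \<epsilon> W by (intro mult_left_mono) auto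
    finally have "norm (\<Phi> f p - f p) \<le> \<epsilon> / 2 * w + \<epsilon>"
      using N[of "Suc N" p] norm_triangle_le[of "\<Phi> f p - F (Suc N) p" "F (Suc N) p - f p" "\<epsilon> / 2 * w + \<epsilon>"]
      by (simp add: dist_norm)
    also have "\<dots> < \<epsilon> * (2 + w)" 
      using \<epsilon> mult_nonneg_nonneg[OF less_imp_le[OF \<epsilon>] \<open>w \<ge> 0\<close>] unfolding distrib_left by linarith
    also have "\<dots> = norm (\<Phi> f p - f p)" using \<open>w \<ge> 0\<close> by (simp add: \<epsilon>_def)
    finally show False by simp
  qed
  with fC show ?thesis by (intro that) auto
qed

lemma has_integral_exp: "0 < \<kappa> \<Longrightarrow> 0 \<le> x \<Longrightarrow>
   ((\<lambda>s. exp (\<kappa> * s)) has_integral ((exp (\<kappa> * x) - 1) / \<kappa>)) {0..x}" for \<kappa> x :: real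
proof -
  assume "0 < \<kappa>" "0 \<le> x"
  then have "((\<lambda>s. exp (\<kappa> * s)) has_integral (exp (\<kappa> * x) / \<kappa> - exp (\<kappa> * 0) / \<kappa>)) {0..x}"
    by (intro fundamental_theorem_of_calculus)
       (auto simp: has_real_derivative_iff_has_vector_derivative[symmetric] intro!: derivative_eq_intros)
  then show ?thesis by (simp add: diff_divide_distrib)
qed

lemma continuous_on_matrix_vector_mult:
  fixes A :: "'a::topological_space \<Rightarrow> real^'n^'m"
  assumes "continuous_on S A" "continuous_on S f"
  shows "continuous_on S (\<lambda>s. A s *v f s)"
  unfolding matrix_vector_mult_def using assms
  by (intro continuous_on_vec_lambda continuous_intros)

lemma matrix_vector_mult_bound:
  fixes A :: "real \<Rightarrow> real^2^2"
  assumes "continuous_on {0..L} A"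
  obtains K where "K > 0" "\<And>x v. x \<in> {0..L} \<Longrightarrow> norm (A x *v v) \<le> K * norm v"
proof -
  have "bounded (A ` {0..L})"
    using assms compact_Icc by (intro compact_imp_bounded compact_continuous_image)
  then obtain B where B: "B > 0" "\<And>x. x \<in> {0..L} \<Longrightarrow> norm (A x) \<le> B"
    by (auto simp: bounded_pos)
  have "norm (A x *v v) \<le> 2 * B * norm v" if "x \<in> {0..L}" for x v
  proof -
    have "norm (A x *v v) \<le> (\<Sum>i\<in>UNIV. norm ((A x *v v) $ i))"
      by (simp add: norm_le_l1_cart)
    also have "\<dots> \<le> (\<Sum>i\<in>(UNIV::2 set). B * norm v)"
    proof (rule sum_mono)
      fix i :: 2
      have "norm ((A x *v v) $ i) = \<bar>A x $ i \<bullet> v\<bar>" by (simp add: matrix_vector_mul_component)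
      also have "\<dots> \<le> norm (A x $ i) * norm v" by (rule Cauchy_Schwarz_ineq2)
      also have "\<dots> \<le> B * norm v"
        using Finite_Cartesian_Product.norm_nth_le[of "A x" i] B(2)[OF that]
        by (intro mult_right_mono) auto
      finally show "norm ((A x *v v) $ i) \<le> B * norm v" .
    qed
    finally show ?thesis by simp
  qed
  then show ?thesis using B(1) by (intro that[of "2 * B"]) auto
qed

lemma linear_ode_solution:
  fixes A :: "real \<Rightarrow> real^2^2"
  assumes A: "continuous_on {0..L} A" and L: "0 < L"
  obtains Y where "Y 0 = y0" "\<And>x. x \<in> {0..L} \<Longrightarrow> (Y has_vector_derivative A x *v Y x) (at x within {0..L})"
proof -
  obtain K where K: "K > 0" "\<And>x v. x \<in> {0..L} \<Longrightarrow> norm (A x *v v) \<le> K * norm v"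
    using matrix_vector_mult_bound[OF A] by blast
  \<comment> \<open>The rate is chosen so that the integral operator contracts the exponentially weighted norm by the factor 1/2.\<close>
  define \<kappa> where "\<kappa> = 2 * K"
  have \<kappa>: "\<kappa> > 0" using K by (simp add: \<kappa>_def)
  define W where "W x = exp (\<kappa> * max 0 (min L x))" for x :: real
  define C where "C = {f :: real \<Rightarrow> real^2. continuous_on {0..L} f \<and> (\<forall>x. x \<notin> {0..L} \<longrightarrow> f x = 0)}"
  define \<Phi> where "\<Phi> f x = (if x \<in> {0..L} then y0 + integral {0..x} (\<lambda>s. A s *v f s) else 0)"
    for f :: "real \<Rightarrow> real^2" and x
  have ci: "continuous_on {0..L} (\<lambda>s. A s *v f s)" if "f \<in> C" for f
    using that A by (auto simp: C_def intro!: continuous_on_matrix_vector_mult)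
  have int: "(\<lambda>s. A s *v f s) integrable_on {0..x}" if "f \<in> C" "x \<in> {0..L}" for f x
    using ci[OF that(1)] that(2) by (intro integrable_continuous_interval) (auto intro: continuous_on_subset)
  have der: "((\<lambda>u. integral {0..u} (\<lambda>s. A s *v f s)) has_vector_derivative A x *v f x) (at x within {0..L})"
    if "f \<in> C" "x \<in> {0..L}" for f x
    using integral_has_vector_derivative[OF ci[OF that(1)] that(2)] .
  have pres: "\<Phi> f \<in> C" if "f \<in> C" for f
  proof -
    have "continuous_on {0..L} (\<lambda>x. y0 + integral {0..x} (\<lambda>s. A s *v f s))"
      using der[OF that] by (intro continuous_intros continuous_on_vector_derivative) auto
    then have "continuous_on {0..L} (\<Phi> f)"
      by (rule continuous_on_eq) (simp add: \<Phi>_def)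
    then show ?thesis by (auto simp: C_def \<Phi>_def)
  qed
  have "\<exists>f\<in>C. \<Phi> f = f"
  proof (rule volterra_fixed_point[where C = C and \<Phi> = \<Phi> and W = W and w = "exp (\<kappa> * L)" and ?f0.0 = "\<lambda>_. 0" and ?B0.0 = "norm y0"])
    show "(\<lambda>_. 0) \<in> C" by (auto simp: C_def)
    show "\<Phi> f \<in> C" if "f \<in> C" for f by (rule pres[OF that])
    show "1 \<le> W p" for p using \<kappa> by (simp add: W_def)
    show "W p \<le> exp (\<kappa> * L)" for p using \<kappa> L by (simp add: W_def)
    show "f \<in> C" if "\<And>n. F n \<in> C" "uniform_limit UNIV F f sequentially" for F f
    proof -
      have "continuous_on {0..L} f"
        by (rule uniform_limit_theorem[OF _ uniform_limit_on_subset[OF that(2)]])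
          (use that(1) in \<open>auto simp: C_def\<close>)
      moreover have "f x = 0" if "x \<notin> {0..L}" for x
      proof -
        have "(\<lambda>n. F n x) \<longlonglongrightarrow> f x" using tendsto_uniform_limitI[OF \<open>uniform_limit UNIV F f sequentially\<close>] by auto
        moreover have "F n x = 0" for n using \<open>F n \<in> C\<close> that by (auto simp: C_def)
        ultimately show ?thesis by (simp add: LIMSEQ_const_iff)
      qed
      ultimately show ?thesis by (auto simp: C_def)
    qed
    show "norm (\<Phi> (\<lambda>_. 0) p - 0) \<le> norm y0" for p by (auto simp: \<Phi>_def)
    show "norm (\<Phi> f x - \<Phi> h x) \<le> B / 2 * W x"
      if C: "f \<in> C" "h \<in> C" and B: "0 \<le> B" and b: "\<And>p. norm (f p - h p) \<le> B * W p" for f h B x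
    proof (cases "x \<in> {0..L}")
      case True
      have "\<Phi> f x - \<Phi> h x = integral {0..x} (\<lambda>s. A s *v f s - A s *v h s)"
        using True by (simp add: \<Phi>_def Henstock_Kurzweil_Integration.integral_diff int C)
      also have "norm \<dots> \<le> integral {0..x} (\<lambda>s. K * B * exp (\<kappa> * s))"
      proof (rule integral_norm_bound_integral)
        show "(\<lambda>s. A s *v f s - A s *v h s) integrable_on {0..x}"
          using True C by (intro integrable_diff int)
        show "(\<lambda>s. K * B * exp (\<kappa> * s)) integrable_on {0..x}"
          by (intro integrable_continuous_interval continuous_intros)
        show "norm (A s *v f s - A s *v h s) \<le> K * B * exp (\<kappa> * s)" if "s \<in> {0..x}" for s
        proof -
          have "norm (A s *v f s - A s *v h s) \<le> K * norm (f s - h s)"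
            using K(2)[of s "f s - h s"] that True by (simp add: matrix_vector_mult_diff_distrib)
          also have "\<dots> \<le> K * (B * W s)" using K b by (intro mult_left_mono) auto
          also have "W s = exp (\<kappa> * s)" using that True by (simp add: W_def)
          finally show ?thesis by (simp add: mult.assoc)
        qed
      qed
      also have "\<dots> = K * B * ((exp (\<kappa> * x) - 1) / \<kappa>)"
        using has_integral_mult_right[OF has_integral_exp[OF \<kappa>, of x], of "K * B"] True
        by (intro integral_unique) auto
      also have "\<dots> = B / 2 * (exp (\<kappa> * x) - 1)" using K by (simp add: \<kappa>_def)
      also have "\<dots> \<le> B / 2 * W x" using B True by (intro mult_left_mono) (auto simp: W_def)
      finally show ?thesis .
    next
      case False
      then have "\<Phi> f x = 0" "\<Phi> h x = 0" by (simp_all only: \<Phi>_def if_False)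
      then show ?thesis using B by (simp add: W_def)
    qed
  qed blast
  then obtain Y where Y: "Y \<in> C" "\<Phi> Y = Y" by blast
  have Y_eq: "Y x = y0 + integral {0..x} (\<lambda>s. A s *v Y s)" if "x \<in> {0..L}" for x
    using that fun_cong[OF Y(2), of x] by (simp add: \<Phi>_def)
  show ?thesis
  proof (rule that)
    show "Y 0 = y0" using Y_eq[of 0] L by simp
    fix x assume x: "x \<in> {0..L}"
    have "((\<lambda>u. y0 + integral {0..u} (\<lambda>s. A s *v Y s)) has_vector_derivative A x *v Y x) (at x within {0..L})"
      using der[OF Y(1) x] by (auto intro!: derivative_eq_intros)
    then show "(Y has_vector_derivative A x *v Y x) (at x within {0..L})"
      by (rule has_vector_derivative_transform[OF x, rotated]) (simp add: Y_eq)
  qed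
qed

section \<open>Construction of the characteristics\<close>

text \<open>
  The upper bound on the speed makes the travel time grow at least linearly, hence surjective.
\<close>

lemma positive_speed_flow:
  fixes d :: "real \<Rightarrow> real"
  assumes d: "continuous_on UNIV d" and pos: "\<And>x. 0 < d x" and bd: "\<And>x. d x \<le> B"
  obtains \<theta> \<xi> where "\<And>x. \<xi> (\<theta> x) = x" "\<And>\<sigma>. \<theta> (\<xi> \<sigma>) = \<sigma>" "\<theta> 0 = 0" "strict_mono \<theta>"
    "\<And>x. (\<theta> has_real_derivative 1 / d x) (at x)" "\<And>\<sigma>. (\<xi> has_real_derivative d (\<xi> \<sigma>)) (at \<sigma>)"
proof -
  define \<theta> :: "real \<Rightarrow> real" where "\<theta> x = (LBINT y=ereal 0..ereal x. 1 / d y)" for x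
  have c: "continuous_on A (\<lambda>y. 1 / d y)" for A
    using pos by (intro continuous_intros continuous_on_subset[OF d]) (auto simp: less_imp_neq[symmetric])
  have der: "(\<theta> has_real_derivative 1 / d x) (at x)" for x
  proof -
    define N where "N = \<bar>x\<bar> + 1"
    have "((\<lambda>u. LBINT y=ereal 0..ereal u. 1 / d y) has_vector_derivative 1 / d x) (at x within {-N..N})"
      by (rule interval_integral_FTC2) (use c in \<open>auto simp: N_def\<close>)
    moreover have "at x within {-N..N} = at x"
      by (rule at_within_interior) (auto simp: N_def)
    ultimately show ?thesis
      by (simp add: \<theta>_def[abs_def] has_real_derivative_iff_has_vector_derivative)
  qed
  have mono: "strict_mono \<theta>"
  proof (rule strict_monoI)
    fix x y :: real assume "x < y"
    then show "\<theta> x < \<theta> y"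
      by (rule DERIV_pos_imp_increasing) (meson der pos zero_less_divide_1_iff)
  qed
  have B: "B > 0" using pos[of 0] bd[of 0] by linarith
  have \<theta>0: "\<theta> 0 = 0" by (simp add: \<theta>_def)
  have grow: "(y - x) / B \<le> \<theta> y - \<theta> x" if "x \<le> y" for x y
  proof -
    have "\<theta> x - x / B \<le> \<theta> y - y / B"
    proof (rule DERIV_nonneg_imp_nondecreasing[OF that])
      fix z
      have "1 / B \<le> 1 / d z" using pos bd by (intro divide_left_mono) (auto intro: mult_pos_pos B)
      then show "\<exists>y'. ((\<lambda>x. \<theta> x - x / B) has_real_derivative y') (at z) \<and> 0 \<le> y'"
        using der[of z] B by (intro exI[of _ "1 / d z - 1 / B"]) (auto intro!: derivative_eq_intros)
    qed
    then show ?thesis by (simp add: diff_divide_distrib)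
  qed
  have surj: "\<exists>x. \<theta> x = y" for y
  proof -
    define N where "N = B * \<bar>y\<bar>"
    have N: "0 \<le> N" using B by (simp add: N_def)
    have e: "N / B = \<bar>y\<bar>" using B by (simp add: N_def)
    have "\<theta> (-N) \<le> y" "y \<le> \<theta> N"
      using grow[of "-N" 0] grow[of 0 N] N e by (auto simp: \<theta>0)
    moreover have "continuous_on {-N..N} \<theta>"
      by (intro continuous_at_imp_continuous_on ballI DERIV_isCont[OF der])
    ultimately show ?thesis
      using IVT'[of \<theta> "-N" y N] N by auto
  qed
  define \<xi> where "\<xi> = inv \<theta>"
  have \<theta>\<xi>: "\<theta> (\<xi> y) = y" for y using surj[of y] unfolding \<xi>_def by (metis f_inv_into_f rangeI)
  have \<xi>\<theta>: "\<xi> (\<theta> x) = x" for x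
    using strict_mono_eq[OF mono] \<theta>\<xi>[of "\<theta> x"] by simp
  have "(\<xi> has_real_derivative d (\<xi> y)) (at y)" for y
  proof -
    have "isCont \<xi> (\<theta> (\<xi> y))"
      by (rule isCont_inverse_function[where d = 1]) (auto simp: \<xi>\<theta> intro: DERIV_isCont der)
    then have "(\<xi> has_real_derivative inverse (1 / d (\<xi> y))) (at y)"
      using pos[of "\<xi> y"] der
      by (intro DERIV_inverse_function[where a = "y - 1" and b = "y + 1"]) (auto simp: \<theta>\<xi>)
    then show ?thesis by simp
  qed
  with \<xi>\<theta> \<theta>\<xi> \<theta>0 mono der show ?thesis by (rule that)
qed

text \<open>
  Extending a speed constantly outside the interval preserves continuity, sign and bounds.
\<close>

lemma clamped_speed:
  fixes d0 :: "real \<Rightarrow> real"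
  assumes "continuous_on {0..L} d0" and pos: "\<And>x. x \<in> {0..L} \<Longrightarrow> 0 < d0 x" and L: "0 < L"
  defines "d \<equiv> \<lambda>x. d0 (max 0 (min L x))"
  obtains B where "continuous_on UNIV d" "\<And>x. 0 < d x" "\<And>x. d x \<le> B"
proof -
  have cl: "max 0 (min L x) \<in> {0..L}" for x using L by auto
  obtain B where B: "\<And>x. x \<in> {0..L} \<Longrightarrow> \<bar>d0 x\<bar> \<le> B"
    using continuous_on_Icc_bounded[OF assms(1)] by blast
  show ?thesis
  proof (rule that[of B])
    show "continuous_on UNIV d" unfolding d_def
      by (rule continuous_on_compose2[OF assms(1)]) (use cl in \<open>auto intro!: continuous_intros\<close>)
    show "0 < d x" for x using pos[OF cl] by (simp add: d_def)
    show "d x \<le> B" for x using B[OF cl[of x]] by (simp add: d_def)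
  qed
qed

lemma characteristics_positive:
  fixes d0 :: "real \<Rightarrow> real"
  assumes "continuous_on {0..L} d0" and "\<And>x. x \<in> {0..L} \<Longrightarrow> 0 < d0 x" and L: "0 < L"
  obtains \<Theta> \<theta> \<xi> where "characteristics L \<Theta> 0 L (\<lambda>x. d0 (max 0 (min L x))) \<theta> \<xi>"
proof -
  obtain B where d: "continuous_on UNIV (\<lambda>x. d0 (max 0 (min L x)))" "\<And>x. 0 < d0 (max 0 (min L x))"
      "\<And>x. d0 (max 0 (min L x)) \<le> B"
    using clamped_speed[OF assms] by blast
  obtain \<theta> \<xi> where \<theta>: "\<And>x. \<xi> (\<theta> x) = x" "\<And>\<sigma>. \<theta> (\<xi> \<sigma>) = \<sigma>" "\<theta> 0 = 0" "strict_mono \<theta>"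
    "\<And>x. (\<theta> has_real_derivative 1 / d0 (max 0 (min L x))) (at x)"
    "\<And>\<sigma>. (\<xi> has_real_derivative d0 (max 0 (min L (\<xi> \<sigma>)))) (at \<sigma>)"
    by (rule positive_speed_flow[OF d]) (rule that; assumption)
  show ?thesis
  proof (rule that[of "\<theta> L" \<theta> \<xi>], unfold_locales)
    show "0 < \<theta> L" using \<theta>(3,4) L by (metis strict_mono_less)
    show "\<theta> x \<in> {0..\<theta> L} \<longleftrightarrow> x \<in> {0..L}" for x
      using strict_mono_less_eq[OF \<theta>(4), of 0 x] strict_mono_less_eq[OF \<theta>(4), of x L] \<theta>(3) by auto
    show "\<xi> 0 = 0" using \<theta>(1)[of 0] \<theta>(3) by simp
    show "d0 (max 0 (min L x)) \<noteq> 0" for x using d(2)[of x] by simp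
  qed (use \<theta> d L in auto)
qed

text \<open>
  The travel times for the reversed speed are measured from \<open>0\<close>; subtracting them from their value at \<open>L\<close>
  gives those from the inflow end \<open>L\<close>.
\<close>

lemma characteristics_negative:
  fixes d0 :: "real \<Rightarrow> real"
  assumes c: "continuous_on {0..L} d0" and neg: "\<And>x. x \<in> {0..L} \<Longrightarrow> d0 x < 0" and L: "0 < L"
  obtains \<Theta> \<theta> \<xi> where "characteristics L \<Theta> L 0 (\<lambda>x. d0 (max 0 (min L x))) \<theta> \<xi>"
proof -
  obtain B where d: "continuous_on UNIV (\<lambda>x. - d0 (max 0 (min L x)))" "\<And>x. 0 < - d0 (max 0 (min L x))"
      "\<And>x. - d0 (max 0 (min L x)) \<le> B"
    using clamped_speed[of L "\<lambda>x. - d0 x"] assms by (auto simp: continuous_on_minus)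
  obtain \<theta> \<xi> where \<theta>: "\<And>x. \<xi> (\<theta> x) = x" "\<And>\<sigma>. \<theta> (\<xi> \<sigma>) = \<sigma>" "\<theta> 0 = 0" "strict_mono \<theta>"
    "\<And>x. (\<theta> has_real_derivative 1 / - d0 (max 0 (min L x))) (at x)"
    "\<And>\<sigma>. (\<xi> has_real_derivative - d0 (max 0 (min L (\<xi> \<sigma>)))) (at \<sigma>)"
    by (rule positive_speed_flow[OF d]) (rule that; assumption)
  show ?thesis
  proof (rule that[of "\<theta> L" "\<lambda>x. \<theta> L - \<theta> x" "\<lambda>\<sigma>. \<xi> (\<theta> L - \<sigma>)"], unfold_locales)
    show "0 < \<theta> L" using \<theta>(3,4) L by (metis strict_mono_less)
    show "\<theta> L - \<theta> x \<in> {0..\<theta> L} \<longleftrightarrow> x \<in> {0..L}" for x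
      using strict_mono_less_eq[OF \<theta>(4), of 0 x] strict_mono_less_eq[OF \<theta>(4), of x L] \<theta>(3) by auto
    show "\<xi> (\<theta> L - \<theta> L) = 0" using \<theta>(1)[of 0] \<theta>(3) by simp
    show "d0 (max 0 (min L x)) \<noteq> 0" for x using d(2)[of x] by simp
    show "((\<lambda>x. \<theta> L - \<theta> x) has_real_derivative 1 / d0 (max 0 (min L x))) (at x)" for x
      using \<theta>(5)[of x] by (auto intro!: derivative_eq_intros)
    show "((\<lambda>\<sigma>. \<xi> (\<theta> L - \<sigma>)) has_real_derivative d0 (max 0 (min L (\<xi> (\<theta> L - \<sigma>))))) (at \<sigma>)" for \<sigma>
      by (auto intro!: derivative_eq_intros DERIV_chain'[OF _ \<theta>(6), THEN DERIV_cong])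
    show "continuous_on UNIV (\<lambda>x. d0 (max 0 (min L x)))"
      using continuous_on_minus[OF d(1)] by simp
  qed (use \<theta> L in auto)
qed

section \<open>The hyperbolic system and its states for constant controls\<close>

text \<open>
  The coupled system, with its two components indexed by the type \<open>2\<close> so that statements about them are made
  once.
\<close>

locale hyperbolic =
  fixes L :: real and \<Theta> b b' :: "2 \<Rightarrow> real" and d \<theta> \<xi> :: "2 \<Rightarrow> real \<Rightarrow> real"
    and M :: "real \<Rightarrow> real^2^2" and \<eta> :: real
  assumes chars: "characteristics L (\<Theta> i) (b i) (b' i) (d i) (\<theta> i) (\<xi> i)"
    and speed_pos: "0 < d 1 x" and speed_neg: "d 2 x < 0"
    and M_cont: "continuous_on {0..L} M"
    and ends: "b 1 = 0" "b 2 = L" "b' 1 = L" "b' 2 = 0"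
begin

sublocale ch: characteristics L "\<Theta> i" "b i" "b' i" "d i" "\<theta> i" "\<xi> i" for i
  by (rule chars)

lemma L_pos: "0 < L" by (rule ch.L_pos)

abbreviation solves_along :: "(real \<Rightarrow> real^2) \<Rightarrow> (real \<Rightarrow> real \<Rightarrow> real^2) \<Rightarrow> 2 \<Rightarrow> real \<Rightarrow> real \<Rightarrow> bool" where
  "solves_along u r i \<equiv> ch.carried i (\<lambda>t x. r t x $ i) (\<lambda>t x. \<eta> * (M x *v r t x) $ i) (\<lambda>_. 0) (\<lambda>t. u t $ i)"

lemma dynamic_state_iff:
  assumes "\<And>x. x \<in> {0..L} \<Longrightarrow> dp x = d 1 x" "\<And>x. x \<in> {0..L} \<Longrightarrow> dm x = d 2 x"
  shows "dynamic_state L dp dm \<eta> M T u r \<longleftrightarrow>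
     (\<lambda>(t, x). r t x) \<in> borel_measurable (lebesgue_on ({0..T} \<times> {0..L})) \<and>
     (\<forall>t\<in>{0..T}. L2_on {0..L} (r t)) \<and>
     (\<forall>t\<in>{0..T}. ((\<lambda>s. LINT x|lebesgue_on {0..L}. (norm (r s x - r t x))\<^sup>2) \<longlongrightarrow> 0)
        (at t within {0..T})) \<and>
     (\<forall>t\<in>{0..T}. AE x in lebesgue_on {0..L}. \<forall>i. solves_along u r i t x) \<and>
     (\<forall>x\<in>{0, L}. AE t in lebesgue_on {0..T}. \<forall>i. solves_along u r i t x) \<and>
     L2_on {0..T} (\<lambda>t. r t L $ 1) \<and> L2_on {0..T} (\<lambda>t. r t 0 $ 2)"
proof -
  have eq: "char_eq L \<eta> M dp 0 1 u r t x \<and> char_eq L \<eta> M dm L 2 u r t x \<longleftrightarrow> (\<forall>i. solves_along u r i t x)"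
    if "0 \<le> t" "x \<in> {0..L}" for t x
    using ch.char_eq_iff_carried[of dp 1 x t \<eta> M 1 u r] ch.char_eq_iff_carried[of dm 2 x t \<eta> M 2 u r] that assms
    by (simp add: ends forall_2)
  have 1: "(AE x in lebesgue_on {0..L}. char_eq L \<eta> M dp 0 1 u r t x \<and> char_eq L \<eta> M dm L 2 u r t x)
     \<longleftrightarrow> (AE x in lebesgue_on {0..L}. \<forall>i. solves_along u r i t x)" if "t \<in> {0..T}" for t
    by (rule AE_cong, rule eq) (use that in auto)
  have 2: "(AE t in lebesgue_on {0..T}. char_eq L \<eta> M dp 0 1 u r t x \<and> char_eq L \<eta> M dm L 2 u r t x)
     \<longleftrightarrow> (AE t in lebesgue_on {0..T}. \<forall>i. solves_along u r i t x)" if "x \<in> {0, L}" for x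
    by (rule AE_cong, rule eq) (use that L_pos in auto)
  show ?thesis unfolding dynamic_state_def using 1 2 by simp
qed

text \<open>
  With constant controls and zero initial state the data jump at the inflow corner, and this jump
  travels along the characteristic with label \<open>0\<close>. Away from that curve component \<open>i\<close> is continuous.
\<close>

definition smooth_region :: "real \<Rightarrow> 2 \<Rightarrow> (real \<times> real) set" where
  "smooth_region T i = {p \<in> {0..T} \<times> {0..L}. fst p \<noteq> \<theta> i (snd p)}"

lemma smooth_region_borel: "smooth_region T i \<in> sets borel"
proof -
  have "closed {p. fst p = \<theta> i (snd p)}"
    by (intro closed_Collect_eq continuous_intros continuous_on_compose2[OF ch.cont_\<theta>[of UNIV]]) auto
  then have "{0..T} \<times> {0..L} - {p. fst p = \<theta> i (snd p)} \<in> sets borel"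
    by (rule sets.Diff[OF ch.strip_borel borel_closed])
  moreover have "{0..T} \<times> {0..L} - {p. fst p = \<theta> i (snd p)} = smooth_region T i"
    by (auto simp: smooth_region_def)
  ultimately show ?thesis by simp
qed

definition piecewise_continuous :: "real \<Rightarrow> (real \<times> real \<Rightarrow> real^2) set" where
  "piecewise_continuous T = {f. (\<exists>B. \<forall>p. norm (f p) \<le> B) \<and>
     (\<forall>i. continuous_on (smooth_region T i) (\<lambda>p. f p $ i) \<and> (\<forall>p. p \<notin> smooth_region T i \<longrightarrow> f p $ i = 0))}"

lemma piecewise_continuous_borel:
  assumes "f \<in> piecewise_continuous T"
  shows "(\<lambda>p. f p $ i) \<in> borel_measurable borel"
proof -
  have "(\<lambda>p. indicator (smooth_region T i) p *\<^sub>R f p $ i) \<in> borel_measurable borel"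
    using assms smooth_region_borel
    by (intro borel_measurable_continuous_on_indicator) (auto simp: piecewise_continuous_def)
  moreover have "(\<lambda>p. indicator (smooth_region T i) p *\<^sub>R f p $ i) = (\<lambda>p. f p $ i)"
    using assms by (auto simp: piecewise_continuous_def fun_eq_iff split: split_indicator)
  ultimately show ?thesis by simp
qed

text \<open>
  Clamping makes the coefficients continuous on the whole line; only their values on the interval matter
  because characteristics stay inside it.
\<close>

definition clamp_M :: "real \<Rightarrow> real^2^2" where "clamp_M x = M (max 0 (min L x))"

lemma clamp_M_cont: "continuous_on A clamp_M"
  unfolding clamp_M_def
  by (rule continuous_on_compose2[OF M_cont]) (use L_pos in \<open>auto intro!: continuous_intros\<close>)

lemma clamp_M_eq: "x \<in> {0..L} \<Longrightarrow> clamp_M x = M x"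
  by (simp add: clamp_M_def)

definition source :: "2 \<Rightarrow> (real \<times> real \<Rightarrow> real^2) \<Rightarrow> real \<Rightarrow> real \<Rightarrow> real" where
  "source i f k s = \<eta> * (clamp_M (\<xi> i (s - k)) *v f (s, \<xi> i (s - k))) $ i"

lemma source_eq: "source i f k s = \<eta> * (\<Sum>j\<in>UNIV. clamp_M (\<xi> i (s - k)) $ i $ j * f (s, \<xi> i (s - k)) $ j)"
  by (simp add: source_def matrix_vector_mult_def)

lemma source_borel:
  assumes "f \<in> piecewise_continuous T"
  shows "source i f k \<in> borel_measurable borel"
proof -
  note [measurable] = piecewise_continuous_borel[OF assms]
  have [measurable]: "(\<lambda>x. clamp_M x $ i $ j) \<in> borel_measurable borel" for j
    by (intro borel_measurable_continuous_onI continuous_on_component clamp_M_cont)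
  have [measurable]: "(\<lambda>s. (s, \<xi> i (s - k))) \<in> borel_measurable borel"
    by (intro borel_measurable_continuous_onI continuous_intros continuous_on_compose2[OF ch.cont_\<xi>[of UNIV]]) auto
  have [measurable]: "(\<lambda>s. f (s, \<xi> i (s - k)) $ j) \<in> borel_measurable borel" for j
    by (rule measurable_compose[OF _ piecewise_continuous_borel[OF assms]]) measurable
  show ?thesis unfolding source_eq[abs_def] by measurable
qed

lemma source_diff_bound:
  obtains K where "K > 0" "\<And>i k s f. \<bar>source i f k s\<bar> \<le> K * norm (f (s, \<xi> i (s - k)))"
    "\<And>i k s f h. \<bar>source i f k s - source i h k s\<bar> \<le> K * norm (f (s, \<xi> i (s - k)) - h (s, \<xi> i (s - k)))"
proof -
  obtain K where K: "K > 0" "\<And>x v. x \<in> {0..L} \<Longrightarrow> norm (M x *v v) \<le> K * norm v"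
    using matrix_vector_mult_bound[OF M_cont] by blast
  have b: "\<bar>\<eta> * (clamp_M x *v v) $ i\<bar> \<le> (\<bar>\<eta>\<bar> * K + 1) * norm v" for x v and i :: 2
  proof -
    have "\<bar>(clamp_M x *v v) $ i\<bar> \<le> norm (clamp_M x *v v)" by (rule component_le_norm_cart)
    also have "\<dots> \<le> K * norm v" unfolding clamp_M_def using L_pos by (intro K(2)) auto
    finally have "\<bar>\<eta>\<bar> * \<bar>(clamp_M x *v v) $ i\<bar> \<le> \<bar>\<eta>\<bar> * (K * norm v)" by (intro mult_left_mono) auto
    also have "\<dots> \<le> (\<bar>\<eta>\<bar> * K + 1) * norm v" by (simp add: distrib_right)
    finally show ?thesis by (simp add: abs_mult)
  qed
  show ?thesis
  proof (rule that[of "\<bar>\<eta>\<bar> * K + 1"])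
    show "\<bar>\<eta>\<bar> * K + 1 > 0" using K(1) by (simp add: add_nonneg_pos)
    show "\<bar>source i f k s\<bar> \<le> (\<bar>\<eta>\<bar> * K + 1) * norm (f (s, \<xi> i (s - k)))" for i k s f
      unfolding source_def by (rule b)
    show "\<bar>source i f k s - source i h k s\<bar> \<le> (\<bar>\<eta>\<bar> * K + 1) * norm (f (s, \<xi> i (s - k)) - h (s, \<xi> i (s - k)))"
      for i k s f h
      using b[of "\<xi> i (s - k)" "f (s, \<xi> i (s - k)) - h (s, \<xi> i (s - k))" i] unfolding source_def
      by (simp add: matrix_vector_mult_diff_distrib right_diff_distrib)
  qed
qed

lemma source_integrable:
  assumes "f \<in> piecewise_continuous T"
  shows "integrable lborel (\<lambda>s. indicator {a..t} s * source i f k s)"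
proof -
  obtain B where B: "\<And>p. norm (f p) \<le> B" using assms by (auto simp: piecewise_continuous_def)
  obtain K where K: "K > 0" "\<And>i k s f. \<bar>source i f k s\<bar> \<le> K * norm (f (s, \<xi> i (s - k)))"
    by (rule source_diff_bound) (rule that)
  note [measurable] = source_borel[OF assms]
  show ?thesis
  proof (rule Bochner_Integration.integrable_bound)
    show "integrable lborel (\<lambda>s. indicator {a..t} s * (K * B))"
      by (intro integrable_mult_left integrable_real_indicator) (auto simp: emeasure_lborel_Icc_eq)
    have "\<bar>source i f k s\<bar> \<le> \<bar>K * B\<bar>" for s
    proof -
      have "\<bar>source i f k s\<bar> \<le> K * B"
        by (rule order_trans[OF K(2)]) (use B K(1) in \<open>auto intro: mult_left_mono\<close>)
      then show ?thesis by linarith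
    qed
    then show "AE s in lborel. norm (indicator {a..t} s * source i f k s) \<le> norm (indicator {a..t} s * (K * B))"
      by (auto split: split_indicator)
  qed measurable
qed

definition integral_operator :: "real \<Rightarrow> real^2 \<Rightarrow> (real \<times> real \<Rightarrow> real^2) \<Rightarrow> real \<times> real \<Rightarrow> real^2" where
  "integral_operator T c f p = vec_lambda (\<lambda>i. if p \<in> smooth_region T i then
     (if \<theta> i (snd p) < fst p then c $ i else 0) +
     (LINT s|lborel. indicator {max 0 (fst p - \<theta> i (snd p))..fst p} s * source i f (fst p - \<theta> i (snd p)) s)
   else 0)"

text \<open>
  A characteristic of one family crosses the discontinuity curve of the other family at most
  once, since the two families run in opposite directions.
\<close>

lemma crossing_once:
  assumes "i \<noteq> j"
  shows "AE s in lborel. s \<noteq> \<theta> j (\<xi> i (s - k))"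
proof -
  have mono: "\<xi> 1 x < \<xi> 1 y" "\<theta> 1 x < \<theta> 1 y" if "x < y" for x y
    by (rule DERIV_pos_imp_increasing[OF that], meson ch.\<xi>_deriv speed_pos)
       (rule DERIV_pos_imp_increasing[OF that], meson ch.\<theta>_deriv speed_pos zero_less_divide_1_iff)
  have anti: "\<xi> 2 y < \<xi> 2 x" "\<theta> 2 y < \<theta> 2 x" if "x < y" for x y
    by (rule DERIV_neg_imp_decreasing[OF that], meson ch.\<xi>_deriv speed_neg)
       (rule DERIV_neg_imp_decreasing[OF that], meson ch.\<theta>_deriv speed_neg divide_less_0_1_iff)
  have dec: "\<theta> j (\<xi> i y) < \<theta> j (\<xi> i x)" if "x < y" for x y
  proof (cases "i = 1")
    case True
    then have "j = 2" using assms exhaust_2[of j] by auto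
    then show ?thesis using True anti(2)[OF mono(1)[OF that]] by simp
  next
    case False
    then have "i = 2" "j = 1" using assms exhaust_2[of i] exhaust_2[of j] by auto
    then show ?thesis using mono(2)[OF anti(1)[OF that]] by simp
  qed
  have one: "s1 = s2" if "s1 = \<theta> j (\<xi> i (s1 - k))" "s2 = \<theta> j (\<xi> i (s2 - k))" for s1 s2
    using dec[of "s1 - k" "s2 - k"] dec[of "s2 - k" "s1 - k"] that by (cases s1 s2 rule: linorder_cases) auto
  have "finite {s. s = \<theta> j (\<xi> i (s - k))}"
  proof (cases "\<exists>s. s = \<theta> j (\<xi> i (s - k))")
    case True
    then obtain s0 where "s0 = \<theta> j (\<xi> i (s0 - k))" by blast
    then have "{s. s = \<theta> j (\<xi> i (s - k))} \<subseteq> {s0}" using one by blast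
    then show ?thesis by (rule finite_subset) simp
  qed auto
  from AE_not_in[OF finite_imp_null_set_lborel[OF this]] show ?thesis by auto
qed

end

lemma has_bochner_integral_exp:
  fixes \<kappa> t :: real
  assumes "0 < \<kappa>" "0 \<le> t"
  shows "has_bochner_integral lborel (\<lambda>s. indicator {0..t} s * exp (\<kappa> * s)) ((exp (\<kappa> * t) - 1) / \<kappa>)"
proof -
  have "has_bochner_integral lborel (\<lambda>s. indicator {0..t} s *\<^sub>R exp (\<kappa> * s)) (exp (\<kappa> * t) / \<kappa> - exp (\<kappa> * 0) / \<kappa>)"
    using assms by (intro has_bochner_integral_FTC_Icc)
      (auto simp: has_real_derivative_iff_has_vector_derivative[symmetric]
            intro!: derivative_eq_intros continuous_intros)
  then show ?thesis by (simp add: diff_divide_distrib)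
qed

context hyperbolic begin

lemma smooth_regionD:
  assumes "p \<in> smooth_region T i"
  shows "fst p \<in> {0..T}" "snd p \<in> {0..L}" "fst p - \<theta> i (snd p) \<noteq> 0"
    "max 0 (fst p - \<theta> i (snd p)) \<le> fst p"
  using assms ch.\<theta>_range[of i "snd p"] by (auto simp: smooth_region_def)

lemma along_characteristic:
  assumes "p \<in> smooth_region T i" "s \<in> {max 0 (fst p - \<theta> i (snd p))..fst p}"
  shows "(s, \<xi> i (s - (fst p - \<theta> i (snd p)))) \<in> smooth_region T i"
proof -
  have "s - (fst p - \<theta> i (snd p)) \<in> {0..\<Theta> i}"
    using smooth_regionD[OF assms(1)] assms(2) ch.\<theta>_range[of i "snd p"] by auto
  then have "\<xi> i (s - (fst p - \<theta> i (snd p))) \<in> {0..L}" using ch.\<xi>_range[of i] by blast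
  then show ?thesis
    using smooth_regionD[OF assms(1)] assms(2) by (auto simp: smooth_region_def)
qed

text \<open>
  Continuity of the integral in its end point is a dominated convergence argument: a characteristic off
  the curve \<open>k = 0\<close> of its own family never meets that curve, and by \<open>crossing_once\<close> it meets the curve of the
  other family in a null set of times, so the integrands converge almost everywhere.
\<close>

lemma integral_operator_pres:
  assumes f: "f \<in> piecewise_continuous T"
  shows "integral_operator T c f \<in> piecewise_continuous T"
proof -
  obtain B where B: "\<And>p. norm (f p) \<le> B" using f unfolding piecewise_continuous_def by blast
  obtain K where K: "K > 0" "\<And>i k s f. \<bar>source i f k s\<bar> \<le> K * norm (f (s, \<xi> i (s - k)))"
    by (rule source_diff_bound) (rule that)
  have src: "\<bar>source i f k s\<bar> \<le> K * B" for i k s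
    by (rule order_trans[OF K(2)]) (use B K(1) in \<open>auto intro: mult_left_mono\<close>)
  have KB: "0 \<le> K * B" using src[of 1 0 0] by linarith
  have dom: "has_bochner_integral lborel (\<lambda>s. indicator {0..T} s * (K * B)) (max 0 T * (K * B))"
    by (intro has_bochner_integral_mult_left) (auto simp: has_bochner_integral_iff max_def)
  have ind: "\<bar>indicator {max 0 (fst p - \<theta> i (snd p))..fst p} s * source i f k s\<bar> \<le> indicator {0..T} s * (K * B)"
    if "p \<in> smooth_region T i" for p i k s
    using src[of i k s] KB smooth_regionD[OF that] by (auto split: split_indicator)
  have bound: "\<bar>integral_operator T c f p $ i\<bar> \<le> \<bar>c $ i\<bar> + max 0 T * (K * B)" for p i
  proof (cases "p \<in> smooth_region T i")
    case True
    have "\<bar>LINT s|lborel. indicator {max 0 (fst p - \<theta> i (snd p))..fst p} s * source i f (fst p - \<theta> i (snd p)) s\<bar>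
        \<le> (LINT s|lborel. indicator {0..T} s * (K * B))"
      unfolding real_norm_def[symmetric]
      by (rule Bochner_Integration.integral_norm_bound_integral)
         (use dom source_integrable[OF f] ind[OF True] in \<open>auto simp: has_bochner_integral_iff\<close>)
    also have "\<dots> = max 0 T * (K * B)" using dom by (simp add: has_bochner_integral_iff)
    finally show ?thesis using True by (auto simp: integral_operator_def)
  next
    case False
    then show ?thesis using KB by (simp add: integral_operator_def)
  qed
  have "norm (integral_operator T c f p) \<le> (\<Sum>i\<in>UNIV. \<bar>c $ i\<bar> + max 0 T * (K * B))" for p
    by (rule order_trans[OF norm_le_l1_cart sum_mono]) (simp add: bound)
  then have 1: "\<exists>B. \<forall>p. norm (integral_operator T c f p) \<le> B" by blast
  have 2: "continuous_on (smooth_region T i) (\<lambda>p. integral_operator T c f p $ i)" for i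
    unfolding continuous_on_sequentially
  proof (intro allI ballI impI, elim conjE)
    fix X p assume p: "p \<in> smooth_region T i" and X: "\<forall>n. X n \<in> smooth_region T i" and lim: "X \<longlonglongrightarrow> p"
    define k where "k p = fst p - \<theta> i (snd p)" for p
    have k_cont: "(\<lambda>n. k (X n)) \<longlonglongrightarrow> k p"
      unfolding k_def using lim
      by (intro tendsto_intros continuous_on_tendsto_compose[OF ch.cont_\<theta>[of UNIV]]) auto
    have t_cont: "(\<lambda>n. fst (X n)) \<longlonglongrightarrow> fst p" using lim by (intro tendsto_intros)
    have k_ne: "k p \<noteq> 0" using smooth_regionD[OF p] by (simp add: k_def)
    have c: "(\<lambda>n. if 0 < k (X n) then c $ i else 0) \<longlonglongrightarrow> (if 0 < k p then c $ i else 0)"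
    proof (rule tendsto_eventually)
      show "\<forall>\<^sub>F n in sequentially. (if 0 < k (X n) then c $ i else 0) = (if 0 < k p then c $ i else 0)"
      proof (cases "0 < k p")
        case True
        show ?thesis using order_tendstoD(1)[OF k_cont True] by eventually_elim (use True in auto)
      next
        case False
        then have "k p < 0" using k_ne by simp
        show ?thesis using order_tendstoD(2)[OF k_cont \<open>k p < 0\<close>]
          by eventually_elim (use \<open>k p < 0\<close> in auto)
      qed
    qed
    have "(\<lambda>n. LINT s|lborel. indicator {max 0 (k (X n))..fst (X n)} s * source i f (k (X n)) s)
      \<longlonglongrightarrow> (LINT s|lborel. indicator {max 0 (k p)..fst p} s * source i f (k p) s)"
    proof (rule integral_dominated_convergence)
      show "integrable lborel (\<lambda>s. indicator {0..T} s * (K * B))"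
        using dom by (simp add: has_bochner_integral_iff)
      show "(\<lambda>s. indicator {max 0 (k p)..fst p} s * source i f (k p) s) \<in> borel_measurable lborel"
        using source_integrable[OF f] by blast
      show "(\<lambda>s. indicator {max 0 (k (X n))..fst (X n)} s * source i f (k (X n)) s) \<in> borel_measurable lborel" for n
        using source_integrable[OF f] by blast
      show "AE s in lborel. norm (indicator {max 0 (k (X n))..fst (X n)} s * source i f (k (X n)) s)
          \<le> indicator {0..T} s * (K * B)" for n
        using ind[OF X[rule_format]] by (simp add: k_def)
      have cross: "AE s in lborel. \<forall>j. j \<noteq> i \<longrightarrow> s \<noteq> \<theta> j (\<xi> i (s - k p))"
        by (subst AE_all_countable) (use crossing_once in auto)
      show "AE s in lborel. (\<lambda>n. indicator {max 0 (k (X n))..fst (X n)} s * source i f (k (X n)) s)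
         \<longlonglongrightarrow> indicator {max 0 (k p)..fst p} s * source i f (k p) s"
        using cross AE_lborel_singleton[of "max 0 (k p)"] AE_lborel_singleton[of "fst p"]
      proof eventually_elim
        case (elim s)
        have m_cont: "(\<lambda>n. max 0 (k (X n))) \<longlonglongrightarrow> max 0 (k p)"
          using k_cont by (intro tendsto_intros)
        \<comment> \<open>The indicators of the integration intervals converge except at the two end points.\<close>
        consider "s < max 0 (k p)" | "fst p < s" | "max 0 (k p) < s" "s < fst p" using elim by linarith
        then show ?case
        proof cases
          case 1
          have "\<forall>\<^sub>F n in sequentially. indicator {max 0 (k (X n))..fst (X n)} s * source i f (k (X n)) s = 0"
            using order_tendstoD(1)[OF m_cont 1] by eventually_elim (auto simp: indicator_def)
          moreover have "indicator {max 0 (k p)..fst p} s * source i f (k p) s = 0"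
            using 1 by (auto simp: indicator_def)
          ultimately show ?thesis by (simp only: tendsto_eventually)
        next
          case 2
          have "\<forall>\<^sub>F n in sequentially. indicator {max 0 (k (X n))..fst (X n)} s * source i f (k (X n)) s = 0"
            using order_tendstoD(2)[OF t_cont 2] by eventually_elim (auto simp: indicator_def)
          moreover have "indicator {max 0 (k p)..fst p} s * source i f (k p) s = 0"
            using 2 by (auto simp: indicator_def)
          ultimately show ?thesis by (simp only: tendsto_eventually)
        next
          case 3
          have ev: "\<forall>\<^sub>F n in sequentially. s \<in> {max 0 (k (X n))..fst (X n)}"
            using order_tendstoD(2)[OF m_cont 3(1)] order_tendstoD(1)[OF t_cont 3(2)]
            by eventually_elim auto
          define q where "q n = (s, \<xi> i (s - k (X n)))" for n
          define q0 where "q0 = (s, \<xi> i (s - k p))"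
          have q_lim: "q \<longlonglongrightarrow> q0" unfolding q_def q0_def
            using k_cont by (intro tendsto_intros continuous_on_tendsto_compose[OF ch.cont_\<xi>[of UNIV]]) auto
          have q0_i: "q0 \<in> smooth_region T i"
            using along_characteristic[OF p, of s] 3 by (simp add: q0_def k_def)
          have q0_j: "q0 \<in> smooth_region T j" for j
            using q0_i elim(1) by (cases "j = i") (auto simp: smooth_region_def q0_def)
          have q_i: "\<forall>\<^sub>F n in sequentially. q n \<in> smooth_region T i"
            using ev by eventually_elim (use along_characteristic[OF X[rule_format]] in \<open>simp add: q_def k_def\<close>)
          have q_j: "\<forall>\<^sub>F n in sequentially. q n \<in> smooth_region T j" for j
          proof -
            have "(\<lambda>n. fst (q n) - \<theta> j (snd (q n))) \<longlonglongrightarrow> fst q0 - \<theta> j (snd q0)"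
              using q_lim by (intro tendsto_intros continuous_on_tendsto_compose[OF ch.cont_\<theta>[of UNIV]]) auto
            then have "\<forall>\<^sub>F n in sequentially. fst (q n) - \<theta> j (snd (q n)) \<noteq> 0"
              using smooth_regionD(3)[OF q0_j] by (rule tendsto_imp_eventually_ne)
            with q_i show ?thesis by eventually_elim (auto simp: smooth_region_def)
          qed
          have f_lim: "(\<lambda>n. f (q n) $ j) \<longlonglongrightarrow> f q0 $ j" for j
          proof -
            have "continuous_on (smooth_region T j) (\<lambda>p. f p $ j)"
              using f by (simp add: piecewise_continuous_def)
            from continuous_on_tendsto_compose[OF this q_lim q0_j q_j] show ?thesis .
          qed
          have M_lim: "(\<lambda>n. clamp_M (\<xi> i (s - k (X n)))) \<longlonglongrightarrow> clamp_M (\<xi> i (s - k p))"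
            using k_cont by (intro tendsto_intros continuous_on_tendsto_compose[OF clamp_M_cont[of UNIV]]
                continuous_on_tendsto_compose[OF ch.cont_\<xi>[of UNIV]]) auto
          have "(\<lambda>n. source i f (k (X n)) s) \<longlonglongrightarrow> source i f (k p) s"
            unfolding source_eq
            by (intro tendsto_mult tendsto_const tendsto_sum tendsto_vec_nth M_lim f_lim[unfolded q_def q0_def])
          then have "(\<lambda>n. indicator {max 0 (k p)..fst p} s * source i f (k (X n)) s)
             \<longlonglongrightarrow> indicator {max 0 (k p)..fst p} s * source i f (k p) s"
            by (intro tendsto_intros)
          then show ?thesis
            by (rule Lim_transform_eventually)
               (use ev in \<open>eventually_elim, use 3 in \<open>auto split: split_indicator\<close>\<close>)
        qed
      qed
    qed
    from tendsto_add[OF c this]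
    show "((\<lambda>p. integral_operator T c f p $ i) \<circ> X) \<longlonglongrightarrow> integral_operator T c f p $ i"
      using p X by (simp add: integral_operator_def k_def o_def)
  qed
  show ?thesis unfolding piecewise_continuous_def using 1 2
    by (auto simp: integral_operator_def)
qed

lemma integral_operator_fixed_point:
  assumes T: "0 < T"
  obtains f where "f \<in> piecewise_continuous T" "integral_operator T c f = f"
proof -
  obtain K where K: "K > 0" "\<And>i k s f h. \<bar>source i f k s - source i h k s\<bar> \<le> K * norm (f (s, \<xi> i (s - k)) - h (s, \<xi> i (s - k)))"
    by (rule source_diff_bound) (rule that)
  \<comment> \<open>Twice the rate used for one equation: the bounds for the two components are added.\<close>
  define \<kappa> where "\<kappa> = 4 * K"
  have \<kappa>: "\<kappa> > 0" using K by (simp add: \<kappa>_def)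
  define W where "W p = exp (\<kappa> * max 0 (min T (fst p)))" for p :: "real \<times> real"
  have z: "(\<lambda>_. 0) \<in> piecewise_continuous T" by (auto simp: piecewise_continuous_def)
  obtain B0 where B0: "\<And>p. norm (integral_operator T c (\<lambda>_. 0) p) \<le> B0"
    using integral_operator_pres[OF z, of c] unfolding piecewise_continuous_def by blast
  show thesis
  proof (rule volterra_fixed_point[where C = "piecewise_continuous T" and \<Phi> = "integral_operator T c"
        and W = W and w = "exp (\<kappa> * T)" and ?f0.0 = "\<lambda>_. 0" and ?B0.0 = B0])
    show "(\<lambda>_. 0) \<in> piecewise_continuous T" by (rule z)
    show "integral_operator T c f \<in> piecewise_continuous T" if "f \<in> piecewise_continuous T" for f
      by (rule integral_operator_pres[OF that])
    show "1 \<le> W p" for p using \<kappa> by (simp add: W_def)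
    show "W p \<le> exp (\<kappa> * T)" for p using \<kappa> T by (simp add: W_def)
    show "norm (integral_operator T c (\<lambda>_. 0) p - 0) \<le> B0" for p using B0 by simp
    show "f \<in> piecewise_continuous T"
      if F: "\<And>n. F n \<in> piecewise_continuous T" and u: "uniform_limit UNIV F f sequentially" for F f
    proof -
      have pt: "(\<lambda>n. F n p) \<longlonglongrightarrow> f p" for p
        using tendsto_uniform_limitI[OF u] by auto
      obtain N where N: "\<And>p. dist (F N p) (f p) < 1"
        using u unfolding uniform_limit_sequentially_iff by (meson UNIV_I order_refl zero_less_one)
      obtain B where B: "\<And>p. norm (F N p) \<le> B" using F[of N] unfolding piecewise_continuous_def by blast
      have "norm (f p) \<le> B + 1" for p
        using norm_triangle_le[of "f p - F N p" "F N p" "B + 1"] N[of p] B[of p] by (simp add: dist_norm norm_minus_commute)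
      moreover have "continuous_on (smooth_region T i) (\<lambda>p. f p $ i)" for i
      proof (rule uniform_limit_theorem)
        show "\<forall>\<^sub>F n in sequentially. continuous_on (smooth_region T i) (\<lambda>p. F n p $ i)"
          using F by (simp add: piecewise_continuous_def)
        show "uniform_limit (smooth_region T i) (\<lambda>n p. F n p $ i) (\<lambda>p. f p $ i) sequentially"
          by (rule bounded_linear.uniform_limit[OF bounded_linear_vec_nth uniform_limit_on_subset[OF u]]) simp
      qed simp
      moreover have "f p $ i = 0" if "p \<notin> smooth_region T i" for p i
      proof -
        have "(\<lambda>n. F n p $ i) \<longlonglongrightarrow> f p $ i" using pt by (intro tendsto_intros)
        moreover have "F n p $ i = 0" for n using F[of n] that unfolding piecewise_continuous_def by blast
        ultimately show ?thesis by (simp add: LIMSEQ_const_iff)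
      qed
      ultimately show ?thesis unfolding piecewise_continuous_def by blast
    qed
    show "norm (integral_operator T c f p - integral_operator T c h p) \<le> B / 2 * W p"
      if f: "f \<in> piecewise_continuous T" and h: "h \<in> piecewise_continuous T" and B: "0 \<le> B"
        and b: "\<And>p. norm (f p - h p) \<le> B * W p" for f h B p
    proof -
      have "\<bar>(integral_operator T c f p - integral_operator T c h p) $ i\<bar> \<le> B / 4 * W p" for i
      proof (cases "p \<in> smooth_region T i")
        case True
        define k where "k = fst p - \<theta> i (snd p)"
        define A where "A = {max 0 k..fst p}"
        have t: "fst p \<in> {0..T}" using smooth_regionD[OF True] by simp
        have src: "\<bar>source i f k s - source i h k s\<bar> \<le> K * B * exp (\<kappa> * s)" if "s \<in> {0..fst p}" for s
        proof -
          have "W (s, \<xi> i (s - k)) = exp (\<kappa> * s)" using that t by (auto simp: W_def)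
          then show ?thesis using K(2)[of i f k s h] b[of "(s, \<xi> i (s - k))"] K(1)
            by (smt (verit) mult.assoc mult_left_mono)
        qed
        have e: "(integral_operator T c f p - integral_operator T c h p) $ i
          = (LINT s|lborel. indicator A s * source i f k s - indicator A s * source i h k s)"
          using True source_integrable[OF f] source_integrable[OF h]
          by (simp add: integral_operator_def A_def k_def)
        have l: "\<bar>LINT s|lborel. indicator A s * source i f k s - indicator A s * source i h k s\<bar> \<le> (LINT s|lborel. K * B * (indicator {0..fst p} s * exp (\<kappa> * s)))"
          unfolding real_norm_def[symmetric]
        proof (rule Bochner_Integration.integral_norm_bound_integral)
          show "integrable lborel (\<lambda>s. indicator A s * source i f k s - indicator A s * source i h k s)"
            unfolding A_def using source_integrable[OF f] source_integrable[OF h] by auto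
          show "integrable lborel (\<lambda>s. K * B * (indicator {0..fst p} s * exp (\<kappa> * s)))"
            using has_bochner_integral_exp[OF \<kappa>, of "fst p"] t by (auto simp: has_bochner_integral_iff)
          show "norm (indicator A s * source i f k s - indicator A s * source i h k s)
            \<le> K * B * (indicator {0..fst p} s * exp (\<kappa> * s))" for s
          proof (cases "s \<in> A")
            case True
            then have "s \<in> {0..fst p}" by (simp add: A_def)
            with src[OF this] True show ?thesis by simp
          next
            case False
            then show ?thesis using K(1) B by simp
          qed
        qed
        have "(LINT s|lborel. K * B * (indicator {0..fst p} s * exp (\<kappa> * s))) = K * B * ((exp (\<kappa> * fst p) - 1) / \<kappa>)"
          by (rule has_bochner_integral_integral_eq[OF has_bochner_integral_mult_right[OF has_bochner_integral_exp[OF \<kappa>]]])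
             (use t in auto)
        also have "\<dots> = B / 4 * (exp (\<kappa> * fst p) - 1)" using K by (simp add: \<kappa>_def)
        also have "\<dots> \<le> B / 4 * W p" using B t by (intro mult_left_mono) (auto simp: W_def)
        finally show ?thesis using e l by linarith
      next
        case False
        then have "(integral_operator T c f p - integral_operator T c h p) $ i = 0"
          by (simp add: integral_operator_def)
        moreover have "0 \<le> W p" by (simp add: W_def)
        ultimately show ?thesis using B by simp
      qed
      then have "(\<Sum>i\<in>UNIV. \<bar>(integral_operator T c f p - integral_operator T c h p) $ i\<bar>) \<le> (\<Sum>i\<in>(UNIV::2 set). B / 4 * W p)"
        by (intro sum_mono)
      then show ?thesis
        using norm_le_l1_cart[of "integral_operator T c f p - integral_operator T c h p"] by simp
    qed
  qed (rule that)
qed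

text \<open>
  Constant controls generate states. These are the competitors against which the optimal control of the
  dynamic problem is tested.
\<close>

lemma ex_dynamic_state_constant_control:
  assumes T: "0 < T"
    and sp: "\<And>x. x \<in> {0..L} \<Longrightarrow> dp x = d 1 x" "\<And>x. x \<in> {0..L} \<Longrightarrow> dm x = d 2 x"
  shows "\<exists>q. dynamic_state L dp dm \<eta> M T (\<lambda>_. c) q"
proof -
  obtain f where f: "f \<in> piecewise_continuous T" and fixp: "integral_operator T c f = f"
    by (rule integral_operator_fixed_point[OF T])
  define q where "q t x = f (t, x)" for t x
  obtain B where B: "\<And>p. norm (f p) \<le> B" using f unfolding piecewise_continuous_def by blast
  have "0 \<le> B" using B[of undefined] norm_ge_zero order_trans by blast
  have fb: "f \<in> borel_measurable borel"
    by (subst borel_measurable_euclidean_space)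
       (auto simp: Basis_vec_def inner_axis intro: piecewise_continuous_borel[OF f])
  have qb: "q t \<in> borel_measurable borel" "(\<lambda>t. q t x) \<in> borel_measurable borel" for t x
    unfolding q_def[abs_def]
    by (rule measurable_compose[OF _ fb], intro borel_measurable_continuous_onI continuous_intros)+
  have L2: "L2_on {0..a} g" if "g \<in> borel_measurable borel" "\<And>x. norm (g x) \<le> B"
    for a :: real and g :: "real \<Rightarrow> 'a::euclidean_space"
  proof -
    have m: "g \<in> borel_measurable (lebesgue_on {0..a})"
      using that(1) by (intro measurable_restrict_space1 measurable_completion) auto
    have "integrable (lebesgue_on {0..a}) (\<lambda>x. (norm (g x))\<^sup>2)"
    proof (rule Bochner_Integration.integrable_bound)
      show "integrable (lebesgue_on {0..a}) (\<lambda>_. B\<^sup>2)" by (rule continuous_imp_integrable_real) (rule continuous_on_const)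
      show "AE x in lebesgue_on {0..a}. norm ((norm (g x))\<^sup>2) \<le> norm (B\<^sup>2)"
        using that(2) by (auto intro!: power_mono)
    qed (use m in measurable)
    with m show ?thesis by (simp add: L2_on_def)
  qed
  have sol: "solves_along (\<lambda>_. c) q i t x" if "(t, x) \<in> smooth_region T i" for i t x
  proof -
    define k where "k = t - \<theta> i x"
    have k: "k \<noteq> 0" using smooth_regionD[OF that] by (simp add: k_def)
    have "f (t, x) $ i = (if 0 < k then c $ i else 0) + (LINT s|lborel. indicator {max 0 k..t} s * source i f k s)"
      by (subst fixp[symmetric]) (use that in \<open>simp add: integral_operator_def k_def\<close>)
    then have "has_bochner_integral lborel (\<lambda>s. indicator {max 0 k..t} s * source i f k s)
       (q t x $ i - (if k \<le> 0 then 0 else c $ i))"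
      using source_integrable[OF f] k by (auto simp: has_bochner_integral_iff q_def)
    moreover have "AE s in lborel. s \<in> {max 0 k..t} \<longrightarrow> \<eta> * (M (\<xi> i (s - k)) *v q s (\<xi> i (s - k))) $ i = source i f k s"
    proof (intro AE_I2 impI)
      fix s assume "s \<in> {max 0 k..t}"
      then have "\<xi> i (s - k) \<in> {0..L}"
        using smooth_regionD(2)[OF along_characteristic[OF that, of s]] by (simp add: k_def)
      then show "\<eta> * (M (\<xi> i (s - k)) *v q s (\<xi> i (s - k))) $ i = source i f k s"
        by (simp add: source_def q_def clamp_M_eq)
    qed
    ultimately show ?thesis
      unfolding ch.carried_def Let_def k_def[symmetric]
      by (subst has_bochner_integral_lebesgue_on_iff[where F = "source i f k"]) (auto intro: source_borel[OF f])
  qed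
  have AE_x: "AE x in lebesgue_on {0..L}. \<forall>i. (t, x) \<in> smooth_region T i" if "t \<in> {0..T}" for t
  proof -
    have "AE x in lborel. x \<noteq> \<xi> i t" for i by (rule AE_lborel_singleton)
    then have "AE x in lborel. \<forall>i. x \<noteq> \<xi> i t" by (subst AE_all_countable) auto
    then have "AE x in lborel. \<forall>i. t \<noteq> \<theta> i x"
      by eventually_elim (metis ch.\<xi>_\<theta>)
    then show ?thesis
      by (subst AE_lebesgue_on_iff) (use that in \<open>auto elim!: eventually_mono simp: smooth_region_def\<close>)
  qed
  have AE_t: "AE t in lebesgue_on {0..T}. \<forall>i. (t, x) \<in> smooth_region T i" if "x \<in> {0..L}" for x
  proof -
    have "AE t in lborel. t \<noteq> \<theta> i x" for i by (rule AE_lborel_singleton)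
    then have "AE t in lborel. \<forall>i. t \<noteq> \<theta> i x" by (subst AE_all_countable) auto
    then show ?thesis
      by (subst AE_lebesgue_on_iff) (use that in \<open>auto elim!: eventually_mono simp: smooth_region_def\<close>)
  qed
  have cont: "((\<lambda>s. LINT x|lebesgue_on {0..L}. (norm (q s x - q t x))\<^sup>2) \<longlongrightarrow> 0) (at t within {0..T})"
    if t: "t \<in> {0..T}" for t
    unfolding tendsto_at_iff_sequentially
  proof (intro allI impI)
    fix X assume X: "\<forall>n. X n \<in> {0..T} - {t}" and lim: "X \<longlonglongrightarrow> t"
    have "(\<lambda>n. LINT x|lebesgue_on {0..L}. (norm (q (X n) x - q t x))\<^sup>2) \<longlonglongrightarrow> (LINT x|lebesgue_on {0..L}. 0)"
    proof (rule integral_dominated_convergence)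
      show "integrable (lebesgue_on {0..L}) (\<lambda>_. (2 * B)\<^sup>2)"
        by (rule continuous_imp_integrable_real) (rule continuous_on_const)
      show "(\<lambda>x. (norm (q (X n) x - q t x))\<^sup>2) \<in> borel_measurable (lebesgue_on {0..L})" for n
      proof (intro measurable_restrict_space1 measurable_completion)
        show "(\<lambda>x. (norm (q (X n) x - q t x))\<^sup>2) \<in> borel_measurable lborel"
          using qb(1)[of "X n"] qb(1)[of t] by measurable
      qed
      show "AE x in lebesgue_on {0..L}. norm ((norm (q (X n) x - q t x))\<^sup>2) \<le> (2 * B)\<^sup>2" for n
      proof (intro AE_I2)
        fix x
        have "norm (q (X n) x - q t x) \<le> 2 * B"
          using norm_triangle_ineq4[of "q (X n) x" "q t x"] B[of "(X n, x)"] B[of "(t, x)"] by (simp add: q_def)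
        then have "(norm (q (X n) x - q t x))\<^sup>2 \<le> (2 * B)\<^sup>2"
          by (intro power_mono) auto
        then show "norm ((norm (q (X n) x - q t x))\<^sup>2) \<le> (2 * B)\<^sup>2" by simp
      qed
      show "AE x in lebesgue_on {0..L}. (\<lambda>n. (norm (q (X n) x - q t x))\<^sup>2) \<longlonglongrightarrow> 0"
        using AE_x[OF t]
      proof eventually_elim
        case (elim x)
        have "(\<lambda>n. f (X n, x) $ i) \<longlonglongrightarrow> f (t, x) $ i" for i
        proof (rule continuous_on_tendsto_compose[where f = "\<lambda>p. f p $ i" and g = "\<lambda>n. (X n, x)"])
          show "continuous_on (smooth_region T i) (\<lambda>p. f p $ i)" using f by (simp add: piecewise_continuous_def)
          show "(\<lambda>n. (X n, x)) \<longlonglongrightarrow> (t, x)" using lim by (intro tendsto_intros)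
          show "(t, x) \<in> smooth_region T i" using elim by simp
          have "\<forall>\<^sub>F n in sequentially. X n \<noteq> \<theta> i x"
            using elim by (intro tendsto_imp_eventually_ne[OF lim]) (auto simp: smooth_region_def)
          then show "\<forall>\<^sub>F n in sequentially. (X n, x) \<in> smooth_region T i"
            by eventually_elim (use X elim in \<open>auto simp: smooth_region_def\<close>)
        qed
        then have "(\<lambda>n. q (X n) x) \<longlonglongrightarrow> q t x" unfolding q_def by (rule vec_tendstoI)
        then have "(\<lambda>n. (norm (q (X n) x - q t x))\<^sup>2) \<longlonglongrightarrow> (norm (q t x - q t x))\<^sup>2" by (intro tendsto_intros)
        then show ?case by simp
      qed
    qed auto
    then show "((\<lambda>s. LINT x|lebesgue_on {0..L}. (norm (q s x - q t x))\<^sup>2) \<circ> X) \<longlonglongrightarrow> 0"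
      by (simp add: o_def)
  qed
  have "dynamic_state L dp dm \<eta> M T (\<lambda>_. c) q"
  proof (rule iffD2[OF dynamic_state_iff], goal_cases)
    case 3
    show ?case
  proof (intro conjI ballI)
    show "(\<lambda>(t, x). q t x) \<in> borel_measurable (lebesgue_on ({0..T} \<times> {0..L}))"
      using fb by (intro measurable_restrict_space1 measurable_completion) (simp add: q_def split_beta')
    show "L2_on {0..L} (q t)" for t using qb B by (intro L2) (auto simp: q_def)
    show "AE x in lebesgue_on {0..L}. \<forall>i. solves_along (\<lambda>_. c) q i t x" if "t \<in> {0..T}" for t
      using AE_x[OF that] by eventually_elim (use sol in blast)
    show "AE t in lebesgue_on {0..T}. \<forall>i. solves_along (\<lambda>_. c) q i t x" if "x \<in> {0, L}" for x
    proof -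
      have "x \<in> {0..L}" using that L_pos by auto
      from AE_t[OF this] show ?thesis by eventually_elim (use sol in blast)
    qed
    have "norm (f p $ i) \<le> B" for p i
      using component_le_norm_cart[of "f p" i] B[of p] by simp
    then show "L2_on {0..T} (\<lambda>t. q t L $ 1)" "L2_on {0..T} (\<lambda>t. q t 0 $ 2)"
      by (intro L2; simp add: q_def measurable_compose[OF _ piecewise_continuous_borel[OF f], where f = "\<lambda>t. (t, _)"])+
  qed (rule cont)
  qed (simp_all add: sp)
  then show ?thesis by blast
qed

end

section \<open>Differences, stationary profiles and weights\<close>

lemma power2_diff_le: "(x - y)\<^sup>2 \<le> 2 * x\<^sup>2 + 2 * y\<^sup>2" for x y :: real
  using zero_le_power2[of "x + y"] unfolding power2_sum power2_diff by linarith

lemma L2_on_diff: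
  fixes f g :: "real \<Rightarrow> real"
  assumes "L2_on S f" "L2_on S g"
  shows "L2_on S (\<lambda>x. f x - g x)"
  unfolding L2_on_def
proof
  show m: "(\<lambda>x. f x - g x) \<in> borel_measurable (lebesgue_on S)"
    using assms unfolding L2_on_def by (intro borel_measurable_diff) auto
  show "integrable (lebesgue_on S) (\<lambda>x. (norm (f x - g x))\<^sup>2)"
  proof (rule Bochner_Integration.integrable_bound)
    show "integrable (lebesgue_on S) (\<lambda>x. 2 * (f x)\<^sup>2 + 2 * (g x)\<^sup>2)"
      using assms by (auto simp: L2_on_def)
    show "AE x in lebesgue_on S. norm ((norm (f x - g x))\<^sup>2) \<le> norm (2 * (f x)\<^sup>2 + 2 * (g x)\<^sup>2)"
      using power2_diff_le by auto
  qed (use m in measurable)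
qed

lemma L2_on_continuous:
  fixes f :: "real \<Rightarrow> real"
  assumes "continuous_on {a..b} f"
  shows "L2_on {a..b} f"
  unfolding L2_on_def using assms
  by (auto intro!: continuous_imp_integrable_real continuous_imp_measurable_on_sets_lebesgue continuous_intros)

lemma L2_on_component:
  assumes "L2_on S (f :: real \<Rightarrow> real^2)"
  shows "L2_on S (\<lambda>x. f x $ i)"
  unfolding L2_on_def
proof
  have [measurable]: "f \<in> borel_measurable (lebesgue_on S)" using assms by (simp add: L2_on_def)
  show m: "(\<lambda>x. f x $ i) \<in> borel_measurable (lebesgue_on S)"
    by (rule measurable_compose[OF _ borel_measurable_continuous_onI[OF continuous_on_component]]) (auto intro: continuous_on_id)
  show "integrable (lebesgue_on S) (\<lambda>x. (norm (f x $ i))\<^sup>2)"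
  proof (rule Bochner_Integration.integrable_bound)
    show "integrable (lebesgue_on S) (\<lambda>x. (norm (f x))\<^sup>2)" using assms by (simp add: L2_on_def)
    show "AE x in lebesgue_on S. norm ((norm (f x $ i))\<^sup>2) \<le> norm ((norm (f x))\<^sup>2)"
    proof (intro AE_I2)
      fix x
      have "\<bar>f x $ i\<bar>\<^sup>2 \<le> (norm (f x))\<^sup>2" by (intro power_mono component_le_norm_cart) auto
      then show "norm ((norm (f x $ i))\<^sup>2) \<le> norm ((norm (f x))\<^sup>2)" by simp
    qed
  qed (use m in measurable)
qed

context characteristics begin

lemma continuous_strip_measurable:
  fixes T :: real and w :: "real \<Rightarrow> real"
  assumes "continuous_on {0..L} w"
  shows "(\<lambda>p. w (snd p)) \<in> borel_measurable (lebesgue_on ({0..T} \<times> {0..L}))"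
proof (rule continuous_imp_measurable_on_sets_lebesgue[OF _ strip_lebesgue])
  show "continuous_on ({0..T} \<times> {0..L}) (\<lambda>p. w (snd p))"
    by (rule continuous_on_compose2[OF assms]) (auto intro!: continuous_intros)
qed

lemma L2_strip_mult:
  assumes "L2_strip T f" "continuous_on {0..L} w"
  shows "L2_strip T (\<lambda>p. w (snd p) * f p)"
  unfolding L2_strip_def
proof
  show "(\<lambda>p. w (snd p) * f p) \<in> borel_measurable (lebesgue_on ({0..T} \<times> {0..L}))"
    using continuous_strip_measurable[OF assms(2)] assms(1) unfolding L2_strip_def by (intro borel_measurable_times) auto
  have "integrable (lebesgue_on ({0..T} \<times> {0..L})) (\<lambda>p. (w (snd p))\<^sup>2 * (f p)\<^sup>2)"
    using assms unfolding L2_strip_def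
    by (intro continuous_mult_integrable[where w = "\<lambda>x. (w x)\<^sup>2"] continuous_intros) auto
  then show "integrable (lebesgue_on ({0..T} \<times> {0..L})) (\<lambda>p. (w (snd p) * f p)\<^sup>2)"
    by (simp add: power_mult_distrib)
qed

lemma L2_strip_diff:
  assumes "L2_strip T f" "L2_strip T g"
  shows "L2_strip T (\<lambda>p. f p - g p)"
  unfolding L2_strip_def
proof
  show m: "(\<lambda>p. f p - g p) \<in> borel_measurable (lebesgue_on ({0..T} \<times> {0..L}))"
    using assms unfolding L2_strip_def by (intro borel_measurable_diff) auto
  show "integrable (lebesgue_on ({0..T} \<times> {0..L})) (\<lambda>p. (f p - g p)\<^sup>2)"
  proof (rule Bochner_Integration.integrable_bound)
    show "integrable (lebesgue_on ({0..T} \<times> {0..L})) (\<lambda>p. 2 * (f p)\<^sup>2 + 2 * (g p)\<^sup>2)"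
      using assms by (auto simp: L2_strip_def)
    show "AE p in lebesgue_on ({0..T} \<times> {0..L}). norm ((f p - g p)\<^sup>2) \<le> norm (2 * (f p)\<^sup>2 + 2 * (g p)\<^sup>2)"
      using power2_diff_le by auto
  qed (use m in measurable)
qed

lemma L2_strip_add:
  assumes "L2_strip T f" "L2_strip T g"
  shows "L2_strip T (\<lambda>p. f p + g p)"
  using L2_strip_diff[OF assms(1) L2_strip_mult[OF assms(2), of "\<lambda>_. -1"]] by simp

lemma L2_strip_continuous:
  assumes "continuous_on {0..L} w"
  shows "L2_strip T (\<lambda>p. w (snd p))"
  unfolding L2_strip_def
proof
  have e: "{0..T} \<times> {0..L} = cbox (0, 0) (T, L)" by (simp add: cbox_Pair_eq)
  have "continuous_on ({0..T} \<times> {0..L}) (\<lambda>p. (w (snd p))\<^sup>2)"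
    by (intro continuous_intros continuous_on_compose2[OF assms]) auto
  then show "integrable (lebesgue_on ({0..T} \<times> {0..L})) (\<lambda>p. (w (snd p))\<^sup>2)"
    unfolding e by (rule continuous_imp_integrable)
qed (rule continuous_strip_measurable[OF assms])

lemma carried_diff:
  assumes "carried f1 g1 p1 v1 t x" "carried f2 g2 p2 v2 t x"
  shows "carried (\<lambda>t x. f1 t x - f2 t x) (\<lambda>t x. g1 t x - g2 t x) (\<lambda>x. p1 x - p2 x) (\<lambda>t. v1 t - v2 t) t x"
  using has_bochner_integral_diff[OF assms[unfolded carried_def Let_def]]
  unfolding carried_def Let_def
  by (rule has_bochner_integral_cong[THEN iffD1, rotated -1]) auto

lemma transported_diff:
  assumes "transported T f1 g1 p1 v1" "transported T f2 g2 p2 v2"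
  shows "transported T (\<lambda>t x. f1 t x - f2 t x) (\<lambda>t x. g1 t x - g2 t x) (\<lambda>x. p1 x - p2 x) (\<lambda>t. v1 t - v2 t)"
  unfolding transported_def
proof (intro conjI ballI)
  note t = assms[unfolded transported_def]
  show "L2_strip T (\<lambda>(t, x). f1 t x - f2 t x)" "L2_strip T (\<lambda>(t, x). g1 t x - g2 t x)"
    using L2_strip_diff[of T "case_prod f1" "case_prod f2"] L2_strip_diff[of T "case_prod g1" "case_prod g2"] t
    by (auto simp: split_beta')
  show "AE x in lebesgue_on {0..L}. carried (\<lambda>t x. f1 t x - f2 t x) (\<lambda>t x. g1 t x - g2 t x) (\<lambda>x. p1 x - p2 x) (\<lambda>t. v1 t - v2 t) s x"
    if "s \<in> {0..T}" for s
  proof -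
    have "AE x in lebesgue_on {0..L}. carried f1 g1 p1 v1 s x" "AE x in lebesgue_on {0..L}. carried f2 g2 p2 v2 s x"
      using t that by auto
    then show ?thesis by eventually_elim (rule carried_diff)
  qed
  have "AE s in lebesgue_on {0..T}. carried f1 g1 p1 v1 s b'" "AE s in lebesgue_on {0..T}. carried f2 g2 p2 v2 s b'"
    using t by auto
  then show "AE s in lebesgue_on {0..T}. carried (\<lambda>t x. f1 t x - f2 t x) (\<lambda>t x. g1 t x - g2 t x) (\<lambda>x. p1 x - p2 x) (\<lambda>t. v1 t - v2 t) s b'"
    by eventually_elim (rule carried_diff)
qed (use assms in \<open>auto simp: transported_def intro: L2_on_diff\<close>)

text \<open>
  A function of \<open>x\<close> alone is carried along characteristics by the fundamental theorem of calculus, with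
  its own value at the inflow end as control.
\<close>

lemma carried_stationary:
  assumes \<phi>: "\<And>x. x \<in> {0..L} \<Longrightarrow> (\<phi> has_real_derivative \<gamma> x / d x) (at x within {0..L})"
    and \<gamma>: "continuous_on {0..L} \<gamma>" and t: "0 \<le> t" and x: "x \<in> {0..L}"
  shows "carried (\<lambda>_. \<phi>) (\<lambda>_. \<gamma>) \<phi> (\<lambda>_. \<phi> b) t x"
proof -
  define k where "k = t - \<theta> x"
  define a where "a = max 0 k"
  have \<theta>x: "\<theta> x \<in> {0..\<Theta>}" using x \<theta>_range by blast
  have "a \<le> t" using t \<theta>x by (auto simp: a_def k_def)
  have x_in: "\<xi> (s - k) \<in> {0..L}" if "s \<in> {a..t}" for s
    using that \<theta>x \<xi>_range[of "s - k"] by (auto simp: a_def k_def)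
  have img: "(\<lambda>s. \<xi> (s - k)) ` {a..t} \<subseteq> {0..L}" using x_in by blast
  have der: "((\<lambda>s. \<phi> (\<xi> (s - k))) has_real_derivative \<gamma> (\<xi> (s - k))) (at s within {a..t})" if "s \<in> {a..t}" for s
  proof -
    have "((\<lambda>s. \<xi> (s - k)) has_real_derivative d (\<xi> (s - k))) (at s within {a..t})"
      by (auto intro!: derivative_eq_intros DERIV_chain'[OF _ \<xi>_deriv, THEN DERIV_cong])
    from DERIV_image_chain[OF DERIV_subset[OF \<phi>[OF x_in[OF that]] img] this]
    show ?thesis using d_nz by (simp add: o_def)
  qed
  have "continuous_on {a..t} (\<lambda>s. \<gamma> (\<xi> (s - k)))"
    by (intro continuous_on_compose2[OF \<gamma> _ img] continuous_on_compose2[OF cont_\<xi>[of UNIV]] continuous_intros) auto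
  then have "(\<lambda>s. \<gamma> (\<xi> (s - k))) absolutely_integrable_on {a..t}"
    by (rule absolutely_integrable_continuous_real)
  moreover have "integral {a..t} (\<lambda>s. \<gamma> (\<xi> (s - k))) = \<phi> (\<xi> (t - k)) - \<phi> (\<xi> (a - k))"
    using \<open>a \<le> t\<close> der by (intro integral_unique fundamental_theorem_of_calculus)
      (auto simp: has_real_derivative_iff_has_vector_derivative)
  ultimately have "has_bochner_integral (lebesgue_on {a..t}) (\<lambda>s. \<gamma> (\<xi> (s - k))) (\<phi> (\<xi> (t - k)) - \<phi> (\<xi> (a - k)))"
    by (subst has_bochner_integral_lebesgue_on_iff_integral) auto
  moreover have "\<phi> (\<xi> (t - k)) - \<phi> (\<xi> (a - k)) = \<phi> x - (if k \<le> 0 then \<phi> (\<xi> (- k)) else \<phi> b)"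
    by (auto simp: a_def max_def \<xi>_0 k_def)
  ultimately show ?thesis
    unfolding carried_def Let_def k_def[symmetric] a_def[symmetric] by simp
qed

lemma transported_stationary:
  assumes \<phi>: "\<And>x. x \<in> {0..L} \<Longrightarrow> (\<phi> has_real_derivative \<gamma> x / d x) (at x within {0..L})"
    and \<gamma>: "continuous_on {0..L} \<gamma>"
  shows "transported T (\<lambda>_. \<phi>) (\<lambda>_. \<gamma>) \<phi> (\<lambda>_. \<phi> b)"
  unfolding transported_def
proof (intro conjI ballI)
  have \<phi>_cont: "continuous_on {0..L} \<phi>" by (rule DERIV_continuous_on[OF \<phi>])
  show "L2_strip T (\<lambda>(t, x). \<phi> x)" "L2_strip T (\<lambda>(t, x). \<gamma> x)"
    using L2_strip_continuous[OF \<phi>_cont] L2_strip_continuous[OF \<gamma>] by (auto simp: split_beta')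
  show "AE x in lebesgue_on {0..L}. carried (\<lambda>_. \<phi>) (\<lambda>_. \<gamma>) \<phi> (\<lambda>_. \<phi> b) t x" if "t \<in> {0..T}" for t
    using that by (intro AE_I2 carried_stationary \<phi> \<gamma>) auto
  show "AE t in lebesgue_on {0..T}. carried (\<lambda>_. \<phi>) (\<lambda>_. \<gamma>) \<phi> (\<lambda>_. \<phi> b) t b'"
    using b'_in by (intro AE_I2 carried_stationary \<phi> \<gamma>) auto
qed (intro L2_on_continuous continuous_on_const DERIV_continuous_on[OF \<phi>]; assumption)+

text \<open>
  The weight \<open>\<phi>\<close> is placed in the integral over \<open>x\<close>; the Jacobian \<open>1 / \<bar>d\<bar>\<close> of the labels is absorbed by
  choosing \<open>\<psi> = \<bar>d\<bar> \<phi>\<close> in \<open>balance_law\<close>.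
\<close>

lemma weighted_balance_law:
  assumes tr1: "transported T f1 g1 p1 v1" and tr2: "transported T f2 g2 p2 v2" and T: "0 < T"
    and s: "s\<^sup>2 = 1" "\<And>x. \<bar>d x\<bar> = s * d x"
    and \<psi>: "\<And>x. x \<in> {0..L} \<Longrightarrow> ((\<lambda>x. \<phi> x * d x) has_real_derivative \<psi>' x) (at x within {0..L})"
    and \<psi>': "continuous_on {0..L} \<psi>'"
  defines "h \<equiv> \<lambda>(t, x). \<psi>' x * (f1 t x * f2 t x) + \<phi> x * (f1 t x * g2 t x + g1 t x * f2 t x)"
  shows "integrable (lebesgue_on ({0..T} \<times> {0..L})) h" (is ?int)
    and "(LINT p|lebesgue_on ({0..T} \<times> {0..L}). h p) =
      (LINT x|lebesgue_on {0..L}. \<phi> x * (f1 T x * f2 T x))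
      - (LINT x|lebesgue_on {0..L}. \<phi> x * (p1 x * p2 x))
      + \<phi> b' * \<bar>d b'\<bar> * (LINT t|lebesgue_on {0..T}. f1 t b' * f2 t b')
      - \<phi> b * \<bar>d b\<bar> * (LINT t|lebesgue_on {0..T}. v1 t * v2 t)" (is ?eq)
proof -
  define \<psi> where "\<psi> x = s * (\<phi> x * d x)" for x
  have der: "(\<psi> has_real_derivative s * \<psi>' x) (at x within {0..L})" if "x \<in> {0..L}" for x
    unfolding \<psi>_def[abs_def] by (rule DERIV_cmult[OF \<psi>[OF that]])
  have cont: "continuous_on {0..L} (\<lambda>x. s * \<psi>' x)" using \<psi>' by (intro continuous_intros)
  have e: "\<psi> x * y / \<bar>d x\<bar> = \<phi> x * y" "\<psi> x = \<phi> x * \<bar>d x\<bar>" for x y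
    using d_nz[of x] s by (auto simp: \<psi>_def field_simps power2_eq_square)
  have "((s * \<psi>' x) * d x * y + \<psi> x * z) / \<bar>d x\<bar> = \<psi>' x * y + \<phi> x * z" for x y z
  proof -
    have "(s * \<psi>' x) * d x * y + \<psi> x * z = (s * d x) * (\<psi>' x * y + \<phi> x * z)"
      by (simp add: \<psi>_def algebra_simps)
    moreover have "s * d x \<noteq> 0" using s(1) d_nz[of x] by auto
    ultimately show ?thesis unfolding s(2) by simp
  qed
  then have h: "(\<lambda>(t, x). ((s * \<psi>' x) * d x * (f1 t x * f2 t x)
      + \<psi> x * (f1 t x * g2 t x + g1 t x * f2 t x)) / \<bar>d x\<bar>) = h"
    by (auto simp: h_def fun_eq_iff)
  note b = balance_law[OF tr1 tr2 T der cont, unfolded h]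
  show ?int using b(1) by simp
  show ?eq using b(2) unfolding e(1) e(2)[of b] e(2)[of b'] .
qed

end

text \<open>
  Continuity into the space of square integrable functions gives local bounds on the norm, and a
  bisection argument makes them uniform on the compact time interval.
\<close>

lemma bounded_of_L2_continuous:
  fixes r :: "real \<Rightarrow> real \<Rightarrow> real^2"
  assumes L2: "\<And>t. t \<in> {0..T} \<Longrightarrow> L2_on {0..L} (r t)"
    and cont: "\<And>t. t \<in> {0..T} \<Longrightarrow>
      ((\<lambda>s. LINT x|lebesgue_on {0..L}. (norm (r s x - r t x))\<^sup>2) \<longlongrightarrow> 0) (at t within {0..T})"
    and T: "0 \<le> T"
  obtains B where "\<And>t. t \<in> {0..T} \<Longrightarrow> (LINT x|lebesgue_on {0..L}. (norm (r t x))\<^sup>2) \<le> B"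
proof -
  let ?N = "\<lambda>t. LINT x|lebesgue_on {0..L}. (norm (r t x))\<^sup>2"
  have sq: "(norm (a - b :: real^2))\<^sup>2 \<le> 2 * (norm a)\<^sup>2 + 2 * (norm b)\<^sup>2" for a b
  proof -
    have "(norm (a - b))\<^sup>2 \<le> (norm a + norm b)\<^sup>2"
      using norm_triangle_ineq4[of a b] by (intro power_mono) auto
    also have "\<dots> \<le> 2 * (norm a)\<^sup>2 + 2 * (norm b)\<^sup>2"
      using zero_le_power2[of "norm a - norm b"] unfolding power2_sum power2_diff by linarith
    finally show ?thesis .
  qed
  have two: "?N s \<le> 2 * (LINT x|lebesgue_on {0..L}. (norm (r s x - r t x))\<^sup>2) + 2 * ?N t"
    if "s \<in> {0..T}" "t \<in> {0..T}" for s t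
  proof -
    have m: "r s \<in> borel_measurable (lebesgue_on {0..L})" "r t \<in> borel_measurable (lebesgue_on {0..L})"
      and i: "integrable (lebesgue_on {0..L}) (\<lambda>x. (norm (r s x))\<^sup>2)" "integrable (lebesgue_on {0..L}) (\<lambda>x. (norm (r t x))\<^sup>2)"
      using L2 that by (auto simp: L2_on_def)
    have i2: "integrable (lebesgue_on {0..L}) (\<lambda>x. (norm (r s x - r t x))\<^sup>2)"
    proof (rule Bochner_Integration.integrable_bound)
      show "integrable (lebesgue_on {0..L}) (\<lambda>x. 2 * (norm (r s x))\<^sup>2 + 2 * (norm (r t x))\<^sup>2)"
        using i by auto
      show "AE x in lebesgue_on {0..L}. norm ((norm (r s x - r t x))\<^sup>2) \<le> norm (2 * (norm (r s x))\<^sup>2 + 2 * (norm (r t x))\<^sup>2)"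
        using sq by auto
    qed (use m in measurable)
    have "?N s \<le> (LINT x|lebesgue_on {0..L}. 2 * (norm (r s x - r t x))\<^sup>2 + 2 * (norm (r t x))\<^sup>2)"
    proof (rule integral_mono)
      fix x show "(norm (r s x))\<^sup>2 \<le> 2 * (norm (r s x - r t x))\<^sup>2 + 2 * (norm (r t x))\<^sup>2"
        using sq[of "r s x - r t x" "- r t x"] by simp
    qed (use i i2 in auto)
    also have "\<dots> = 2 * (LINT x|lebesgue_on {0..L}. (norm (r s x - r t x))\<^sup>2) + 2 * ?N t"
      using i i2 by simp
    finally show ?thesis .
  qed
  have "\<exists>B. \<forall>t\<in>{0..T} \<inter> {0..T}. ?N t \<le> B"
    using T
  proof (induction rule: Bolzano[where P = "\<lambda>a b. \<exists>B. \<forall>t\<in>{a..b} \<inter> {0..T}. ?N t \<le> B"])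
    case (trans a b c)
    then obtain B1 B2 where "\<forall>t\<in>{a..b} \<inter> {0..T}. ?N t \<le> B1" "\<forall>t\<in>{b..c} \<inter> {0..T}. ?N t \<le> B2" by blast
    then have "\<forall>t\<in>{a..c} \<inter> {0..T}. ?N t \<le> max B1 B2"
      using trans by (metis IntE IntI atLeastAtMost_iff le_max_iff_disj linorder_le_cases)
    then show ?case by blast
  next
    case (local t)
    then have t: "t \<in> {0..T}" by simp
    have "\<forall>\<^sub>F s in at t within {0..T}. (LINT x|lebesgue_on {0..L}. (norm (r s x - r t x))\<^sup>2) < 1"
      using cont[OF t] by (rule order_tendstoD) simp
    then obtain \<delta> where \<delta>: "\<delta> > 0"
      and close: "\<And>s. s \<in> {0..T} \<Longrightarrow> s \<noteq> t \<Longrightarrow> dist s t < \<delta> \<Longrightarrow>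
         (LINT x|lebesgue_on {0..L}. (norm (r s x - r t x))\<^sup>2) < 1"
      unfolding eventually_at by blast
    have "?N s \<le> 2 + 2 * ?N t" if "s \<in> {0..T}" "dist s t < \<delta>" for s
    proof (cases "s = t")
      case True
      have "0 \<le> ?N t" by (intro integral_nonneg_AE) auto
      then show ?thesis using True by simp
    next
      case False
      then show ?thesis using two[OF that(1) t] close[OF that(1) False that(2)] by linarith
    qed
    then have "\<exists>B. \<forall>s\<in>{a..b} \<inter> {0..T}. ?N s \<le> B" if "a \<le> t" "t \<le> b" "b - a < \<delta>" for a b
      using that by (intro exI[of _ "2 + 2 * ?N t"]) (auto simp: dist_real_def)
    then show ?case using \<delta> by blast
  qed
  then obtain B where "\<forall>t\<in>{0..T}. ?N t \<le> B" by auto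
  then show ?thesis by (intro that[of B]) blast
qed

text \<open>
  Tonelli's theorem in the form needed for states, which are jointly Lebesgue measurable and whose
  integrals over the slices are bounded in time.
\<close>

lemma strip_integral_of_bounded_slices:
  fixes h :: "real \<Rightarrow> real \<Rightarrow> real"
  assumes m: "(\<lambda>p. h (fst p) (snd p)) \<in> borel_measurable (lebesgue_on ({0..T} \<times> {0..L}))"
    and i: "\<And>t. t \<in> {0..T} \<Longrightarrow> integrable (lebesgue_on {0..L}) (h t)"
    and nonneg: "\<And>t x. 0 \<le> h t x"
    and B: "\<And>t. t \<in> {0..T} \<Longrightarrow> (LINT x|lebesgue_on {0..L}. h t x) \<le> B"
  shows "integrable (lebesgue_on ({0..T} \<times> {0..L})) (\<lambda>p. h (fst p) (snd p))"
    and "(LINT p|lebesgue_on ({0..T} \<times> {0..L}). h (fst p) (snd p))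
      = (LINT t|lebesgue_on {0..T}. LINT x|lebesgue_on {0..L}. h t x)"
proof -
  let ?S = "{0..T} \<times> {0..L}"
  have S: "?S \<in> sets (borel :: (real \<times> real) measure)"
    by (intro borel_closed closed_Times) auto
  have Lb: "{0..a} \<in> sets (borel :: real measure)" for a :: real by simp
  obtain F where F: "F \<in> borel_measurable borel" and ae: "AE p in lborel. p \<in> ?S \<longrightarrow> h (fst p) (snd p) = F p"
    by (rule borel_representative[OF m S])
  have [measurable]: "F \<in> borel_measurable (borel \<Otimes>\<^sub>M borel)" using F by (simp add: borel_prod)
  have "AE p in lborel \<Otimes>\<^sub>M lborel. p \<in> ?S \<longrightarrow> h (fst p) (snd p) = F p"
    using ae unfolding lborel_prod .
  from lborel_pair.AE_pair[OF this]
  have ae2: "AE t in lborel. AE x in lborel. (t, x) \<in> ?S \<longrightarrow> h t x = F (t, x)" by simp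
  define Q where "Q p = indicator {0..T} (fst p) * (indicator {0..L} (snd p) * F p)" for p
  have [measurable]: "Q \<in> borel_measurable (borel \<Otimes>\<^sub>M borel)" unfolding Q_def[abs_def] by measurable
  have slice: "AE t in lborel. integrable lborel (\<lambda>x. Q (t, x)) \<and>
      (LINT x|lborel. norm (Q (t, x))) = indicator {0..T} t * (LINT x|lebesgue_on {0..L}. h t x) \<and>
      (LINT x|lborel. Q (t, x)) = indicator {0..T} t * (LINT x|lebesgue_on {0..L}. h t x)"
    using ae2
  proof eventually_elim
    case (elim t)
    show ?case
    proof (cases "t \<in> {0..T}")
      case True
      have aex: "AE x in lborel. x \<in> {0..L} \<longrightarrow> h t x = F (t, x)"
        using elim by eventually_elim (use True in auto)
      have Ft: "(\<lambda>x. F (t, x)) \<in> borel_measurable borel" by measurable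
      have "integrable lborel (\<lambda>x. indicator {0..L} x * F (t, x))"
        using i[OF True] integrable_lebesgue_on_iff[OF Lb Ft aex] by simp
      moreover have "(LINT x|lebesgue_on {0..L}. h t x) = (LINT x|lborel. indicator {0..L} x * F (t, x))"
        by (rule LINT_lebesgue_on_eq[OF Lb Ft aex])
      moreover have "AE x in lborel. norm (Q (t, x)) = Q (t, x)"
        using aex
      proof eventually_elim
        case (elim x)
        then show ?case using nonneg[of t x] by (auto simp: Q_def split: split_indicator)
      qed
      then have "(LINT x|lborel. norm (Q (t, x))) = (LINT x|lborel. Q (t, x))"
        by (intro integral_cong_AE) auto
      ultimately show ?thesis using True by (simp add: Q_def)
    qed (simp add: Q_def)
  qed
  have Qi: "integrable (lborel \<Otimes>\<^sub>M lborel) Q"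
  proof (rule lborel_pair.Fubini_integrable)
    show "integrable lborel (\<lambda>t. LINT x|lborel. norm (Q (t, x)))"
    proof (rule Bochner_Integration.integrable_bound)
      show "integrable lborel (\<lambda>t. indicator {0..T} t * B)"
        by (intro integrable_mult_left integrable_real_indicator) (auto simp: emeasure_lborel_Icc_eq)
      show "AE t in lborel. norm (LINT x|lborel. norm (Q (t, x))) \<le> norm (indicator {0..T} t * B)"
        using slice
      proof eventually_elim
        case (elim t)
        have "0 \<le> (LINT x|lebesgue_on {0..L}. h t x)" by (intro integral_nonneg_AE) (simp add: nonneg)
        then show ?case using elim B[of t] by (auto split: split_indicator)
      qed
    qed measurable
    show "AE t in lborel. integrable lborel (\<lambda>x. Q (t, x))" using slice by eventually_elim simp
  qed measurable
  have Qe: "(\<lambda>p. indicator ?S p * F p) = Q" by (auto simp: Q_def fun_eq_iff split: split_indicator)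
  show "integrable (lebesgue_on ?S) (\<lambda>p. h (fst p) (snd p))"
    using Qi integrable_lebesgue_on_iff[OF S F ae] unfolding Qe lborel_prod by simp
  have "(LINT p|lebesgue_on ?S. h (fst p) (snd p)) = (LINT p|(lborel \<Otimes>\<^sub>M lborel). Q p)"
    using LINT_lebesgue_on_eq[OF S F ae] unfolding Qe lborel_prod .
  also have "\<dots> = (LINT t|lborel. LINT x|lborel. Q (t, x))"
    by (rule lborel_pair.integral_fst'[OF Qi, symmetric])
  also have "\<dots> = (LINT t|lborel. indicator {0..T} t * (LINT x|lborel. Q (t, x)))"
    by (intro Bochner_Integration.integral_cong) (auto simp: Q_def split: split_indicator)
  also have "\<dots> = (LINT t|lebesgue_on {0..T}. LINT x|lebesgue_on {0..L}. h t x)"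
  proof (rule LINT_lebesgue_on_eq[OF Lb, symmetric])
    show "AE t in lborel. t \<in> {0..T} \<longrightarrow> (LINT x|lebesgue_on {0..L}. h t x) = (LINT x|lborel. Q (t, x))"
      using slice by eventually_elim auto
  qed measurable
  finally show "(LINT p|lebesgue_on ?S. h (fst p) (snd p))
      = (LINT t|lebesgue_on {0..T}. LINT x|lebesgue_on {0..L}. h t x)" .
qed

section \<open>The state relative to a stationary state\<close>

lemma norm2_sq: "(norm (v :: real^2))\<^sup>2 = (\<Sum>i\<in>UNIV. (v $ i)\<^sup>2)"
  unfolding power2_norm_eq_inner inner_vec_def by (simp add: power2_eq_square)

lemma L2_on_integrable:
  fixes f :: "real \<Rightarrow> real"
  assumes "L2_on {a..b} f"
  shows "integrable (lebesgue_on {a..b}) f" "integrable (lebesgue_on {a..b}) (\<lambda>x. (f x)\<^sup>2)"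
  using L2_on_mult_integrable[OF assms L2_on_continuous[OF continuous_on_const[of _ 1]]] assms
  by (auto simp: L2_on_def)

lemma L2_on_mult:
  fixes w f :: "real \<Rightarrow> real"
  assumes f: "L2_on {a..b} f" and w: "continuous_on {a..b} w"
  shows "integrable (lebesgue_on {a..b}) (\<lambda>x. w x * f x)"
    "integrable (lebesgue_on {a..b}) (\<lambda>x. w x * (f x)\<^sup>2)"
proof -
  show "integrable (lebesgue_on {a..b}) (\<lambda>x. w x * f x)"
    by (rule L2_on_mult_integrable[OF L2_on_continuous[OF w] f])
  obtain B where B: "\<And>x. x \<in> {a..b} \<Longrightarrow> \<bar>w x\<bar> \<le> B"
    using continuous_on_Icc_bounded[OF w] by blast
  have m: "f \<in> borel_measurable (lebesgue_on {a..b})" "w \<in> borel_measurable (lebesgue_on {a..b})"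
    using f L2_on_continuous[OF w] by (auto simp: L2_on_def)
  show "integrable (lebesgue_on {a..b}) (\<lambda>x. w x * (f x)\<^sup>2)"
  proof (rule Bochner_Integration.integrable_bound)
    show "integrable (lebesgue_on {a..b}) (\<lambda>x. B * (f x)\<^sup>2)"
      using L2_on_integrable(2)[OF f] by simp
    show "AE x in lebesgue_on {a..b}. norm (w x * (f x)\<^sup>2) \<le> norm (B * (f x)\<^sup>2)"
    proof (intro AE_I2)
      fix x assume "x \<in> space (lebesgue_on {a..b})"
      then have "\<bar>w x\<bar> \<le> \<bar>B\<bar>" using B[of x] by auto
      then show "norm (w x * (f x)\<^sup>2) \<le> norm (B * (f x)\<^sup>2)"
        by (auto simp: abs_mult intro: mult_right_mono)
    qed
  qed (use m in measurable)
qed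

context hyperbolic begin

text \<open>
  The sign of the speed.
\<close>

definition orientation :: "2 \<Rightarrow> real" where "orientation i = (if i = 1 then 1 else - 1)"

lemma orientation_sq: "(orientation i)\<^sup>2 = 1" by (simp add: orientation_def)

lemma abs_speed: "\<bar>d i x\<bar> = orientation i * d i x"
  using speed_pos[of x] speed_neg[of x] exhaust_2[of i] by (auto simp: orientation_def)

lemma b_in: "b i \<in> {0..L}" "b' i \<in> {0..L}"
  using ch.b_in[of i] ch.b'_in[of i] by auto

lemma d_cont: "continuous_on A (d i)"
  using ch.d_cont continuous_on_subset by blast

definition stationary :: "(real \<Rightarrow> real^2) \<Rightarrow> bool" where
  "stationary R \<longleftrightarrow> (\<forall>i. \<forall>x\<in>{0..L}.
     ((\<lambda>x. R x $ i) has_real_derivative \<eta> * (M x *v R x) $ i / d i x) (at x within {0..L}))"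

lemma stationary_cont:
  assumes "stationary R"
  shows "continuous_on {0..L} (\<lambda>x. R x $ i)" "continuous_on {0..L} R"
    "continuous_on {0..L} (\<lambda>x. \<eta> * (M x *v R x) $ i)"
proof -
  show c: "continuous_on {0..L} (\<lambda>x. R x $ i)" for i
    by (rule DERIV_continuous_on) (use assms in \<open>unfold stationary_def, blast\<close>)
  have "continuous_on {0..L} (\<lambda>x. \<chi> i. R x $ i)" using c by (rule continuous_on_vec_lambda)
  then show R: "continuous_on {0..L} R" by simp
  show "continuous_on {0..L} (\<lambda>x. \<eta> * (M x *v R x) $ i)"
    by (intro continuous_intros continuous_on_matrix_vector_mult M_cont R)
qed

lemma stationary_transported:
  assumes "stationary R"
  shows "ch.transported i T (\<lambda>_ x. R x $ i) (\<lambda>_ x. \<eta> * (M x *v R x) $ i) (\<lambda>x. R x $ i) (\<lambda>_. R (b i) $ i)"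
  using ch.transported_stationary[of "\<lambda>x. R x $ i" "\<lambda>x. \<eta> * (M x *v R x) $ i" i T]
    stationary_cont[OF assms] assms by (simp add: stationary_def)

lemma L2_on_norm_sq:
  assumes "L2_on {0..L} (f :: real \<Rightarrow> real^2)"
  shows "integrable (lebesgue_on {0..L}) (\<lambda>x. (norm (f x))\<^sup>2)"
  using assms by (simp add: L2_on_def)

lemma state_strip:
  assumes dyn: "dynamic_state L dp dm \<eta> M T u r" and T: "0 < T" and R: "stationary R"
  shows "integrable (lebesgue_on ({0..T} \<times> {0..L})) (\<lambda>p. (norm (r (fst p) (snd p) - R (snd p)))\<^sup>2)"
    and "(LINT p|lebesgue_on ({0..T} \<times> {0..L}). (norm (r (fst p) (snd p) - R (snd p)))\<^sup>2)
      = (LINT t|lebesgue_on {0..T}. LINT x|lebesgue_on {0..L}. (norm (r t x - R x))\<^sup>2)"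
proof -
  have m: "(\<lambda>p. r (fst p) (snd p)) \<in> borel_measurable (lebesgue_on ({0..T} \<times> {0..L}))"
    and L2: "\<And>t. t \<in> {0..T} \<Longrightarrow> L2_on {0..L} (r t)"
    and c: "\<And>t. t \<in> {0..T} \<Longrightarrow> ((\<lambda>s. LINT x|lebesgue_on {0..L}. (norm (r s x - r t x))\<^sup>2) \<longlongrightarrow> 0) (at t within {0..T})"
    using dyn unfolding dynamic_state_def by (auto simp: split_beta')
  have Rc: "continuous_on {0..L} R" by (rule stationary_cont[OF R])
  have mR: "(\<lambda>p. R (snd p)) \<in> borel_measurable (lebesgue_on ({0..T} \<times> {0..L}))"
  proof (rule continuous_imp_measurable_on_sets_lebesgue[OF _ ch.strip_lebesgue])
    show "continuous_on ({0..T} \<times> {0..L}) (\<lambda>p. R (snd p))"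
      by (rule continuous_on_compose2[OF Rc]) (auto intro!: continuous_intros)
  qed
  have L2z: "L2_on {0..L} (\<lambda>x. r t x - R x)" if "t \<in> {0..T}" for t
    unfolding L2_on_def
  proof
    have "R \<in> borel_measurable (lebesgue_on {0..L})"
      using Rc by (intro continuous_imp_measurable_on_sets_lebesgue) auto
    then show m: "(\<lambda>x. r t x - R x) \<in> borel_measurable (lebesgue_on {0..L})"
      using L2[OF that] unfolding L2_on_def by (intro borel_measurable_diff) auto
    have "integrable (lebesgue_on {0..L}) (\<lambda>x. \<Sum>i\<in>UNIV. (r t x $ i - R x $ i)\<^sup>2)"
      using L2_on_diff[OF L2_on_component[OF L2[OF that]] L2_on_continuous[OF stationary_cont(1)[OF R]]]
      by (intro Bochner_Integration.integrable_sum) (auto intro: L2_on_integrable)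
    then show "integrable (lebesgue_on {0..L}) (\<lambda>x. (norm (r t x - R x))\<^sup>2)"
      by (simp add: norm2_sq)
  qed
  obtain B where "\<And>t. t \<in> {0..T} \<Longrightarrow> (LINT x|lebesgue_on {0..L}. (norm (r t x - R x))\<^sup>2) \<le> B"
  proof (rule bounded_of_L2_continuous[of T L "\<lambda>t x. r t x - R x"])
    show "((\<lambda>s. LINT x|lebesgue_on {0..L}. (norm (r s x - R x - (r t x - R x)))\<^sup>2) \<longlongrightarrow> 0) (at t within {0..T})"
      if "t \<in> {0..T}" for t using c[OF that] by simp
  qed (use L2z T in auto)
  note s = strip_integral_of_bounded_slices[of "\<lambda>t x. (norm (r t x - R x))\<^sup>2" T L, OF _ L2_on_norm_sq[OF L2z] _ this]
  have mz: "(\<lambda>p. (norm (r (fst p) (snd p) - R (snd p)))\<^sup>2) \<in> borel_measurable (lebesgue_on ({0..T} \<times> {0..L}))"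
    using m mR by measurable
  show "integrable (lebesgue_on ({0..T} \<times> {0..L})) (\<lambda>p. (norm (r (fst p) (snd p) - R (snd p)))\<^sup>2)"
    by (rule s(1)) (use mz in auto)
  show "(LINT p|lebesgue_on ({0..T} \<times> {0..L}). (norm (r (fst p) (snd p) - R (snd p)))\<^sup>2)
      = (LINT t|lebesgue_on {0..T}. LINT x|lebesgue_on {0..L}. (norm (r t x - R x))\<^sup>2)"
    by (rule s(2)) (use mz in auto)
qed

lemma stationary_zero: "stationary (\<lambda>_. 0)"
  by (simp add: stationary_def)

lemma dynamic_transported:
  assumes dyn: "dynamic_state L dp dm \<eta> M T u r" and T: "0 < T" and u: "L2_on {0..T} u"
    and sp: "\<And>x. x \<in> {0..L} \<Longrightarrow> dp x = d 1 x" "\<And>x. x \<in> {0..L} \<Longrightarrow> dm x = d 2 x"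
  shows "ch.transported i T (\<lambda>t x. r t x $ i) (\<lambda>t x. \<eta> * (M x *v r t x) $ i) (\<lambda>_. 0) (\<lambda>t. u t $ i)"
proof -
  have m: "(\<lambda>p. r (fst p) (snd p)) \<in> borel_measurable (lebesgue_on ({0..T} \<times> {0..L}))"
    and L2: "\<And>t. t \<in> {0..T} \<Longrightarrow> L2_on {0..L} (r t)"
    and car: "\<And>t. t \<in> {0..T} \<Longrightarrow> AE x in lebesgue_on {0..L}. \<forall>i. solves_along u r i t x"
      "\<And>x. x \<in> {0, L} \<Longrightarrow> AE t in lebesgue_on {0..T}. \<forall>i. solves_along u r i t x"
    and out: "L2_on {0..T} (\<lambda>t. r t L $ 1)" "L2_on {0..T} (\<lambda>t. r t 0 $ 2)"
    using iffD1[OF dynamic_state_iff[OF sp] dyn] unfolding split_beta' by blast+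
  have strip: "ch.L2_strip T (\<lambda>p. r (fst p) (snd p) $ j)" for j
    unfolding ch.L2_strip_def
  proof
    show mj: "(\<lambda>p. r (fst p) (snd p) $ j) \<in> borel_measurable (lebesgue_on ({0..T} \<times> {0..L}))"
      by (rule measurable_compose[OF m borel_measurable_continuous_onI[OF continuous_on_component[OF continuous_on_id]]])
    show "integrable (lebesgue_on ({0..T} \<times> {0..L})) (\<lambda>p. (r (fst p) (snd p) $ j)\<^sup>2)"
    proof (rule Bochner_Integration.integrable_bound)
      show "integrable (lebesgue_on ({0..T} \<times> {0..L})) (\<lambda>p. (norm (r (fst p) (snd p)))\<^sup>2)"
        using state_strip(1)[OF dyn T stationary_zero] by simp
      show "AE p in lebesgue_on ({0..T} \<times> {0..L}). norm ((r (fst p) (snd p) $ j)\<^sup>2) \<le> norm ((norm (r (fst p) (snd p)))\<^sup>2)"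
      proof (intro AE_I2)
        fix p
        have "\<bar>r (fst p) (snd p) $ j\<bar>\<^sup>2 \<le> (norm (r (fst p) (snd p)))\<^sup>2"
          by (intro power_mono component_le_norm_cart) auto
        then show "norm ((r (fst p) (snd p) $ j)\<^sup>2) \<le> norm ((norm (r (fst p) (snd p)))\<^sup>2)" by simp
      qed
    qed (use mj in measurable)
  qed
  have "ch.L2_strip T (\<lambda>p. (\<eta> * M (snd p) $ i $ 1) * r (fst p) (snd p) $ 1 + (\<eta> * M (snd p) $ i $ 2) * r (fst p) (snd p) $ 2)"
    by (intro ch.L2_strip_add ch.L2_strip_mult[where w = "\<lambda>x. \<eta> * M x $ i $ _"] strip continuous_intros M_cont)
  also have "(\<lambda>p. (\<eta> * M (snd p) $ i $ 1) * r (fst p) (snd p) $ 1 + (\<eta> * M (snd p) $ i $ 2) * r (fst p) (snd p) $ 2)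
     = (\<lambda>p. \<eta> * (M (snd p) *v r (fst p) (snd p)) $ i)"
    by (simp add: matrix_vector_mult_def sum_2 algebra_simps)
  finally have g: "ch.L2_strip T (\<lambda>p. \<eta> * (M (snd p) *v r (fst p) (snd p)) $ i)" .
  have out': "L2_on {0..T} (\<lambda>t. r t (b' i) $ i)"
    using out exhaust_2[of i] by (auto simp: ends)
  have b'L: "b' i \<in> {0, L}" using exhaust_2[of i] by (auto simp: ends)
  show ?thesis
    unfolding ch.transported_def
  proof (intro conjI ballI)
    show "AE x in lebesgue_on {0..L}. solves_along u r i t x" if "t \<in> {0..T}" for t
      using car(1)[OF that] by eventually_elim blast
    show "AE t in lebesgue_on {0..T}. solves_along u r i t (b' i)"
      using car(2)[OF b'L] by eventually_elim blast
  qed (use strip[of i] g out' T L2_on_component[OF L2, of T] L2_on_component[OF u]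
        L2_on_continuous[OF continuous_on_const] in \<open>simp_all add: split_beta'\<close>)
qed

lemma difference_transported:
  assumes dyn: "dynamic_state L dp dm \<eta> M T u r" and T: "0 < T" and u: "L2_on {0..T} u"
    and sp: "\<And>x. x \<in> {0..L} \<Longrightarrow> dp x = d 1 x" "\<And>x. x \<in> {0..L} \<Longrightarrow> dm x = d 2 x"
    and R: "stationary R"
  shows "ch.transported i T (\<lambda>t x. (r t x - R x) $ i) (\<lambda>t x. \<eta> * (M x *v (r t x - R x)) $ i)
     (\<lambda>x. - R x $ i) (\<lambda>t. u t $ i - R (b i) $ i)"
  using ch.transported_diff[OF dynamic_transported[OF dyn T u sp] stationary_transported[OF R], of i]
  by (simp add: matrix_vector_mult_diff_distrib right_diff_distrib)

end

section \<open>Energy, duality and the cost functional\<close>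

text \<open>
  With \<open>X\<close> the squared distance of the control to the static control, the cost differs from \<open>T\<close> times the
  static optimal value by a constant, up to terms in \<open>X\<close>, and from below it grows with \<open>X\<close>.
\<close>

definition turnpike_bounds ::
  "real \<Rightarrow> real \<Rightarrow> real^2 \<Rightarrow> real^2 \<Rightarrow> (real \<Rightarrow> real^2) \<Rightarrow> real \<Rightarrow> real \<Rightarrow> (real \<Rightarrow> real^2) \<Rightarrow>
   (real \<Rightarrow> real \<Rightarrow> real^2) \<Rightarrow> bool" where
  "turnpike_bounds L lam Rb w R K T u r \<longleftrightarrow>
     (let X = LINT t|lebesgue_on {0..T}. (norm (u t - w))\<^sup>2 in
      T * J0 L lam Rb w R - K + lam / 2 * X \<le> J L lam Rb T u r \<and>
      J L lam Rb T u r \<le> T * J0 L lam Rb w R + K * (1 + X) \<and>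
      (LINT t|lebesgue_on {0..T}. LINT x|lebesgue_on {0..L}. (norm (r t x - R x))\<^sup>2) \<le> K * (1 + X))"

lemma J_expansion:
  fixes r :: "real \<Rightarrow> real \<Rightarrow> real^2"
  assumes T: "0 < T" and u: "L2_on {0..T} u" and u1: "\<And>t. t \<in> {0..T} \<Longrightarrow> u t $ 1 = w $ 1"
    and out: "L2_on {0..T} (\<lambda>t. r t L $ 1)" "L2_on {0..T} (\<lambda>t. r t 0 $ 2)"
  shows "J L lam Rb T u r = T * J0 L lam Rb w R
     + 2 * ((1 - lam) * (R L $ 1 - Rb $ 1) * (LINT t|lebesgue_on {0..T}. (r t L $ 1 - R L $ 1))
          + (1 - lam) * (R 0 $ 2 - Rb $ 2) * (LINT t|lebesgue_on {0..T}. (r t 0 $ 2 - R 0 $ 2))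
          + lam * w $ 2 * (LINT t|lebesgue_on {0..T}. (u t $ 2 - w $ 2)))
     + (1 - lam) * ((LINT t|lebesgue_on {0..T}. (r t L $ 1 - R L $ 1)\<^sup>2)
          + (LINT t|lebesgue_on {0..T}. (r t 0 $ 2 - R 0 $ 2)\<^sup>2))
     + lam * (LINT t|lebesgue_on {0..T}. (u t $ 2 - w $ 2)\<^sup>2)"
proof -
  define y1 where "y1 t = r t L $ 1 - R L $ 1" for t
  define y2 where "y2 t = r t 0 $ 2 - R 0 $ 2" for t
  define y3 where "y3 t = u t $ 2 - w $ 2" for t
  have L2: "L2_on {0..T} y1" "L2_on {0..T} y2" "L2_on {0..T} y3"
    unfolding y1_def[abs_def] y2_def[abs_def] y3_def[abs_def]
    by (intro L2_on_diff out L2_on_component[OF u] L2_on_continuous continuous_on_const)+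
  note i = L2_on_integrable[OF L2(1)] L2_on_integrable[OF L2(2)] L2_on_integrable[OF L2(3)]
  have ic: "integrable (lebesgue_on {0..T}) (\<lambda>_. c)" for c :: real
    by (rule continuous_imp_integrable_real) (rule continuous_on_const)
  have "J L lam Rb T u r = (LINT t|lebesgue_on {0..T}. J0 L lam Rb w R
     + 2 * ((1 - lam) * (R L $ 1 - Rb $ 1) * y1 t + (1 - lam) * (R 0 $ 2 - Rb $ 2) * y2 t + lam * w $ 2 * y3 t)
     + ((1 - lam) * ((y1 t)\<^sup>2 + (y2 t)\<^sup>2) + lam * (y3 t)\<^sup>2))"
    unfolding J_def
  proof (rule Bochner_Integration.integral_cong)
    fix t assume "t \<in> space (lebesgue_on {0..T})"
    then have "u t $ 1 = w $ 1" using u1 by simp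
    then show "(1 - lam) * (norm (vector [r t L $ 1 - Rb $ 1, r t 0 $ 2 - Rb $ 2] :: real^2))\<^sup>2 + lam * (norm (u t))\<^sup>2
      = J0 L lam Rb w R
     + 2 * ((1 - lam) * (R L $ 1 - Rb $ 1) * y1 t + (1 - lam) * (R 0 $ 2 - Rb $ 2) * y2 t + lam * w $ 2 * y3 t)
     + ((1 - lam) * ((y1 t)\<^sup>2 + (y2 t)\<^sup>2) + lam * (y3 t)\<^sup>2)"
      unfolding J0_def norm2_sq sum_2 by (simp add: y1_def y2_def y3_def power2_eq_square algebra_simps)
  qed simp
  also have "\<dots> = T * J0 L lam Rb w R
     + 2 * ((1 - lam) * (R L $ 1 - Rb $ 1) * (LINT t|lebesgue_on {0..T}. y1 t)
          + (1 - lam) * (R 0 $ 2 - Rb $ 2) * (LINT t|lebesgue_on {0..T}. y2 t)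
          + lam * w $ 2 * (LINT t|lebesgue_on {0..T}. y3 t))
     + ((1 - lam) * ((LINT t|lebesgue_on {0..T}. (y1 t)\<^sup>2) + (LINT t|lebesgue_on {0..T}. (y2 t)\<^sup>2))
     + lam * (LINT t|lebesgue_on {0..T}. (y3 t)\<^sup>2))"
    using i ic T by (simp add: measure_restrict_space)
  finally show ?thesis unfolding y1_def y2_def y3_def by simp
qed

context hyperbolic begin

definition adjoint_state :: "(real \<Rightarrow> real^2) \<Rightarrow> bool" where
  "adjoint_state Q \<longleftrightarrow> (\<forall>i. \<forall>x\<in>{0..L}. ((\<lambda>x. Q x $ i) has_real_derivative
     - (\<Sum>j\<in>UNIV. \<eta> * M x $ j $ i * Q x $ j / d j x)) (at x within {0..L}))"

text \<open>
  First order conditions of the static problem with the plus control fixed: the adjoint \<open>Q\<close> carries the gradient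
  of the outflow term as boundary data, and its remaining boundary value equals the gradient of the control cost.
\<close>

definition optimality_system ::
  "real \<Rightarrow> real^2 \<Rightarrow> real^2 \<Rightarrow> (real \<Rightarrow> real^2) \<Rightarrow> (real \<Rightarrow> real^2) \<Rightarrow> bool" where
  "optimality_system lam Rb w R Q \<longleftrightarrow> stationary R \<and> adjoint_state Q \<and>
     R 0 $ 1 = w $ 1 \<and> R L $ 2 = w $ 2 \<and>
     Q L $ 1 = (1 - lam) * (R L $ 1 - Rb $ 1) \<and> Q 0 $ 2 = - ((1 - lam) * (R 0 $ 2 - Rb $ 2)) \<and>
     Q L $ 2 = lam * w $ 2"

text \<open>
  The Lyapunov argument: the balance law with both factors equal to \<open>r - R\<close> and weights \<open>e\<close>, summed
  over the two components. The assumed inequality for the quadratic form bounds the right-hand side, so the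
  energy, the outflow traces and the dissipated energy are controlled by the initial state and the control.
\<close>

lemma energy_balance:
  assumes dyn: "dynamic_state L dp dm \<eta> M T u r" and T: "0 < T" and u: "L2_on {0..T} u"
    and sp: "\<And>x. x \<in> {0..L} \<Longrightarrow> dp x = d 1 x" "\<And>x. x \<in> {0..L} \<Longrightarrow> dm x = d 2 x"
    and R: "stationary R"
    and e: "\<And>i x. x \<in> {0..L} \<Longrightarrow> ((\<lambda>x. e i x * d i x) has_real_derivative e' i x) (at x within {0..L})"
    and e': "\<And>i. continuous_on {0..L} (e' i)"
    and dissip: "\<And>x v. x \<in> {0..L} \<Longrightarrow> (\<Sum>i\<in>UNIV. e' i x * (v $ i)\<^sup>2 + 2 * (\<eta> * (e i x * (v $ i * (M x *v v) $ i))))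
       \<le> - \<alpha> * (norm v)\<^sup>2"
  shows "(\<Sum>i\<in>UNIV. LINT x|lebesgue_on {0..L}. e i x * (r T x $ i - R x $ i)\<^sup>2)
     + (\<Sum>i\<in>UNIV. e i (b' i) * \<bar>d i (b' i)\<bar> * (LINT t|lebesgue_on {0..T}. (r t (b' i) $ i - R (b' i) $ i)\<^sup>2))
     + \<alpha> * (LINT p|lebesgue_on ({0..T} \<times> {0..L}). (norm (r (fst p) (snd p) - R (snd p)))\<^sup>2)
   \<le> (\<Sum>i\<in>UNIV. LINT x|lebesgue_on {0..L}. e i x * (R x $ i)\<^sup>2)
     + (\<Sum>i\<in>UNIV. e i (b i) * \<bar>d i (b i)\<bar> * (LINT t|lebesgue_on {0..T}. (u t $ i - R (b i) $ i)\<^sup>2))"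
proof -
  let ?S = "{0..T} \<times> {0..L}"
  define z where "z t x = r t x - R x" for t x
  define h where "h i = (\<lambda>(t, x). e' i x * (z t x $ i * z t x $ i)
     + e i x * (z t x $ i * (\<eta> * (M x *v z t x) $ i) + (\<eta> * (M x *v z t x) $ i) * z t x $ i))" for i
  note tr = difference_transported[OF dyn T u sp R, folded z_def]
  have bal: "integrable (lebesgue_on ?S) (h i)"
    "(LINT p|lebesgue_on ?S. h i p) = (LINT x|lebesgue_on {0..L}. e i x * (r T x $ i - R x $ i)\<^sup>2)
       - (LINT x|lebesgue_on {0..L}. e i x * (R x $ i)\<^sup>2)
       + e i (b' i) * \<bar>d i (b' i)\<bar> * (LINT t|lebesgue_on {0..T}. (r t (b' i) $ i - R (b' i) $ i)\<^sup>2)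
       - e i (b i) * \<bar>d i (b i)\<bar> * (LINT t|lebesgue_on {0..T}. (u t $ i - R (b i) $ i)\<^sup>2)" for i
    unfolding h_def
    using ch.weighted_balance_law[OF tr tr T orientation_sq abs_speed e e', of i]
    by (simp_all add: z_def power2_eq_square)
  have "(\<Sum>i\<in>UNIV. LINT p|lebesgue_on ?S. h i p) = (LINT p|lebesgue_on ?S. (\<Sum>i\<in>UNIV. h i p))"
    by (rule Bochner_Integration.integral_sum[symmetric]) (rule bal(1))
  also have "\<dots> \<le> (LINT p|lebesgue_on ?S. - \<alpha> * (norm (z (fst p) (snd p)))\<^sup>2)"
  proof (rule integral_mono)
    show "integrable (lebesgue_on ?S) (\<lambda>p. \<Sum>i\<in>UNIV. h i p)"
      by (intro Bochner_Integration.integrable_sum bal(1))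
    show "integrable (lebesgue_on ?S) (\<lambda>p. - \<alpha> * (norm (z (fst p) (snd p)))\<^sup>2)"
      using state_strip(1)[OF dyn T R] unfolding z_def by (intro integrable_mult_right)
    fix p assume "p \<in> space (lebesgue_on ?S)"
    then have p: "snd p \<in> {0..L}" by auto
    have "(\<Sum>i\<in>UNIV. h i p) = (\<Sum>i\<in>UNIV. e' i (snd p) * (z (fst p) (snd p) $ i)\<^sup>2
       + 2 * (\<eta> * (e i (snd p) * (z (fst p) (snd p) $ i * (M (snd p) *v z (fst p) (snd p)) $ i))))"
      by (simp add: h_def split_beta power2_eq_square algebra_simps)
    also have "\<dots> \<le> - \<alpha> * (norm (z (fst p) (snd p)))\<^sup>2" by (rule dissip[OF p])
    finally show "(\<Sum>i\<in>UNIV. h i p) \<le> - \<alpha> * (norm (z (fst p) (snd p)))\<^sup>2" .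
  qed
  also have "\<dots> = - \<alpha> * (LINT p|lebesgue_on ?S. (norm (z (fst p) (snd p)))\<^sup>2)"
    by (rule integral_mult_right_zero)
  finally have "(\<Sum>i\<in>UNIV. LINT p|lebesgue_on ?S. h i p) \<le> - \<alpha> * (LINT p|lebesgue_on ?S. (norm (z (fst p) (snd p)))\<^sup>2)" .
  then show ?thesis
    unfolding bal(2) by (simp add: sum.distrib sum_subtractf z_def)
qed

text \<open>
  Testing the equation for \<open>r - R\<close> with an adjoint state \<open>Q\<close> annihilates the integral over the strip: only the
  boundary terms and the values at the initial and final times remain.
\<close>

lemma adjoint_balance:
  assumes dyn: "dynamic_state L dp dm \<eta> M T u r" and T: "0 < T" and u: "L2_on {0..T} u"
    and sp: "\<And>x. x \<in> {0..L} \<Longrightarrow> dp x = d 1 x" "\<And>x. x \<in> {0..L} \<Longrightarrow> dm x = d 2 x"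
    and R: "stationary R"
    and Q: "adjoint_state Q"
  shows "(\<Sum>i\<in>UNIV. orientation i * (Q (b' i) $ i * (LINT t|lebesgue_on {0..T}. (r t (b' i) $ i - R (b' i) $ i))
        - Q (b i) $ i * (LINT t|lebesgue_on {0..T}. (u t $ i - R (b i) $ i))))
    = - (\<Sum>i\<in>UNIV. (LINT x|lebesgue_on {0..L}. Q x $ i / d i x * (r T x $ i - R x $ i))
         + (LINT x|lebesgue_on {0..L}. Q x $ i / d i x * R x $ i))"
proof -
  let ?S = "{0..T} \<times> {0..L}"
  note Qd = Q[unfolded adjoint_state_def, rule_format]
  define Q' where "Q' i x = - (\<Sum>j\<in>UNIV. \<eta> * M x $ j $ i * Q x $ j / d j x)" for i x
  have Q_cont: "continuous_on {0..L} (\<lambda>x. Q x $ i)" for i by (rule DERIV_continuous_on[OF Qd])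
  have Q'_cont: "continuous_on {0..L} (Q' i)" for i
    unfolding Q'_def[abs_def] by (intro continuous_intros M_cont Q_cont d_cont) (auto simp: ch.d_nz)
  have der: "((\<lambda>x. Q x $ i / d i x * d i x) has_real_derivative Q' i x) (at x within {0..L})" if "x \<in> {0..L}" for i x
    using Qd[OF that] ch.d_nz by (simp add: Q'_def)
  define z where "z t x = r t x - R x" for t x
  note tr = difference_transported[OF dyn T u sp R, folded z_def]
  have one: "ch.transported i T (\<lambda>_ _. 1) (\<lambda>_ _. 0) (\<lambda>_. 1) (\<lambda>_. 1)" for i
    by (rule ch.transported_stationary) (auto intro: continuous_on_const)
  have o: "Q x $ i / d i x * \<bar>d i x\<bar> = orientation i * Q x $ i" for i x
    using ch.d_nz[of i x] unfolding abs_speed by simp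
  define h where "h i = (\<lambda>(t, x). Q' i x * z t x $ i + Q x $ i / d i x * (\<eta> * (M x *v z t x) $ i))" for i
  have bal: "integrable (lebesgue_on ?S) (h i)"
    "(LINT p|lebesgue_on ?S. h i p) = (LINT x|lebesgue_on {0..L}. Q x $ i / d i x * (r T x $ i - R x $ i))
       + (LINT x|lebesgue_on {0..L}. Q x $ i / d i x * R x $ i)
       + orientation i * (Q (b' i) $ i * (LINT t|lebesgue_on {0..T}. (r t (b' i) $ i - R (b' i) $ i))
       - Q (b i) $ i * (LINT t|lebesgue_on {0..T}. (u t $ i - R (b i) $ i)))" for i
    unfolding h_def
    using ch.weighted_balance_law[OF tr one T orientation_sq abs_speed der Q'_cont, of i] unfolding o
    by (simp_all add: z_def right_diff_distrib)
  have "(\<Sum>i\<in>UNIV. LINT p|lebesgue_on ?S. h i p) = (LINT p|lebesgue_on ?S. (\<Sum>i\<in>UNIV. h i p))"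
    by (rule Bochner_Integration.integral_sum[symmetric]) (rule bal(1))
  also have "(\<lambda>p. \<Sum>i\<in>UNIV. h i p) = (\<lambda>p. 0)"
    by (auto simp: fun_eq_iff h_def Q'_def matrix_vector_mult_def sum_2 algebra_simps)
  finally have "(\<Sum>i\<in>UNIV. LINT p|lebesgue_on ?S. h i p) = 0" by simp
  then show ?thesis unfolding bal(2) by (simp add: sum.distrib)
qed

text \<open>
  By the optimality system and \<open>adjoint_balance\<close>, the linear term in the expansion of the cost equals
  pairings of the adjoint with the initial and final states. The pairing with the final state is estimated by
  \<open>\<epsilon>\<close> times the squared norm of that state, and by \<open>energy_balance\<close> that norm is at most a constant plus a
  multiple of \<open>X\<close>. For small \<open>\<epsilon>\<close> the result is absorbed by the control cost \<open>lam * X\<close>. All constants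
  are independent of the horizon.
\<close>

lemma turnpike_estimates:
  assumes sp: "\<And>x. x \<in> {0..L} \<Longrightarrow> dp x = d 1 x" "\<And>x. x \<in> {0..L} \<Longrightarrow> dm x = d 2 x"
    and os: "optimality_system lam Rb w R Q"
    and e: "\<And>i x. x \<in> {0..L} \<Longrightarrow> ((\<lambda>x. e i x * d i x) has_real_derivative e' i x) (at x within {0..L})"
    and e': "\<And>i. continuous_on {0..L} (e' i)"
    and e0: "0 < e0" "\<And>i x. x \<in> {0..L} \<Longrightarrow> e0 \<le> e i x"
    and dissip: "\<And>x v. x \<in> {0..L} \<Longrightarrow> (\<Sum>i\<in>UNIV. e' i x * (v $ i)\<^sup>2 + 2 * (\<eta> * (e i x * (v $ i * (M x *v v) $ i))))
       \<le> - \<alpha> * (norm v)\<^sup>2"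
    and \<alpha>: "0 < \<alpha>" and lam: "0 < lam" "lam < 1"
  obtains K where "0 < K"
    "\<And>T u r. 0 < T \<Longrightarrow> L2_on {0..T} u \<Longrightarrow> (\<And>t. t \<in> {0..T} \<Longrightarrow> u t $ 1 = w $ 1) \<Longrightarrow>
      dynamic_state L dp dm \<eta> M T u r \<Longrightarrow>
      turnpike_bounds L lam Rb w R K T u r"
proof -
  have R: "stationary R" and Q: "adjoint_state Q" and w: "R 0 $ 1 = w $ 1" "R L $ 2 = w $ 2"
    and opt: "Q L $ 1 = (1 - lam) * (R L $ 1 - Rb $ 1)" "Q 0 $ 2 = - ((1 - lam) * (R 0 $ 2 - Rb $ 2))"
      "Q L $ 2 = lam * w $ 2"
    using os by (auto simp: optimality_system_def)
  define \<phi> where "\<phi> i x = Q x $ i / d i x" for i x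
  have Q_cont: "continuous_on {0..L} (\<lambda>x. Q x $ i)" for i by (rule DERIV_continuous_on[OF Q[unfolded adjoint_state_def, rule_format]])
  have \<phi>_cont: "continuous_on {0..L} (\<phi> i)" for i
    unfolding \<phi>_def[abs_def] by (intro continuous_intros Q_cont d_cont) (auto simp: ch.d_nz)
  have e_cont: "continuous_on {0..L} (e i)" for i
  proof -
    have "continuous_on {0..L} (\<lambda>x. e i x * d i x / d i x)"
      by (intro continuous_intros d_cont DERIV_continuous_on[OF e]) (auto simp: ch.d_nz)
    then show ?thesis by (simp add: ch.d_nz)
  qed
  define m where "m = min (e 1 (b' 1) * \<bar>d 1 (b' 1)\<bar>) (e 2 (b' 2) * \<bar>d 2 (b' 2)\<bar>)"
  have e_pos: "0 < e i x" if "x \<in> {0..L}" for i x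
    using less_le_trans[OF e0(1) e0(2)[OF that]] .
  have "0 < e i (b' i) * \<bar>d i (b' i)\<bar>" for i
    using e_pos[OF b_in(2)] ch.d_nz[of i "b' i"] by (intro mult_pos_pos) auto
  then have m1: "0 < m" unfolding m_def by simp
  have m2: "m \<le> e i (b' i) * \<bar>d i (b' i)\<bar>" for i
    using exhaust_2[of i] unfolding m_def by auto
  note m = m1 m2
  define \<beta> where "\<beta> = e 2 L * \<bar>d 2 L\<bar>"
  have \<beta>: "0 \<le> \<beta>" using e_pos[of L 2] L_pos by (auto simp: \<beta>_def)
  define C0 where "C0 = (\<Sum>i\<in>UNIV. LINT x|lebesgue_on {0..L}. e i x * (R x $ i)\<^sup>2)"
  have C0: "0 \<le> C0" unfolding C0_def
    by (intro sum_nonneg integral_nonneg_AE AE_I2) (auto intro!: mult_nonneg_nonneg less_imp_le[OF e_pos])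
  \<comment> \<open>Small enough for twice the pairing with the final state to cost at most lam / 2 * X.\<close>
  define \<epsilon> where "\<epsilon> = lam * e0 / (4 * (\<beta> + 1))"
  have \<epsilon>: "0 < \<epsilon>" using lam e0 \<beta> by (auto simp: \<epsilon>_def)
  define P where "P = (\<Sum>i\<in>UNIV. LINT x|lebesgue_on {0..L}. (\<phi> i x)\<^sup>2)"
  have P: "0 \<le> P" unfolding P_def by (intro sum_nonneg integral_nonneg_AE AE_I2) auto
  define C\<phi> where "C\<phi> = \<bar>\<Sum>i\<in>UNIV. LINT x|lebesgue_on {0..L}. \<phi> i x * R x $ i\<bar>"
  define C1 where "C1 = 2 * \<epsilon> * C0 / e0 + P / (2 * \<epsilon>) + 2 * C\<phi>"
  have C1: "0 \<le> C1" using \<epsilon> C0 e0(1) P by (auto simp: C1_def C\<phi>_def intro!: add_nonneg_nonneg)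
  define K where "K = 3 + C1 + (C0 + \<beta>) / m + (C0 + \<beta>) / \<alpha>"
  have K: "0 < K" using C1 C0 \<beta> m(1) \<alpha> by (auto simp: K_def intro!: add_pos_nonneg)
  show ?thesis
  proof (rule that[OF K])
    fix T u r assume T: "0 < T" and u: "L2_on {0..T} u" and u1: "\<And>t. t \<in> {0..T} \<Longrightarrow> u t $ 1 = w $ 1"
      and dyn: "dynamic_state L dp dm \<eta> M T u r"
    define X where "X = (LINT t|lebesgue_on {0..T}. (u t $ 2 - w $ 2)\<^sup>2)"
    have X_eq: "(LINT t|lebesgue_on {0..T}. (norm (u t - w))\<^sup>2) = X"
      unfolding X_def by (rule Bochner_Integration.integral_cong) (auto simp: norm2_sq sum_2 u1)
    have X: "0 \<le> X" unfolding X_def by (intro integral_nonneg_AE AE_I2) auto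
    have L2T: "L2_on {0..L} (r T)" and out: "L2_on {0..T} (\<lambda>t. r t L $ 1)" "L2_on {0..T} (\<lambda>t. r t 0 $ 2)"
      using dyn T unfolding dynamic_state_def by auto
    have L2z: "L2_on {0..L} (\<lambda>x. r T x $ i - R x $ i)" for i
      by (intro L2_on_diff L2_on_component[OF L2T] L2_on_continuous stationary_cont R)
    define V where "V = (\<Sum>i\<in>UNIV. LINT x|lebesgue_on {0..L}. (r T x $ i - R x $ i)\<^sup>2)"
    define Y where "Y = (\<Sum>i\<in>UNIV. LINT t|lebesgue_on {0..T}. (r t (b' i) $ i - R (b' i) $ i)\<^sup>2)"
    define S where "S = (LINT p|lebesgue_on ({0..T} \<times> {0..L}). (norm (r (fst p) (snd p) - R (snd p)))\<^sup>2)"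
    have V: "0 \<le> V" and Y: "0 \<le> Y" and S: "0 \<le> S"
      unfolding V_def Y_def S_def by (intro sum_nonneg integral_nonneg_AE AE_I2; simp)+
    have 1: "e0 * V \<le> (\<Sum>i\<in>UNIV. LINT x|lebesgue_on {0..L}. e i x * (r T x $ i - R x $ i)\<^sup>2)"
      unfolding V_def sum_distrib_left
    proof (rule sum_mono)
      fix i :: 2
      have "e0 * (LINT x|lebesgue_on {0..L}. (r T x $ i - R x $ i)\<^sup>2) = (LINT x|lebesgue_on {0..L}. e0 * (r T x $ i - R x $ i)\<^sup>2)"
        by simp
      also have "\<dots> \<le> (LINT x|lebesgue_on {0..L}. e i x * (r T x $ i - R x $ i)\<^sup>2)"
        by (rule integral_mono)
           (use L2_on_integrable(2)[OF L2z] L2_on_mult(2)[OF L2z e_cont] e0 in \<open>auto intro!: mult_right_mono\<close>)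
      finally show "e0 * (LINT x|lebesgue_on {0..L}. (r T x $ i - R x $ i)\<^sup>2)
         \<le> (LINT x|lebesgue_on {0..L}. e i x * (r T x $ i - R x $ i)\<^sup>2)" .
    qed
    have 2: "m * Y \<le> (\<Sum>i\<in>UNIV. e i (b' i) * \<bar>d i (b' i)\<bar> * (LINT t|lebesgue_on {0..T}. (r t (b' i) $ i - R (b' i) $ i)\<^sup>2))"
      unfolding Y_def sum_distrib_left
      by (intro sum_mono mult_right_mono m integral_nonneg_AE AE_I2) simp
    have "(LINT t|lebesgue_on {0..T}. (u t $ 1 - R 0 $ 1)\<^sup>2) = (LINT t|lebesgue_on {0..T}. 0)"
      by (rule Bochner_Integration.integral_cong) (auto simp: u1 w)
    then have 3: "(\<Sum>i\<in>UNIV. e i (b i) * \<bar>d i (b i)\<bar> * (LINT t|lebesgue_on {0..T}. (u t $ i - R (b i) $ i)\<^sup>2)) = \<beta> * X"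
      by (simp add: sum_2 ends w \<beta>_def X_def)
    \<comment> \<open>Only the minus control differs from its static value, so the inflow term is a multiple of X.\<close>
    have en: "e0 * V + m * Y + \<alpha> * S \<le> C0 + \<beta> * X"
      using energy_balance[OF dyn T u sp R e e' dissip] 1 2 unfolding 3 C0_def S_def by linarith
    have pos: "0 \<le> e0 * V" "0 \<le> m * Y" "0 \<le> \<alpha> * S" using e0(1) V m(1) Y \<alpha> S by auto
    have Vb: "V \<le> (C0 + \<beta> * X) / e0" and Yb: "Y \<le> (C0 + \<beta> * X) / m" and Sb: "S \<le> (C0 + \<beta> * X) / \<alpha>"
      using en pos e0(1) m(1) \<alpha> by (auto simp: pos_le_divide_eq mult.commute)
    define \<Lambda> where "\<Lambda> = (1 - lam) * (R L $ 1 - Rb $ 1) * (LINT t|lebesgue_on {0..T}. (r t L $ 1 - R L $ 1))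
          + (1 - lam) * (R 0 $ 2 - Rb $ 2) * (LINT t|lebesgue_on {0..T}. (r t 0 $ 2 - R 0 $ 2))
          + lam * w $ 2 * (LINT t|lebesgue_on {0..T}. (u t $ 2 - w $ 2))"
    have "(LINT t|lebesgue_on {0..T}. (u t $ 1 - R 0 $ 1)) = (LINT t|lebesgue_on {0..T}. 0)"
      by (rule Bochner_Integration.integral_cong) (auto simp: u1 w)
    then have "\<Lambda> = - (\<Sum>i\<in>UNIV. (LINT x|lebesgue_on {0..L}. \<phi> i x * (r T x $ i - R x $ i))
         + (LINT x|lebesgue_on {0..L}. \<phi> i x * R x $ i))"
      using adjoint_balance[OF dyn T u sp R Q]
      unfolding \<phi>_def \<Lambda>_def by (simp add: sum_2 ends w opt orientation_def algebra_simps)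
    then have "\<bar>\<Lambda>\<bar> \<le> \<bar>\<Sum>i\<in>UNIV. LINT x|lebesgue_on {0..L}. \<phi> i x * (r T x $ i - R x $ i)\<bar> + C\<phi>"
      unfolding C\<phi>_def sum.distrib by linarith
    also have "\<bar>\<Sum>i\<in>UNIV. LINT x|lebesgue_on {0..L}. \<phi> i x * (r T x $ i - R x $ i)\<bar>
       \<le> (\<Sum>i\<in>UNIV. LINT x|lebesgue_on {0..L}. \<epsilon> * (r T x $ i - R x $ i)\<^sup>2 + (\<phi> i x)\<^sup>2 / (4 * \<epsilon>))"
    proof (rule order_trans[OF sum_abs sum_mono])
      fix i :: 2
      have young: "\<bar>y * z\<bar> \<le> \<epsilon> * z\<^sup>2 + y\<^sup>2 / (4 * \<epsilon>)" for y z :: real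
      proof -
        have "0 \<le> (2 * \<epsilon> * \<bar>z\<bar> - \<bar>y\<bar>)\<^sup>2 / (4 * \<epsilon>)" using \<epsilon> by simp
        also have "\<dots> = \<epsilon> * z\<^sup>2 + y\<^sup>2 / (4 * \<epsilon>) - \<bar>y\<bar> * \<bar>z\<bar>"
          using \<epsilon> by (simp add: power2_diff power_mult_distrib field_simps power2_eq_square)
        finally show ?thesis by (simp add: abs_mult)
      qed
      show "\<bar>LINT x|lebesgue_on {0..L}. \<phi> i x * (r T x $ i - R x $ i)\<bar>
        \<le> (LINT x|lebesgue_on {0..L}. \<epsilon> * (r T x $ i - R x $ i)\<^sup>2 + (\<phi> i x)\<^sup>2 / (4 * \<epsilon>))"
        unfolding real_norm_def[symmetric]
        by (rule Bochner_Integration.integral_norm_bound_integral)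
           (use L2_on_mult(1)[OF L2z \<phi>_cont] L2_on_integrable(2)[OF L2z] L2_on_integrable(2)[OF L2_on_continuous[OF \<phi>_cont]] young
            in auto)
    qed
    also have "\<dots> = \<epsilon> * V + P / (4 * \<epsilon>)"
      using L2_on_integrable(2)[OF L2z] L2_on_integrable(2)[OF L2_on_continuous[OF \<phi>_cont]]
      by (simp add: V_def P_def sum.distrib sum_distrib_left sum_divide_distrib)
    finally have \<Lambda>: "\<bar>\<Lambda>\<bar> \<le> \<epsilon> * V + P / (4 * \<epsilon>) + C\<phi>" by simp
    have "2 * (\<epsilon> * V) \<le> 2 * (\<epsilon> * ((C0 + \<beta> * X) / e0))" 
      by (intro mult_left_mono Vb) (use \<epsilon> in auto)
    also have "\<dots> = 2 * \<epsilon> * C0 / e0 + lam / 2 * (\<beta> / (\<beta> + 1)) * X"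
    proof -
      have "\<epsilon> / e0 = lam / (4 * (\<beta> + 1))" using e0(1) by (simp add: \<epsilon>_def)
      moreover have "2 * (\<epsilon> * ((C0 + \<beta> * X) / e0)) = 2 * \<epsilon> * C0 / e0 + 2 * (\<epsilon> / e0) * (\<beta> * X)"
        by (simp add: add_divide_distrib distrib_left)
      moreover have "2 * (lam / (4 * c)) * (\<beta> * X) = lam / 2 * (\<beta> / c) * X" for c :: real by simp
      ultimately show ?thesis by presburger
    qed
    also have "\<dots> \<le> 2 * \<epsilon> * C0 / e0 + lam / 2 * 1 * X"
      using X lam \<beta> by (intro add_left_mono mult_right_mono mult_left_mono) auto
    finally have \<Lambda>2: "2 * \<bar>\<Lambda>\<bar> \<le> C1 + lam / 2 * X" using \<Lambda> unfolding C1_def by (simp add: field_simps)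
    have Y_sum: "Y = (LINT t|lebesgue_on {0..T}. (r t L $ 1 - R L $ 1)\<^sup>2) + (LINT t|lebesgue_on {0..T}. (r t 0 $ 2 - R 0 $ 2)\<^sup>2)"
      by (simp add: Y_def sum_2 ends)
    have Jeq: "J L lam Rb T u r = T * J0 L lam Rb w R + 2 * \<Lambda> + (1 - lam) * Y + lam * X"
      using J_expansion[OF T u u1 out, where R = R and lam = lam and Rb = Rb] unfolding \<Lambda>_def Y_sum X_def by simp
    have Ylam: "0 \<le> (1 - lam) * Y" "(1 - lam) * Y \<le> Y" "lam * X \<le> X"
      using Y X lam by (auto simp: mult_left_le_one_le)
    have lin: "(C0 + \<beta> * X) / c \<le> (C0 + \<beta>) / c * (1 + X)" if "0 < c" for c
    proof -
      have "C0 + \<beta> * X \<le> (C0 + \<beta>) * (1 + X)"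
        using C0 \<beta> X mult_nonneg_nonneg[OF C0 X] by (simp add: algebra_simps)
      then show ?thesis using that by (simp add: divide_right_mono times_divide_eq_left)
    qed
    have q: "0 \<le> (C0 + \<beta>) / m" "0 \<le> (C0 + \<beta>) / \<alpha>" using C0 \<beta> m(1) \<alpha> by auto
    have KX: "K * (1 + X) = 3 + C1 + 3 * X + C1 * X + (C0 + \<beta>) / m * (1 + X) + (C0 + \<beta>) / \<alpha> * (1 + X)"
      unfolding K_def by (simp add: algebra_simps)
    have nn: "0 \<le> C1 * X" "0 \<le> (C0 + \<beta>) / m * (1 + X)" "0 \<le> (C0 + \<beta>) / \<alpha> * (1 + X)" "lam / 2 * X \<le> X"
      using mult_nonneg_nonneg[OF C1 X] mult_nonneg_nonneg[OF q(1), of "1 + X"] mult_nonneg_nonneg[OF q(2), of "1 + X"]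
        mult_left_le_one_le[OF X, of "lam / 2"] X lam by simp_all
    have "T * J0 L lam Rb w R - K + lam / 2 * X \<le> J L lam Rb T u r"
    proof -
      have "C1 \<le> K" using q unfolding K_def by linarith
      then show ?thesis using \<Lambda>2 Ylam(1) unfolding Jeq by linarith
    qed
    moreover have "J L lam Rb T u r \<le> T * J0 L lam Rb w R + K * (1 + X)"
      using \<Lambda>2 Ylam Yb lin[OF m(1)] nn X unfolding Jeq KX by linarith
    moreover have "S \<le> K * (1 + X)"
      using Sb lin[OF \<alpha>] nn C1 X unfolding KX by linarith
    ultimately show "turnpike_bounds L lam Rb w R K T u r"
      unfolding turnpike_bounds_def Let_def X_eq S_def state_strip(2)[OF dyn T R] by blast
  qed
qed

end

section \<open>The static problem\<close>

context hyperbolic begin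

lemma at_interior: "x \<in> {0<..<L} \<Longrightarrow> at x within {0..L} = at x"
  by (rule at_within_interior) simp

text \<open>
  The pairing of an adjoint state with a solution of the static equation is constant in \<open>x\<close>. Only interior
  derivatives of the solution enter, so that arbitrary competitors of the static problem are covered.
\<close>

lemma adjoint_pairing:
  assumes Q: "adjoint_state Q" and S: "\<And>i. continuous_on {0..L} (\<lambda>x. S x $ i)"
    "\<And>i x. x \<in> {0<..<L} \<Longrightarrow> ((\<lambda>x. S x $ i) has_real_derivative \<eta> * (M x *v S x) $ i / d i x) (at x)"
  shows "Q L $ 1 * S L $ 1 + Q L $ 2 * S L $ 2 = Q 0 $ 1 * S 0 $ 1 + Q 0 $ 2 * S 0 $ 2"
proof -
  have Qd: "((\<lambda>x. Q x $ i) has_real_derivative - (\<Sum>j\<in>UNIV. \<eta> * M x $ j $ i * Q x $ j / d j x)) (at x within {0..L})"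
    if "x \<in> {0..L}" for i x using Q that by (simp add: adjoint_state_def)
  define g where "g x = (\<Sum>i\<in>UNIV. Q x $ i * S x $ i)" for x
  have "g L = g 0"
  proof (rule DERIV_isconst_end[OF L_pos])
    show "continuous_on {0..L} g"
      unfolding g_def[abs_def] by (intro continuous_intros S(1) DERIV_continuous_on[OF Qd])
    fix x assume "0 < x" "x < L"
    then have x: "x \<in> {0<..<L}" by simp
    note Qx = Qd[of x, unfolded at_interior[OF x]]
    have "(g has_real_derivative (\<Sum>i\<in>UNIV. - (\<Sum>j\<in>UNIV. \<eta> * M x $ j $ i * Q x $ j / d j x) * S x $ i
        + \<eta> * (M x *v S x) $ i / d i x * Q x $ i)) (at x)"
      unfolding g_def[abs_def] using x by (intro DERIV_sum DERIV_mult Qx S(2)) auto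
    also have "(\<Sum>i\<in>UNIV. - (\<Sum>j\<in>UNIV. \<eta> * M x $ j $ i * Q x $ j / d j x) * S x $ i
        + \<eta> * (M x *v S x) $ i / d i x * Q x $ i) = 0"
      by (simp add: sum_2 matrix_vector_mult_def algebra_simps add_divide_distrib)
    finally show "(g has_real_derivative 0) (at x)" .
  qed
  then show ?thesis by (simp add: g_def sum_2)
qed

lemma stationary_interior:
  assumes "stationary S" "x \<in> {0<..<L}"
  shows "((\<lambda>x. S x $ i) has_real_derivative \<eta> * (M x *v S x) $ i / d i x) (at x)"
proof -
  have "x \<in> {0..L}" using assms(2) by simp
  then have "((\<lambda>x. S x $ i) has_real_derivative \<eta> * (M x *v S x) $ i / d i x) (at x within {0..L})"
    using assms(1) unfolding stationary_def by blast
  then show ?thesis unfolding at_interior[OF assms(2)] .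
qed

lemma stationary_pairing:
  assumes "adjoint_state Q" "stationary S"
  shows "Q L $ 1 * S L $ 1 + Q L $ 2 * S L $ 2 = Q 0 $ 1 * S 0 $ 1 + Q 0 $ 2 * S 0 $ 2"
  by (rule adjoint_pairing[OF assms(1) stationary_cont(1)[OF assms(2)] stationary_interior[OF assms(2)]])

lemma component_derivative:
  assumes "(Y has_vector_derivative V) F"
  shows "((\<lambda>x. Y x $ i) has_real_derivative V $ i) F"
  using bounded_linear.has_vector_derivative[OF bounded_linear_vec_nth assms]
  by (simp add: has_real_derivative_iff_has_vector_derivative)

lemma ex_stationary: "\<exists>Y. stationary Y \<and> Y 0 = y0"
proof -
  define A :: "real \<Rightarrow> real^2^2" where "A x = (\<chi> i j. \<eta> * M x $ i $ j / d i x)" for x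
  have "continuous_on {0..L} A"
    unfolding A_def[abs_def] by (intro continuous_on_vec_lambda continuous_intros M_cont d_cont) (simp add: ch.d_nz)
  then obtain Y where Y: "Y 0 = y0" "\<And>x. x \<in> {0..L} \<Longrightarrow> (Y has_vector_derivative A x *v Y x) (at x within {0..L})"
    using linear_ode_solution[OF _ L_pos] by blast
  have "(A x *v y) $ i = \<eta> * (M x *v y) $ i / d i x" for x y i
    by (simp add: A_def matrix_vector_mult_def sum_2 algebra_simps add_divide_distrib)
  then have "stationary Y"
    using component_derivative[OF Y(2)] unfolding stationary_def by simp
  with Y(1) show ?thesis by blast
qed

lemma ex_adjoint_state: "\<exists>Y. adjoint_state Y \<and> Y 0 = y0"
proof -
  define A :: "real \<Rightarrow> real^2^2" where "A x = (\<chi> i j. - (\<eta> * M x $ j $ i / d j x))" for x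
  have "continuous_on {0..L} A"
    unfolding A_def[abs_def] by (intro continuous_on_vec_lambda continuous_intros M_cont d_cont) (simp add: ch.d_nz)
  then obtain Y where Y: "Y 0 = y0" "\<And>x. x \<in> {0..L} \<Longrightarrow> (Y has_vector_derivative A x *v Y x) (at x within {0..L})"
    using linear_ode_solution[OF _ L_pos] by blast
  have "(A x *v y) $ i = - (\<Sum>j\<in>UNIV. \<eta> * M x $ j $ i * y $ j / d j x)" for x y i
    by (simp add: A_def matrix_vector_mult_def sum_2)
  then have "adjoint_state Y"
    using component_derivative[OF Y(2)] unfolding adjoint_state_def by simp
  with Y(1) show ?thesis by blast
qed

lemma stationary_combination:
  assumes "stationary Y" "stationary Z"
  shows "stationary (\<lambda>x. p *\<^sub>R Y x + q *\<^sub>R Z x)"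
  unfolding stationary_def
proof (intro allI ballI)
  fix i x assume x: "x \<in> {0..L}"
  have "((\<lambda>x. p * Y x $ i + q * Z x $ i) has_real_derivative
      p * (\<eta> * (M x *v Y x) $ i / d i x) + q * (\<eta> * (M x *v Z x) $ i / d i x)) (at x within {0..L})"
    using assms x unfolding stationary_def by (intro DERIV_add DERIV_cmult) auto
  then show "((\<lambda>x. (p *\<^sub>R Y x + q *\<^sub>R Z x) $ i) has_real_derivative
      \<eta> * (M x *v (p *\<^sub>R Y x + q *\<^sub>R Z x)) $ i / d i x) (at x within {0..L})"
    by (simp add: matrix_vector_mult_def sum_2 algebra_simps add_divide_distrib)
qed

lemma adjoint_combination:
  assumes "adjoint_state Y" "adjoint_state Z"
  shows "adjoint_state (\<lambda>x. p *\<^sub>R Y x + q *\<^sub>R Z x)"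
  unfolding adjoint_state_def
proof (intro allI ballI)
  fix i x assume x: "x \<in> {0..L}"
  have "((\<lambda>x. p * Y x $ i + q * Z x $ i) has_real_derivative
      p * - (\<Sum>j\<in>UNIV. \<eta> * M x $ j $ i * Y x $ j / d j x) + q * - (\<Sum>j\<in>UNIV. \<eta> * M x $ j $ i * Z x $ j / d j x)) (at x within {0..L})"
    using assms x unfolding adjoint_state_def by (intro DERIV_add DERIV_cmult) auto
  then show "((\<lambda>x. (p *\<^sub>R Y x + q *\<^sub>R Z x) $ i) has_real_derivative
      - (\<Sum>j\<in>UNIV. \<eta> * M x $ j $ i * (p *\<^sub>R Y x + q *\<^sub>R Z x) $ j / d j x)) (at x within {0..L})"
    by (simp add: sum_2 algebra_simps add_divide_distrib)
qed

text \<open>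
  The static system is a two-point boundary value problem, so solvability is uniqueness in disguise. The
  Lyapunov function \<open>\<Sum>i. e i * d i * (Y i)\<^sup>2\<close> decreases in \<open>x\<close>, while homogeneous boundary values would force it
  to increase from a negative to a nonnegative value; the adjoint problem inherits unique solvability by
  duality. For fixed plus control \<open>c\<close> the static states form an affine line, on which the strictly convex cost
  has a stationary point.
\<close>

lemma ex_optimal_static:
  fixes Rb :: "real^2"
  assumes e: "\<And>i x. x \<in> {0..L} \<Longrightarrow> ((\<lambda>x. e i x * d i x) has_real_derivative e' i x) (at x within {0..L})"
    and e_pos: "\<And>i x. x \<in> {0..L} \<Longrightarrow> 0 < e i x"
    and dissip: "\<And>x v. x \<in> {0..L} \<Longrightarrow> (\<Sum>i\<in>UNIV. e' i x * (v $ i)\<^sup>2 + 2 * (\<eta> * (e i x * (v $ i * (M x *v v) $ i))))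
       \<le> - \<alpha> * (norm v)\<^sup>2"
    and \<alpha>: "0 < \<alpha>" and lam: "0 < lam" "lam < 1"
  obtains R Q and w :: "real^2" where "optimality_system lam Rb w R Q" "w $ 1 = c"
proof -
  obtain Y1 where Y1: "stationary Y1" "Y1 0 = axis 1 1" using ex_stationary by blast
  obtain Y2 where Y2: "stationary Y2" "Y2 0 = axis 2 1" using ex_stationary by blast
  obtain Q1 where Q1: "adjoint_state Q1" "Q1 0 = axis 1 1" using ex_adjoint_state by blast
  obtain Q2 where Q2: "adjoint_state Q2" "Q2 0 = axis 2 1" using ex_adjoint_state by blast
  have ax: "axis 1 1 $ (1::2) = (1::real)" "axis 1 1 $ (2::2) = (0::real)"
    "axis 2 1 $ (1::2) = (0::real)" "axis 2 1 $ (2::2) = (1::real)" by (simp_all add: axis_def)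
  \<comment> \<open>Otherwise Y2 would have homogeneous boundary values at both inflow ends.\<close>
  have Y2_ne: "Y2 L $ 2 \<noteq> 0"
  proof
    assume z: "Y2 L $ 2 = 0"
    define g where "g x = (\<Sum>i\<in>UNIV. e i x * d i x * (Y2 x $ i)\<^sup>2)" for x
    have Yd: "((\<lambda>x. Y2 x $ i) has_real_derivative \<eta> * (M x *v Y2 x) $ i / d i x) (at x within {0..L})"
      if "x \<in> {0..L}" for i x using Y2(1) that by (simp add: stationary_def)
    have "g L \<le> g 0"
    proof (rule DERIV_nonpos_imp_decreasing_open[OF less_imp_le[OF L_pos]])
      show "continuous_on {0..L} g" unfolding g_def[abs_def]
        by (intro continuous_on_sum continuous_on_mult[OF DERIV_continuous_on[OF e]] continuous_on_power stationary_cont Y2)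
      fix x assume "0 < x" "x < L"
      then have x: "x \<in> {0<..<L}" "x \<in> {0..L}" by auto
      have "(g has_real_derivative (\<Sum>i\<in>UNIV. e' i x * (Y2 x $ i)\<^sup>2
          + (2 * Y2 x $ i * (\<eta> * (M x *v Y2 x) $ i / d i x)) * (e i x * d i x))) (at x)"
        unfolding g_def[abs_def]
      proof (intro DERIV_sum DERIV_mult)
        show "((\<lambda>x. e i x * d i x) has_real_derivative e' i x) (at x)" for i
          using e[OF x(2)] unfolding at_interior[OF x(1)] .
        show "((\<lambda>x. (Y2 x $ i)\<^sup>2) has_real_derivative 2 * Y2 x $ i * (\<eta> * (M x *v Y2 x) $ i / d i x)) (at x)" for i
          using DERIV_power[OF Yd[OF x(2), unfolded at_interior[OF x(1)], of i], of 2] by (simp add: mult.commute mult.left_commute)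
      qed
      moreover have "(\<Sum>i\<in>UNIV. e' i x * (Y2 x $ i)\<^sup>2
          + (2 * Y2 x $ i * (\<eta> * (M x *v Y2 x) $ i / d i x)) * (e i x * d i x))
        = (\<Sum>i\<in>UNIV. e' i x * (Y2 x $ i)\<^sup>2 + 2 * (\<eta> * (e i x * (Y2 x $ i * (M x *v Y2 x) $ i))))"
        by (rule sum.cong) (use ch.d_nz in auto)
      moreover have "- \<alpha> * (norm (Y2 x))\<^sup>2 \<le> 0" using \<alpha> by simp
      ultimately show "\<exists>y. (g has_real_derivative y) (at x) \<and> y \<le> 0"
        using dissip[OF x(2), of "Y2 x"] by (intro exI conjI) (assumption, linarith)
    qed
    moreover have "g 0 < 0"
      using e_pos[of 0 2] speed_neg[of 0] L_pos by (simp add: g_def sum_2 Y2 ax mult_pos_neg)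
    moreover have "0 \<le> g L"
      using e_pos[of L 1] speed_pos[of L] L_pos by (simp add: g_def sum_2 z)
    ultimately show False by simp
  qed
  \<comment> \<open>Otherwise the pairing with Y2 gives Q1 L = 0, contradicting the pairing with Y1.\<close>
  have Q1_ne: "Q1 L $ 1 \<noteq> 0"
  proof
    assume z: "Q1 L $ 1 = 0"
    have "Q1 L $ 2 = 0"
      using stationary_pairing[OF Q1(1) Y2(1)] z Y2_ne by (simp add: Q1 Y2 ax)
    then show False
      using stationary_pairing[OF Q1(1) Y1(1)] z by (simp add: Q1 Y1 ax)
  qed
  \<comment> \<open>S is the response to a unit minus control, N the response to the plus control c alone.\<close>
  define S where "S x = (1 / Y2 L $ 2) *\<^sub>R Y2 x + 0 *\<^sub>R Y1 x" for x
  have S: "stationary S" "S 0 $ 1 = 0" "S L $ 2 = 1"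
    unfolding S_def[abs_def] using Y2_ne stationary_combination[OF Y2(1) Y1(1), of "1 / Y2 L $ 2" 0]
    by (simp_all add: Y2 ax)
  define N where "N x = c *\<^sub>R Y1 x + (- c * Y1 L $ 2 / Y2 L $ 2) *\<^sub>R Y2 x" for x
  have N: "stationary N" "N 0 $ 1 = c" "N L $ 2 = 0"
    unfolding N_def[abs_def] using Y2_ne
      stationary_combination[OF Y1(1) Y2(1), of c "- c * Y1 L $ 2 / Y2 L $ 2"] by (simp_all add: Y1 Y2 ax)
  define a where "a = (1 - lam) * ((S L $ 1)\<^sup>2 + (S 0 $ 2)\<^sup>2) + lam"
  have a: "0 < a" unfolding a_def using lam by (intro add_nonneg_pos mult_nonneg_nonneg) auto
  \<comment> \<open>The minimizer of the quadratic cost of N + y S.\<close>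
  define y where "y = - ((1 - lam) * ((N L $ 1 - Rb $ 1) * S L $ 1 + (N 0 $ 2 - Rb $ 2) * S 0 $ 2)) / a"
  define R where "R x = 1 *\<^sub>R N x + y *\<^sub>R S x" for x
  have R: "stationary R" "R 0 $ 1 = c" "R L $ 2 = y"
    unfolding R_def[abs_def] using N S stationary_combination[OF N(1) S(1), of 1 y] by simp_all
  define w where "w = (vector [c, y] :: real^2)"
  have opt0: "(1 - lam) * ((R L $ 1 - Rb $ 1) * S L $ 1 + (R 0 $ 2 - Rb $ 2) * S 0 $ 2) + lam * y = 0"
  proof -
    have "(1 - lam) * ((R L $ 1 - Rb $ 1) * S L $ 1 + (R 0 $ 2 - Rb $ 2) * S 0 $ 2) + lam * y
      = (1 - lam) * ((N L $ 1 - Rb $ 1) * S L $ 1 + (N 0 $ 2 - Rb $ 2) * S 0 $ 2) + a * y"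
      by (simp add: R_def a_def power2_eq_square algebra_simps)
    also have "\<dots> = 0" using a by (simp add: y_def)
    finally show ?thesis .
  qed
  define q2 where "q2 = - ((1 - lam) * (R 0 $ 2 - Rb $ 2))"
  define Q where "Q x = (((1 - lam) * (R L $ 1 - Rb $ 1) - q2 * Q2 L $ 1) / Q1 L $ 1) *\<^sub>R Q1 x + q2 *\<^sub>R Q2 x" for x
  have Q: "adjoint_state Q" "Q L $ 1 = (1 - lam) * (R L $ 1 - Rb $ 1)" "Q 0 $ 2 = q2"
    unfolding Q_def[abs_def] using Q1_ne adjoint_combination[OF Q1(1) Q2(1)] by (simp_all add: Q1 Q2 ax)
  have "Q L $ 2 = lam * y"
    using stationary_pairing[OF Q(1) S(1)] opt0 by (simp add: S Q q2_def algebra_simps)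
  then show ?thesis
    by (intro that[of w R Q]) (use R Q in \<open>simp_all add: w_def q2_def optimality_system_def\<close>)
qed

text \<open>
  The expansion of the convex cost around the stationary point has a vanishing linear part by duality and a
  nonnegative quadratic part.
\<close>

lemma J0_minimal:
  assumes os: "optimality_system lam Rb w R Q"
    and lam: "0 < lam" "lam < 1"
    and sp: "\<And>x. x \<in> {0..L} \<Longrightarrow> dp x = d 1 x" "\<And>x. x \<in> {0..L} \<Longrightarrow> dm x = d 2 x"
    and S: "static_state L dp dm \<eta> M v S" and v: "v $ 1 = w $ 1"
  shows "J0 L lam Rb w R \<le> J0 L lam Rb v S"
proof -
  have R: "stationary R" and Q: "adjoint_state Q" and w: "R 0 $ 1 = w $ 1" "R L $ 2 = w $ 2"
    and opt: "Q L $ 1 = (1 - lam) * (R L $ 1 - Rb $ 1)" "Q 0 $ 2 = - ((1 - lam) * (R 0 $ 2 - Rb $ 2))"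
      "Q L $ 2 = lam * w $ 2"
    using os by (auto simp: optimality_system_def)
  have Sc: "continuous_on {0..L} (\<lambda>x. S x $ i)" for i
    using S unfolding static_state_def by (intro continuous_on_component) auto
  have bc: "S 0 $ 1 = v $ 1" "S L $ 2 = v $ 2" using S by (auto simp: static_state_def)
  have Sd: "((\<lambda>x. S x $ i) has_real_derivative \<eta> * (M x *v S x) $ i / d i x) (at x)" if x: "x \<in> {0<..<L}" for i x
  proof -
    obtain S' where S': "(S has_vector_derivative S') (at x)" "diag2 (dp x) (dm x) *v S' = \<eta> *\<^sub>R (M x *v S x)"
      using S x unfolding static_state_def by blast
    have "d i x * S' $ i = \<eta> * (M x *v S x) $ i"
      using S'(2) sp[of x] x exhaust_2[of i] by (auto simp: vec_eq_iff diag2_def matrix_vector_mult_def sum_2 forall_2)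
    then have "S' $ i = \<eta> * (M x *v S x) $ i / d i x" using ch.d_nz[of i x] by (simp add: field_simps)
    with component_derivative[OF S'(1), of i] show ?thesis by simp
  qed
  have pair: "Q L $ 1 * (S L $ 1 - R L $ 1) + Q L $ 2 * (S L $ 2 - R L $ 2)
      = Q 0 $ 1 * (S 0 $ 1 - R 0 $ 1) + Q 0 $ 2 * (S 0 $ 2 - R 0 $ 2)"
    using adjoint_pairing[OF Q Sc Sd] stationary_pairing[OF Q R] by (simp add: algebra_simps)
  have eq: "J0 L lam Rb v S = J0 L lam Rb w R
     + 2 * (Q L $ 1 * (S L $ 1 - R L $ 1) + Q L $ 2 * (S L $ 2 - R L $ 2) - Q 0 $ 2 * (S 0 $ 2 - R 0 $ 2))
     + (1 - lam) * ((S L $ 1 - R L $ 1)\<^sup>2 + (S 0 $ 2 - R 0 $ 2)\<^sup>2) + lam * (v $ 2 - w $ 2)\<^sup>2"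
    unfolding J0_def norm2_sq sum_2 opt by (simp add: bc w v power2_eq_square algebra_simps)
  have "Q L $ 1 * (S L $ 1 - R L $ 1) + Q L $ 2 * (S L $ 2 - R L $ 2) - Q 0 $ 2 * (S 0 $ 2 - R 0 $ 2) = 0"
    using pair by (simp add: bc w v)
  moreover have "0 \<le> (1 - lam) * ((S L $ 1 - R L $ 1)\<^sup>2 + (S 0 $ 2 - R 0 $ 2)\<^sup>2)" "0 \<le> lam * (v $ 2 - w $ 2)\<^sup>2"
    using lam by auto
  ultimately show ?thesis unfolding eq by simp
qed

lemma stationary_static_state:
  assumes R: "stationary R" and w: "R 0 $ 1 = w $ 1" "R L $ 2 = w $ 2"
    and sp: "\<And>x. x \<in> {0..L} \<Longrightarrow> dp x = d 1 x" "\<And>x. x \<in> {0..L} \<Longrightarrow> dm x = d 2 x"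
  shows "static_state L dp dm \<eta> M w R"
  unfolding static_state_def
proof (intro conjI ballI)
  show "continuous_on {0..L} R" by (rule stationary_cont[OF R])
  fix x assume x: "x \<in> {0<..<L}"
  define V where "V = (\<chi> i. \<eta> * (M x *v R x) $ i / d i x)"
  have "(R has_vector_derivative V) (at x)"
  proof -
    have c: "((\<lambda>x. R x $ i) has_vector_derivative V $ i) (at x)" for i
      using stationary_interior[OF R x, of i] by (simp add: V_def has_real_derivative_iff_has_vector_derivative)
    have vec: "v $ 1 *\<^sub>R axis 1 1 + v $ 2 *\<^sub>R axis 2 1 = v" for v :: "real^2"
      by (simp add: vec_eq_iff forall_2 axis_def)
    have "((\<lambda>x. R x $ 1 *\<^sub>R axis 1 1 + R x $ 2 *\<^sub>R (axis 2 1 :: real^2)) has_vector_derivative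
        V $ 1 *\<^sub>R axis 1 1 + V $ 2 *\<^sub>R axis 2 1) (at x)"
      by (intro has_vector_derivative_add bounded_linear.has_vector_derivative[OF bounded_linear_scaleR_left] c)
    then show ?thesis by (simp only: vec)
  qed
  moreover have "diag2 (dp x) (dm x) *v V = \<eta> *\<^sub>R (M x *v R x)"
    using x sp ch.d_nz by (auto simp: V_def vec_eq_iff forall_2 diag2_def matrix_vector_mult_def sum_2)
  ultimately show "\<exists>R'. (R has_vector_derivative R') (at x) \<and> diag2 (dp x) (dm x) *v R' = \<eta> *\<^sub>R (M x *v R x)" by blast
qed (rule w)+

section \<open>Controls with integer values\<close>

text \<open>
  Labels of the characteristics through almost all points at a fixed time, and through a fixed boundary point
  at almost all times, avoid any given null set.
\<close>

lemma dynamic_state_cong_AE: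
  assumes dyn: "dynamic_state L dp dm \<eta> M T u r"
    and sp: "\<And>x. x \<in> {0..L} \<Longrightarrow> dp x = d 1 x" "\<And>x. x \<in> {0..L} \<Longrightarrow> dm x = d 2 x"
    and ae: "AE t in lebesgue_on {0..T}. u t = v t"
  shows "dynamic_state L dp dm \<eta> M T v r"
proof -
  have ae': "AE k in lborel. k \<in> {0..T} \<longrightarrow> u k = v k"
    using ae by (subst (asm) AE_lebesgue_on_iff) auto
  have eq: "solves_along v r i t x" if "solves_along u r i t x" "t - \<theta> i x \<in> {0..T} \<longrightarrow> u (t - \<theta> i x) = v (t - \<theta> i x)"
      "t \<in> {0..T}" "x \<in> {0..L}" for i t x
  proof -
    have "(if t - \<theta> i x \<le> 0 then 0 else u (t - \<theta> i x) $ i) = (if t - \<theta> i x \<le> 0 then 0 else v (t - \<theta> i x) $ i)"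
      using that(2,3) ch.\<theta>_range[of i x] that(4) by auto
    then show ?thesis using that(1) unfolding ch.carried_def Let_def by simp
  qed
  have 1: "AE x in lebesgue_on {0..L}. \<forall>i. solves_along v r i t x"
    if t: "t \<in> {0..T}" and s: "AE x in lebesgue_on {0..L}. \<forall>i. solves_along u r i t x" for t
  proof -
    have "AE x in lborel. t - \<theta> i x \<in> {0..T} \<longrightarrow> u (t - \<theta> i x) = v (t - \<theta> i x)" for i
      by (rule ch.AE_position[OF ae'])
    then have "AE x in lborel. \<forall>i. t - \<theta> i x \<in> {0..T} \<longrightarrow> u (t - \<theta> i x) = v (t - \<theta> i x)"
      by (subst AE_all_countable) blast
    then show ?thesis using s unfolding AE_lebesgue_on_iff[OF borel_closed[OF closed_atLeastAtMost]]
      by eventually_elim (use eq t in blast)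
  qed
  have 2: "AE t in lebesgue_on {0..T}. \<forall>i. solves_along v r i t x"
    if x: "x \<in> {0..L}" and s: "AE t in lebesgue_on {0..T}. \<forall>i. solves_along u r i t x" for x
  proof -
    have "AE t in lborel. t - \<theta> i x \<in> {0..T} \<longrightarrow> u (t - \<theta> i x) = v (t - \<theta> i x)" for i
      by (rule AE_lborel_compose[OF ae', where j = "\<lambda>k. k + \<theta> i x" and j' = "\<lambda>_. 1"])
         (auto intro!: derivative_eq_intros)
    then have "AE t in lborel. \<forall>i. t - \<theta> i x \<in> {0..T} \<longrightarrow> u (t - \<theta> i x) = v (t - \<theta> i x)"
      by (subst AE_all_countable) blast
    then show ?thesis using s unfolding AE_lebesgue_on_iff[OF borel_closed[OF closed_atLeastAtMost]]
      by eventually_elim (use eq x in blast)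
  qed
  have "x \<in> {0..L}" if "x \<in> {0, L}" for x using that L_pos by auto
  then show ?thesis
    using iffD1[OF dynamic_state_iff[OF sp] dyn] 1 2
    by (intro iffD2[OF dynamic_state_iff[OF sp]]) blast+
qed

lemma zero_dynamic_state:
  assumes sp: "\<And>x. x \<in> {0..L} \<Longrightarrow> dp x = d 1 x" "\<And>x. x \<in> {0..L} \<Longrightarrow> dm x = d 2 x"
  shows "dynamic_state L dp dm \<eta> M T (\<lambda>_. 0) (\<lambda>_ _. 0)"
proof (rule iffD2[OF dynamic_state_iff[OF sp]])
  have "solves_along (\<lambda>_. 0) (\<lambda>_ _. 0) i t x" for i t x
    unfolding ch.carried_def Let_def by (auto intro: has_bochner_integral_zero)
  moreover have "L2_on A (\<lambda>_. 0 :: 'x::euclidean_space)" for A by (simp add: L2_on_def)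
  ultimately show "(\<lambda>(t, x). 0 :: real^2) \<in> borel_measurable (lebesgue_on ({0..T} \<times> {0..L})) \<and>
     (\<forall>t\<in>{0..T}. L2_on {0..L} (\<lambda>_. 0 :: real^2)) \<and>
     (\<forall>t\<in>{0..T}. ((\<lambda>s. LINT x|lebesgue_on {0..L}. (norm ((0 :: real^2) - 0))\<^sup>2) \<longlongrightarrow> 0)
        (at t within {0..T})) \<and>
     (\<forall>t\<in>{0..T}. AE x in lebesgue_on {0..L}. \<forall>i. solves_along (\<lambda>_. 0) (\<lambda>_ _. 0) i t x) \<and>
     (\<forall>x\<in>{0, L}. AE t in lebesgue_on {0..T}. \<forall>i. solves_along (\<lambda>_. 0) (\<lambda>_ _. 0) i t x) \<and>
     L2_on {0..T} (\<lambda>t. (0 :: real^2) $ 1) \<and> L2_on {0..T} (\<lambda>t. (0 :: real^2) $ 2)"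
    by (simp add: L2_on_def)
qed auto

end

text \<open>
  A partition with two interior points suffices to compare any two interior values and both end values.
\<close>

lemma total_variation_ge:
  assumes "0 < s" "s < t" "t < T"
  shows "ennreal \<bar>f s - f 0\<bar> + ennreal \<bar>f t - f s\<bar> + ennreal \<bar>f T - f t\<bar> \<le> total_variation T f"
proof -
  define p where "p i = (if i = 0 then 0 else if i = 1 then s else if i = 2 then t else T)" for i :: nat
  have "p 0 = 0 \<and> p 3 = T \<and> (\<forall>i<3. p i < p (Suc i))"
    using assms by (auto simp: p_def less_Suc_eq numeral_3_eq_3)
  then have "(\<Sum>i<3. ennreal \<bar>f (p (Suc i)) - f (p i)\<bar>) \<le> total_variation T f"
    unfolding total_variation_def by (intro SUP_upper2[of "(3, p)"]) auto
  moreover have "(\<Sum>i<3. ennreal \<bar>f (p (Suc i)) - f (p i)\<bar>)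
      = ennreal \<bar>f s - f 0\<bar> + ennreal \<bar>f t - f s\<bar> + ennreal \<bar>f T - f t\<bar>"
    by (simp add: p_def numeral_3_eq_3 add.assoc)
  ultimately show ?thesis by simp
qed

lemma total_variation_const: "total_variation T (\<lambda>_. c) = 0"
  unfolding total_variation_def by (auto intro!: antisym SUP_least)

lemma total_variation_zero_imp_const:
  assumes "total_variation T f = 0" "0 < T" "t \<in> {0..T}"
  shows "f t = f 0"
proof -
  have 1: "f s = f 0 \<and> f T = f 0" if "0 < s" "s < T" for s
    using total_variation_ge[OF that(1), of "(s + T) / 2" T f] that assms(1) by (auto simp: ennreal_eq_0_iff add_eq_0_iff_both_eq_0)
  consider "t = 0" | "t = T" | "0 < t" "t < T" using assms(3) by fastforce
  then show ?thesis
    using 1[of t] 1[of "T / 2"] assms(2) by cases auto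
qed

lemma diff_le_total_variation:
  assumes "s \<in> {0<..<T}" "t \<in> {0<..<T}"
  shows "ennreal \<bar>f t - f s\<bar> \<le> total_variation T f"
proof -
  have le: "ennreal \<bar>f b - f a\<bar> \<le> total_variation T f" if "0 < a" "a < b" "b < T" for a b
    by (rule order_trans[OF _ total_variation_ge[OF that, of f]])
       (simp add: add_increasing add_increasing2)
  show ?thesis
    using le[of s t] le[of t s] assms by (cases s t rule: linorder_cases) (auto simp: abs_minus_commute)
qed

text \<open>
  Distinct integers are at distance at least one.
\<close>

lemma integer_control_constant:
  assumes T: "0 < T" and ae: "AE t in lebesgue_on {0..T}. f t \<in> of_int ` F"
    and tv: "total_variation T f < 1"
  obtains c where "c \<in> F" "AE t in lebesgue_on {0..T}. f t = of_int c"
proof -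
  have ae': "AE t in lborel. t \<in> {0..T} \<longrightarrow> f t \<in> of_int ` F"
    using ae by (subst (asm) AE_lebesgue_on_iff) auto
  have "\<exists>s. s \<in> {0<..<T} \<and> f s \<in> of_int ` F"
  proof (rule ccontr)
    assume "\<not> ?thesis"
    then have "AE t in lborel. t \<notin> {0<..<T}"
      using ae' by (auto elim!: eventually_mono)
    then have "emeasure lborel {0<..<T} = 0"
      by (subst (asm) AE_iff_measurable[of "{0<..<T}"]) auto
    then show False using T by simp
  qed
  then obtain s c where s: "s \<in> {0<..<T}" "c \<in> F" "f s = of_int c" by blast
  have "AE t in lborel. t \<in> {0..T} \<longrightarrow> f t = of_int c"
    using ae' AE_lborel_singleton[of 0] AE_lborel_singleton[of T]
  proof eventually_elim
    case (elim t)
    show ?case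
    proof
      assume t: "t \<in> {0..T}"
      then have "t \<in> {0<..<T}" using elim by auto
      from le_less_trans[OF diff_le_total_variation[OF s(1) this] tv]
      have "\<bar>f t - of_int c\<bar> < 1" by (simp add: s ennreal_less_one_iff)
      moreover obtain c' where "f t = of_int c'" using elim t by auto
      ultimately show "f t = of_int c" by simp
    qed
  qed
  then have "AE t in lebesgue_on {0..T}. f t = of_int c" by (subst AE_lebesgue_on_iff) auto
  with s(2) show ?thesis by (rule that)
qed

lemma J_cong_AE:
  assumes u: "L2_on {0..T} u" and v: "L2_on {0..T} v" and out: "L2_on {0..T} (\<lambda>t. r t L $ 1)" "L2_on {0..T} (\<lambda>t. r t 0 $ 2)"
    and ae: "AE t in lebesgue_on {0..T}. u t = v t"
  shows "J L lam Rb T u r = J L lam Rb T v r"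
  unfolding J_def
proof (rule integral_cong_AE)
  have [measurable]: "u \<in> borel_measurable (lebesgue_on {0..T})" "v \<in> borel_measurable (lebesgue_on {0..T})"
    "(\<lambda>t. r t L $ 1) \<in> borel_measurable (lebesgue_on {0..T})" "(\<lambda>t. r t 0 $ 2) \<in> borel_measurable (lebesgue_on {0..T})"
    using assms by (auto simp: L2_on_def)
  have e: "(norm (vector [r t L $ 1 - Rb $ 1, r t 0 $ 2 - Rb $ 2] :: real^2))\<^sup>2
     = (r t L $ 1 - Rb $ 1)\<^sup>2 + (r t 0 $ 2 - Rb $ 2)\<^sup>2" for t
    unfolding norm2_sq sum_2 by simp
  show "(\<lambda>t. (1 - lam) * (norm (vector [r t L $ 1 - Rb $ 1, r t 0 $ 2 - Rb $ 2] :: real^2))\<^sup>2 + lam * (norm (u t))\<^sup>2)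
      \<in> borel_measurable (lebesgue_on {0..T})"
    "(\<lambda>t. (1 - lam) * (norm (vector [r t L $ 1 - Rb $ 1, r t 0 $ 2 - Rb $ 2] :: real^2))\<^sup>2 + lam * (norm (v t))\<^sup>2)
      \<in> borel_measurable (lebesgue_on {0..T})"
    unfolding e by measurable
qed (use ae in eventually_elim, simp)

lemma L2_on_const: "L2_on {0..T} (\<lambda>_. c :: real^2)"
  by (auto simp: L2_on_def intro!: continuous_imp_integrable_real continuous_on_const)

lemma L2_on_replace_first:
  assumes "L2_on {0..T} (u :: real \<Rightarrow> real^2)"
  shows "L2_on {0..T} (\<lambda>t. vector [c, u t $ 2] :: real^2)"
proof -
  have e: "(\<lambda>t. vector [c, u t $ 2] :: real^2) = (\<lambda>t. c *\<^sub>R axis 1 1 + u t $ 2 *\<^sub>R axis 2 1)"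
    by (auto simp: fun_eq_iff vec_eq_iff forall_2 axis_def)
  have [measurable]: "(\<lambda>t. u t $ 2) \<in> borel_measurable (lebesgue_on {0..T})"
    and i: "integrable (lebesgue_on {0..T}) (\<lambda>t. (u t $ 2)\<^sup>2)"
    using L2_on_component[OF assms, of 2] by (auto simp: L2_on_def)
  show ?thesis
    unfolding L2_on_def
  proof
    show "(\<lambda>t. vector [c, u t $ 2] :: real^2) \<in> borel_measurable (lebesgue_on {0..T})"
      unfolding e by measurable
    have "integrable (lebesgue_on {0..T}) (\<lambda>t. c\<^sup>2 + (u t $ 2)\<^sup>2)"
      by (rule Bochner_Integration.integrable_add[OF continuous_imp_integrable_real[OF continuous_on_const] i])
    then show "integrable (lebesgue_on {0..T}) (\<lambda>t. (norm (vector [c, u t $ 2] :: real^2))\<^sup>2)"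
      unfolding norm2_sq sum_2 by simp
  qed
qed

lemma J_nonneg:
  assumes "0 < lam" "lam < 1"
  shows "0 \<le> J L lam Rb T u r"
  unfolding J_def using assms by (intro integral_nonneg_AE AE_I2) (auto intro!: add_nonneg_nonneg)

context hyperbolic begin

text \<open>
  The zero control has zero variation and cost \<open>T (1 - lam) \<parallel>Rb\<parallel>\<^sup>2\<close>, so the penalty keeps the variation of an
  optimal control below one, and its integer values agree almost everywhere. Changing the
  control on a null set to this integer alters neither the state nor the cost functional, but removes the
  variation; by optimality there was none.
\<close>

lemma optimal_plus_control_constant:
  assumes sol: "solves_dynamic L dp dm \<eta> M lam Rb \<nu> F T u r"
    and sp: "\<And>x. x \<in> {0..L} \<Longrightarrow> dp x = d 1 x" "\<And>x. x \<in> {0..L} \<Longrightarrow> dm x = d 2 x"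
    and T: "0 < T" and lam: "0 < lam" "lam < 1" and F: "0 \<in> F"
    and \<nu>: "(1 - lam) * (norm Rb)\<^sup>2 < \<nu>"
  obtains c where "c \<in> F" "\<And>t. t \<in> {0..T} \<Longrightarrow> u t $ 1 = of_int c"
proof -
  have feas: "dynamic_feasible L dp dm \<eta> M F T u r"
    and opt: "\<And>v q. dynamic_feasible L dp dm \<eta> M F T v q \<Longrightarrow>
        dynamic_cost L lam Rb \<nu> T u r \<le> dynamic_cost L lam Rb \<nu> T v q"
    using sol by (auto simp: solves_dynamic_def)
  have u: "L2_on {0..T} u" and uF: "AE t in lebesgue_on {0..T}. u t $ 1 \<in> of_int ` F"
    and dyn: "dynamic_state L dp dm \<eta> M T u r"
    using feas by (auto simp: dynamic_feasible_def)
  have "0 \<le> (1 - lam) * (norm Rb)\<^sup>2" using lam by simp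
  then have \<nu>0: "0 < \<nu>" using \<nu> by linarith
  have "dynamic_feasible L dp dm \<eta> M F T (\<lambda>_. 0) (\<lambda>_ _. 0)"
    using zero_dynamic_state[OF sp] F L2_on_const[of T 0] by (auto simp: dynamic_feasible_def)
  note zero = opt[OF this]
  have "J L lam Rb T (\<lambda>_. 0) (\<lambda>_ _. 0) = T * ((1 - lam) * (norm Rb)\<^sup>2)"
    unfolding J_def norm2_sq sum_2 using T by (simp add: measure_restrict_space)
  then have "ennreal (J L lam Rb T u r) + ennreal (\<nu> * T) * total_variation T (\<lambda>t. u t $ 1)
      \<le> ennreal (T * ((1 - lam) * (norm Rb)\<^sup>2))"
    using zero unfolding dynamic_cost_def by (simp add: total_variation_const)
  then have "ennreal (\<nu> * T) * total_variation T (\<lambda>t. u t $ 1) \<le> ennreal (T * ((1 - lam) * (norm Rb)\<^sup>2))"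
    by (rule order_trans[rotated]) (simp add: add_increasing)
  also have "\<dots> < ennreal (\<nu> * T)"
    using T \<nu> \<nu>0 by (intro ennreal_lessI) (auto simp: mult.commute)
  finally have tv1: "ennreal (\<nu> * T) * total_variation T (\<lambda>t. u t $ 1) < ennreal (\<nu> * T)" .
  have "total_variation T (\<lambda>t. u t $ 1) < 1"
  proof (rule ccontr)
    assume "\<not> ?thesis"
    then have "ennreal (\<nu> * T) * 1 \<le> ennreal (\<nu> * T) * total_variation T (\<lambda>t. u t $ 1)"
      by (intro mult_left_mono) auto
    then show False using tv1 by simp
  qed
  then obtain c where c: "c \<in> F" "AE t in lebesgue_on {0..T}. u t $ 1 = of_int c"
    by (rule integer_control_constant[OF T uF])
  define v where "v t = (vector [of_int c, u t $ 2] :: real^2)" for t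
  have uv: "AE t in lebesgue_on {0..T}. u t = v t"
    using c(2) by eventually_elim (simp add: v_def vec_eq_iff forall_2)
  have v: "L2_on {0..T} v" unfolding v_def[abs_def] by (rule L2_on_replace_first[OF u])
  have "dynamic_feasible L dp dm \<eta> M F T v r"
    unfolding dynamic_feasible_def
  proof (intro conjI v dynamic_state_cong_AE[OF dyn sp uv])
    show "AE t in lebesgue_on {0..T}. v t $ 1 \<in> of_int ` F" using c(1) by (simp add: v_def)
  qed
  note mod = opt[OF this]
  have "J L lam Rb T u r = J L lam Rb T v r"
    by (rule J_cong_AE[OF u v _ _ uv]) (use dyn in \<open>auto simp: dynamic_state_def\<close>)
  then have "ennreal (J L lam Rb T u r) + ennreal (\<nu> * T) * total_variation T (\<lambda>t. u t $ 1)
      \<le> ennreal (J L lam Rb T u r) + 0"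
    using mod unfolding dynamic_cost_def by (simp add: v_def total_variation_const)
  then have "ennreal (\<nu> * T) * total_variation T (\<lambda>t. u t $ 1) \<le> 0"
    by (subst (asm) ennreal_add_left_cancel_le) auto
  then have tv0: "total_variation T (\<lambda>t. u t $ 1) = 0"
    using \<nu>0 T by (auto simp: ennreal_eq_0_iff not_le[symmetric] mult_le_0_iff)
  note const = total_variation_zero_imp_const[OF tv0 T]
  have "AE t in lborel. t \<in> {0..T} \<longrightarrow> u t $ 1 = of_int c"
    using c(2) by (subst (asm) AE_lebesgue_on_iff) auto
  then have "u 0 $ 1 = of_int c"
  proof (rule contrapos_pp)
    assume "u 0 $ 1 \<noteq> of_int c"
    then have "t \<in> {0<..<T} \<Longrightarrow> u t $ 1 \<noteq> of_int c" for t using const[of t] by simp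
    show "\<not> (AE t in lborel. t \<in> {0..T} \<longrightarrow> u t $ 1 = of_int c)"
    proof
      assume "AE t in lborel. t \<in> {0..T} \<longrightarrow> u t $ 1 = of_int c"
      then have "AE t in lborel. t \<notin> {0<..<T}"
        by eventually_elim (use \<open>\<And>t. t \<in> {0<..<T} \<Longrightarrow> u t $ 1 \<noteq> of_int c\<close> in auto)
      then have "emeasure lborel {0<..<T} = 0"
        by (subst (asm) AE_iff_measurable[of "{0<..<T}"]) auto
      then show False using T by simp
    qed
  qed
  then show ?thesis using const by (intro that[OF c(1)]) simp
qed

end

section \<open>The turnpike theorem\<close>

lemma ex_hyperbolic:
  fixes dp dm :: "real \<Rightarrow> real"
  assumes L: "0 < L" and c: "continuous_on {0..L} dp" "continuous_on {0..L} dm" "continuous_on {0..L} M"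
    and sgn: "\<And>x. x \<in> {0..L} \<Longrightarrow> dm x < 0 \<and> 0 < dp x"
  shows "\<exists>\<Theta> b b' d \<theta> \<xi>. hyperbolic L \<Theta> b b' d \<theta> \<xi> M \<and>
     (\<forall>x\<in>{0..L}. dp x = d 1 x) \<and> (\<forall>x\<in>{0..L}. dm x = d 2 x)"
proof -
  obtain \<Theta>p \<theta>p \<xi>p where p: "characteristics L \<Theta>p 0 L (\<lambda>x. dp (max 0 (min L x))) \<theta>p \<xi>p"
    using characteristics_positive[OF c(1) _ L] sgn by blast
  obtain \<Theta>m \<theta>m \<xi>m where m: "characteristics L \<Theta>m L 0 (\<lambda>x. dm (max 0 (min L x))) \<theta>m \<xi>m"
    using characteristics_negative[OF c(2) _ L] sgn by blast
  have cl: "max 0 (min L x) \<in> {0..L}" for x using L by auto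
  have "hyperbolic L (\<lambda>i. if i = 1 then \<Theta>p else \<Theta>m) (\<lambda>i. if i = 1 then 0 else L) (\<lambda>i. if i = 1 then L else 0)
     (\<lambda>i. if i = 1 then (\<lambda>x. dp (max 0 (min L x))) else (\<lambda>x. dm (max 0 (min L x))))
     (\<lambda>i. if i = 1 then \<theta>p else \<theta>m) (\<lambda>i. if i = 1 then \<xi>p else \<xi>m) M"
    by (rule hyperbolic.intro) (use p m sgn[OF cl] c(3) in auto)
  then show ?thesis by (intro exI conjI) (assumption, auto)
qed

text \<open>
  Scaling a nonzero vector to the unit ellipsoid; the supremum is taken over a bounded set of values because
  the ellipsoid is bounded.
\<close>

lemma quadratic_form_le:
  fixes E B :: "real^2^2"
  assumes sup: "(SUP v\<in>{v. v \<bullet> (E *v v) = 1}. v \<bullet> (B *v v)) \<le> \<nu>"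
    and k: "0 < k" "\<And>v. k * (norm v)\<^sup>2 \<le> v \<bullet> (E *v v)"
  shows "v \<bullet> (B *v v) \<le> \<nu> * (v \<bullet> (E *v v))"
proof (cases "v = 0")
  case False
  obtain K where K: "K > 0" "\<And>x v. x \<in> {0..0::real} \<Longrightarrow> norm (B *v v) \<le> K * norm v"
    using matrix_vector_mult_bound[of 0 "\<lambda>_. B"] continuous_on_const by blast
  have bdd: "bdd_above ((\<lambda>v. v \<bullet> (B *v v)) ` {v. v \<bullet> (E *v v) = 1})"
  proof (rule bdd_aboveI2)
    fix u assume "u \<in> {v. v \<bullet> (E *v v) = 1}"
    then have "(norm u)\<^sup>2 \<le> 1 / k" using k(2)[of u] k(1) by (simp add: field_simps)
    have "u \<bullet> (B *v u) \<le> norm u * norm (B *v u)" by (rule norm_cauchy_schwarz)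
    also have "\<dots> \<le> norm u * (K * norm u)" using K(2)[of 0 u] by (intro mult_left_mono) auto
    also have "\<dots> = K * (norm u)\<^sup>2" by (simp add: power2_eq_square)
    also have "\<dots> \<le> K * (1 / k)" using K(1) \<open>(norm u)\<^sup>2 \<le> 1 / k\<close> by (intro mult_left_mono) auto
    finally show "u \<bullet> (B *v u) \<le> K * (1 / k)" .
  qed
  define q where "q = v \<bullet> (E *v v)"
  have "0 < k * (norm v)\<^sup>2" using False k(1) by simp
  then have q: "0 < q" using k(2)[of v] by (simp add: q_def)
  define u where "u = (1 / sqrt q) *\<^sub>R v"
  have sc: "u \<bullet> (C *v u) = (v \<bullet> (C *v v)) / q" for C :: "real^2^2"
    using q by (simp add: u_def matrix_vector_mult_scaleR)
  have "u \<bullet> (E *v u) = 1" using q unfolding sc q_def[symmetric] by simp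
  then have "u \<bullet> (B *v u) \<le> \<nu>"
    using sup by (intro order_trans[OF cSUP_upper[OF _ bdd]]) auto
  then show ?thesis using q unfolding sc q_def[symmetric] by (simp add: pos_divide_le_eq)
qed simp

lemma diag2_quadratic: "v \<bullet> (diag2 a b *v v) = a * (v $ 1)\<^sup>2 + b * (v $ 2)\<^sup>2"
  by (simp add: diag2_def matrix_vector_mult_def inner_vec_def sum_2 power2_eq_square)

text \<open>
  The bound on the supremum, written out in coordinates and for vectors of arbitrary length.
\<close>

lemma dissipation_inequality:
  assumes L: "0 < L" and x: "x \<in> {0..L}"
    and dp: "(dp has_real_derivative dp') (at x within {0..L})" and dm: "(dm has_real_derivative dm') (at x within {0..L})"
    and sup: "(SUP v\<in>{v. v \<bullet> (weight \<mu>p \<mu>m x *v v) = 1}.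
           v \<bullet> ((vector_derivative (\<lambda>y. weight \<mu>p \<mu>m y ** diag2 (dp y) (dm y)) (at x within {0..L})
                 - \<bar>\<eta>\<bar> *\<^sub>R (weight \<mu>p \<mu>m x ** Mx + transpose Mx ** weight \<mu>p \<mu>m x)) *v v)) \<le> \<nu>"
    and \<eta>: "\<eta> \<le> 0"
  shows "exp (- \<mu>p * x) * (dp' - \<mu>p * dp x) * (v $ 1)\<^sup>2 + exp (\<mu>m * x) * (dm' + \<mu>m * dm x) * (v $ 2)\<^sup>2
     + 2 * (\<eta> * (exp (- \<mu>p * x) * (v $ 1 * (Mx *v v) $ 1) + exp (\<mu>m * x) * (v $ 2 * (Mx *v v) $ 2)))
     \<le> \<nu> * (exp (- \<mu>p * x) * (v $ 1)\<^sup>2 + exp (\<mu>m * x) * (v $ 2)\<^sup>2)"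
proof -
  define a where "a = exp (- \<mu>p * x) * (dp' - \<mu>p * dp x)"
  define b where "b = exp (\<mu>m * x) * (dm' + \<mu>m * dm x)"
  have split: "diag2 p q = p *\<^sub>R diag2 1 0 + q *\<^sub>R diag2 0 1" for p q
    by (simp add: diag2_def vec_eq_iff forall_2)
  have prod: "weight \<mu>p \<mu>m y ** diag2 (dp y) (dm y) = diag2 (exp (- \<mu>p * y) * dp y) (exp (\<mu>m * y) * dm y)" for y
    by (simp add: weight_def diag2_def matrix_matrix_mult_def vec_eq_iff forall_2 sum_2)
  have "((\<lambda>y. exp (- \<mu>p * y) * dp y) has_vector_derivative a) (at x within {0..L})"
    "((\<lambda>y. exp (\<mu>m * y) * dm y) has_vector_derivative b) (at x within {0..L})"
    unfolding has_real_derivative_iff_has_vector_derivative[symmetric] a_def b_def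
    by (rule derivative_eq_intros dp dm refl | simp add: algebra_simps)+
  then have "((\<lambda>y. (exp (- \<mu>p * y) * dp y) *\<^sub>R diag2 1 0 + (exp (\<mu>m * y) * dm y) *\<^sub>R diag2 0 1)
      has_vector_derivative a *\<^sub>R diag2 1 0 + b *\<^sub>R diag2 0 1) (at x within {0..L})"
    by (intro has_vector_derivative_add bounded_linear.has_vector_derivative[OF bounded_linear_scaleR_left])
  then have "((\<lambda>y. weight \<mu>p \<mu>m y ** diag2 (dp y) (dm y)) has_vector_derivative diag2 a b) (at x within {0..L})"
    unfolding prod split[symmetric] .
  then have vd: "vector_derivative (\<lambda>y. weight \<mu>p \<mu>m y ** diag2 (dp y) (dm y)) (at x within {0..L}) = diag2 a b"
    using vector_derivative_within_cbox[of 0 L x] L x by simp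
  define k where "k = min (exp (- \<mu>p * x)) (exp (\<mu>m * x))"
  have E: "v \<bullet> (weight \<mu>p \<mu>m x *v v) = exp (- \<mu>p * x) * (v $ 1)\<^sup>2 + exp (\<mu>m * x) * (v $ 2)\<^sup>2" for v
    unfolding weight_def by (rule diag2_quadratic)
  have "k * (norm v)\<^sup>2 \<le> v \<bullet> (weight \<mu>p \<mu>m x *v v)" for v
    unfolding E norm2_sq sum_2 distrib_left by (intro add_mono mult_right_mono) (auto simp: k_def)
  from quadratic_form_le[OF sup[unfolded vd] _ this, of v]
  have "v \<bullet> ((diag2 a b - \<bar>\<eta>\<bar> *\<^sub>R (weight \<mu>p \<mu>m x ** Mx + transpose Mx ** weight \<mu>p \<mu>m x)) *v v)
     \<le> \<nu> * (exp (- \<mu>p * x) * (v $ 1)\<^sup>2 + exp (\<mu>m * x) * (v $ 2)\<^sup>2)"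
    unfolding E by (simp add: k_def)
  moreover have "v \<bullet> ((diag2 a b - \<bar>\<eta>\<bar> *\<^sub>R (weight \<mu>p \<mu>m x ** Mx + transpose Mx ** weight \<mu>p \<mu>m x)) *v v)
     = a * (v $ 1)\<^sup>2 + b * (v $ 2)\<^sup>2
     + 2 * (\<eta> * (exp (- \<mu>p * x) * (v $ 1 * (Mx *v v) $ 1) + exp (\<mu>m * x) * (v $ 2 * (Mx *v v) $ 2)))"
    using \<eta> by (simp add: weight_def diag2_def matrix_vector_mult_def matrix_matrix_mult_def transpose_def
        inner_vec_def sum_2 power2_eq_square algebra_simps)
  ultimately show ?thesis by (simp add: a_def b_def)
qed

theorem theorem2:
  fixes L \<eta>0 lam \<nu> :: real
    and dp dm dp' dm' :: "real \<Rightarrow> real"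
    and M :: "real \<Rightarrow> real^2^2"
    and Rb :: "real^2"
    and F :: "int set"
  assumes "L > 0"
    and "\<And>x. x \<in> {0..L} \<Longrightarrow> (dp has_real_derivative dp' x) (at x within {0..L})"
    and "\<And>x. x \<in> {0..L} \<Longrightarrow> (dm has_real_derivative dm' x) (at x within {0..L})"
    and "continuous_on {0..L} dp'" and "continuous_on {0..L} dm'"
    and "\<And>x. x \<in> {0..L} \<Longrightarrow> dm x < 0 \<and> 0 < dp x"
    and "continuous_on {0..L} M"
    and "\<eta>0 \<le> 0"
    and "\<exists>\<mu>p \<mu>m \<nu>a. \<mu>p > 0 \<and> \<mu>m > 0 \<and> \<nu>a < 0 \<and>
      (\<forall>x\<in>{0..L}. let E = weight \<mu>p \<mu>m in
        (SUP v\<in>{v. v \<bullet> (E x *v v) = 1}.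
           v \<bullet> ((vector_derivative (\<lambda>y. E y ** diag2 (dp y) (dm y)) (at x within {0..L})
                 - \<bar>\<eta>0\<bar> *\<^sub>R (E x ** M x + transpose (M x) ** E x)) *v v)) \<le> \<nu>a)"
    and "\<exists>\<mu>p \<mu>m \<nu>0. \<mu>p < 0 \<and> \<mu>m < 0 \<and> \<nu>0 > 0 \<and>
      (\<forall>x\<in>{0..L}. let E = weight \<mu>p \<mu>m in
        (INF v\<in>{v. v \<bullet> (E x *v v) = 1}.
           v \<bullet> ((vector_derivative E (at x within {0..L}) ** diag2 (dp x) (dm x)
                 - E x ** diag2 (dp' x) (dm' x)
                 + \<bar>\<eta>0\<bar> *\<^sub>R (E x ** M x + transpose (M x) ** E x)) *v v)) \<ge> \<nu>0)"
    and "0 < lam" and "lam < 1" and "\<nu> > 0"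
    and "finite F" and "0 \<in> F"
    and "\<nu> > (1 - lam) * (norm Rb)\<^sup>2"
  shows "\<exists>C>0. \<exists>D>0. \<forall>\<^sub>F T in at_top. \<forall>u r.
    solves_dynamic L dp dm \<eta>0 M lam Rb \<nu> F T u r \<longrightarrow>
    (\<exists>us Rs. solves_static L dp dm \<eta>0 M lam Rb F us Rs \<and>
       (\<forall>t\<in>{0..T}. u t $ 1 = us $ 1) \<and>
       1 / T * (LINT t|lebesgue_on {0..T}. (norm (u t - us))\<^sup>2) \<le> C / T \<and>
       (LINT \<tau>|lebesgue_on {0..T}. LINT x|lebesgue_on {0..L}. (norm (r \<tau> x - Rs x))\<^sup>2) \<le> D)"
proof -
  note L = assms(1) and lam = assms(11,12) and \<eta> = assms(8)
  have dp_cont: "continuous_on {0..L} dp" by (rule DERIV_continuous_on[OF assms(2)])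
  have dm_cont: "continuous_on {0..L} dm" by (rule DERIV_continuous_on[OF assms(3)])
  obtain \<Theta> b b' d \<theta> \<xi> where hyp: "hyperbolic L \<Theta> b b' d \<theta> \<xi> M"
    and sp: "\<And>x. x \<in> {0..L} \<Longrightarrow> dp x = d 1 x" "\<And>x. x \<in> {0..L} \<Longrightarrow> dm x = d 2 x"
    using ex_hyperbolic[OF L dp_cont dm_cont assms(7,6)] by blast
  interpret hyperbolic L \<Theta> b b' d \<theta> \<xi> M \<eta>0 by (rule hyp)
  obtain \<mu>p \<mu>m \<nu>a where \<mu>: "\<mu>p > 0" "\<mu>m > 0" "\<nu>a < 0"
    and sup: "\<And>x. x \<in> {0..L} \<Longrightarrow> (SUP v\<in>{v. v \<bullet> (weight \<mu>p \<mu>m x *v v) = 1}.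
           v \<bullet> ((vector_derivative (\<lambda>y. weight \<mu>p \<mu>m y ** diag2 (dp y) (dm y)) (at x within {0..L})
                 - \<bar>\<eta>0\<bar> *\<^sub>R (weight \<mu>p \<mu>m x ** M x + transpose (M x) ** weight \<mu>p \<mu>m x)) *v v)) \<le> \<nu>a"
    using assms(9) unfolding Let_def by blast
  define e where "e i x = (if i = (1::2) then exp (- \<mu>p * x) else exp (\<mu>m * x))" for i and x :: real
  define e' where "e' i x = (if i = (1::2) then exp (- \<mu>p * x) * (dp' x - \<mu>p * dp x)
      else exp (\<mu>m * x) * (dm' x + \<mu>m * dm x))" for i x
  define e0 where "e0 = exp (- \<mu>p * L)"
  define \<alpha> where "\<alpha> = - \<nu>a * e0"
  have e0: "0 < e0" by (simp add: e0_def)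
  have e0_le: "e0 \<le> e i x" if "x \<in> {0..L}" for i x
  proof -
    have "e0 \<le> 1" using \<mu> L by (simp add: e0_def)
    moreover have "1 \<le> exp (\<mu>m * x)" using \<mu> that by simp
    moreover have "e0 \<le> exp (- \<mu>p * x)" using \<mu> that by (simp add: e0_def)
    ultimately show ?thesis unfolding e_def by (auto intro: order_trans simp del: one_le_exp_iff)
  qed
  have e_pos: "0 < e i x" for i x by (simp add: e_def)
  have \<alpha>: "0 < \<alpha>" using \<mu> e0 by (simp add: \<alpha>_def mult_neg_pos)
  have e_der: "((\<lambda>x. e i x * d i x) has_real_derivative e' i x) (at x within {0..L})" if x: "x \<in> {0..L}" for i x
  proof -
    have 1: "((\<lambda>x. exp (- \<mu>p * x) * dp x) has_real_derivative exp (- \<mu>p * x) * (dp' x - \<mu>p * dp x)) (at x within {0..L})"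
      "((\<lambda>x. exp (\<mu>m * x) * dm x) has_real_derivative exp (\<mu>m * x) * (dm' x + \<mu>m * dm x)) (at x within {0..L})"
      by (rule derivative_eq_intros assms(2)[OF x] assms(3)[OF x] refl | simp add: algebra_simps)+
    have "((\<lambda>x. e i x * (if i = 1 then dp x else dm x)) has_real_derivative e' i x) (at x within {0..L})"
      using 1 by (cases "i = 1") (simp_all add: e_def e'_def)
    then show ?thesis
      by (rule has_field_derivative_transform_within[OF _ zero_less_one x])
         (use sp exhaust_2[of i] in auto)
  qed
  have e'_cont: "continuous_on {0..L} (e' i)" for i
    unfolding e'_def[abs_def] using assms(4,5) dp_cont dm_cont
    by (cases "i = 1") (auto intro!: continuous_intros)
  have dissip: "(\<Sum>i\<in>UNIV. e' i x * (v $ i)\<^sup>2 + 2 * (\<eta>0 * (e i x * (v $ i * (M x *v v) $ i)))) \<le> - \<alpha> * (norm v)\<^sup>2"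
    if x: "x \<in> {0..L}" for x v
  proof -
    have "(\<Sum>i\<in>UNIV. e' i x * (v $ i)\<^sup>2 + 2 * (\<eta>0 * (e i x * (v $ i * (M x *v v) $ i))))
        \<le> \<nu>a * (e 1 x * (v $ 1)\<^sup>2 + e 2 x * (v $ 2)\<^sup>2)"
      using dissipation_inequality[OF L x assms(2)[OF x] assms(3)[OF x] sup[OF x] \<eta>, of v]
      by (simp add: sum_2 e_def e'_def distrib_left)
    also have "\<dots> \<le> \<nu>a * (e0 * (v $ 1)\<^sup>2 + e0 * (v $ 2)\<^sup>2)"
      using \<mu> e0_le[OF x] by (intro mult_left_mono_neg add_mono mult_right_mono) auto
    also have "\<dots> = - \<alpha> * (norm v)\<^sup>2" by (simp add: \<alpha>_def norm2_sq sum_2 algebra_simps)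
    finally show ?thesis .
  qed

  define P where "P c w R K \<longleftrightarrow> w $ 1 = c \<and> 0 < K \<and> static_state L dp dm \<eta>0 M w R \<and>
    (\<forall>v S. static_state L dp dm \<eta>0 M v S \<and> v $ 1 = c \<longrightarrow> J0 L lam Rb w R \<le> J0 L lam Rb v S) \<and>
    (\<forall>T>0. \<forall>u r. L2_on {0..T} u \<and> (\<forall>t\<in>{0..T}. u t $ 1 = w $ 1) \<and> dynamic_state L dp dm \<eta>0 M T u r \<longrightarrow>
      turnpike_bounds L lam Rb w R K T u r)" for c and w :: "real^2" and R K
  have "\<exists>w R K. P c w R K" for c
  proof -
    obtain R Q and w :: "real^2" where os: "optimality_system lam Rb w R Q" and wc: "w $ 1 = c"
      by (rule ex_optimal_static[OF e_der e_pos dissip \<alpha> lam])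
    obtain K where K: "0 < K"
      "\<And>T u r. 0 < T \<Longrightarrow> L2_on {0..T} u \<Longrightarrow> (\<And>t. t \<in> {0..T} \<Longrightarrow> u t $ 1 = w $ 1) \<Longrightarrow>
      dynamic_state L dp dm \<eta>0 M T u r \<Longrightarrow> turnpike_bounds L lam Rb w R K T u r"
      using turnpike_estimates[OF sp os e_der e'_cont e0 e0_le dissip \<alpha> lam] by blast
    have "static_state L dp dm \<eta>0 M w R"
      using os stationary_static_state[OF _ _ _ sp] by (simp add: optimality_system_def)
    moreover have "J0 L lam Rb w R \<le> J0 L lam Rb v S"
      if "static_state L dp dm \<eta>0 M v S" "v $ 1 = c" for v S
      by (rule J0_minimal[OF os lam sp that(1)]) (simp_all add: that wc)
    ultimately have "P c w R K"
      unfolding P_def using wc K by blast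
    then show ?thesis by blast
  qed
  then obtain w R K where P: "\<And>c. P c (w c) (R c) (K c)" by metis
  define jc where "jc c = J0 L lam Rb (w (of_int c)) (R (of_int c))" for c :: int
  define Km where "Km = (\<Sum>c\<in>F. K (of_int c))"
  have K_pos: "0 < K c" for c using P by (simp add: P_def)
  have K_le: "K (of_int c) \<le> Km" if "c \<in> F" for c
    unfolding Km_def by (rule member_le_sum[OF that]) (use assms(14) K_pos in \<open>auto intro: less_imp_le\<close>)
  have Km: "0 < Km" using K_le[OF assms(15)] K_pos[of "of_int 0"] by linarith
  define C where "C = 4 * Km / lam + 1"
  have C: "0 < C" using Km lam by (simp add: C_def add_pos_pos)
  \<comment> \<open>A plus control whose static value is not minimal loses linearly in T, which finally exceeds the bounded errors.\<close>
  have "\<forall>\<^sub>F T in at_top. \<forall>c\<in>F. \<forall>c'\<in>F. jc c' < jc c \<longrightarrow> 2 * Km < T * (jc c - jc c')"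
  proof (intro eventually_ball_finite assms(14) ballI)
    fix c c'
    show "\<forall>\<^sub>F T in at_top. jc c' < jc c \<longrightarrow> 2 * Km < T * (jc c - jc c')"
      using eventually_gt_at_top[of "2 * Km / (jc c - jc c')"]
      by eventually_elim (auto simp: pos_divide_less_eq)
  qed
  then have main: "\<forall>\<^sub>F T in at_top. \<forall>u r.
    solves_dynamic L dp dm \<eta>0 M lam Rb \<nu> F T u r \<longrightarrow>
    (\<exists>us Rs. solves_static L dp dm \<eta>0 M lam Rb F us Rs \<and>
       (\<forall>t\<in>{0..T}. u t $ 1 = us $ 1) \<and>
       1 / T * (LINT t|lebesgue_on {0..T}. (norm (u t - us))\<^sup>2) \<le> C / T \<and>
       (LINT \<tau>|lebesgue_on {0..T}. LINT x|lebesgue_on {0..L}. (norm (r \<tau> x - Rs x))\<^sup>2) \<le> Km * (1 + C))"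
    using eventually_gt_at_top[of 0]
  proof eventually_elim
    case (elim T)
    note gap = elim(1) and T = elim(2)
    show ?case
    proof (intro allI impI)
      fix u r assume sol: "solves_dynamic L dp dm \<eta>0 M lam Rb \<nu> F T u r"
      have u: "L2_on {0..T} u" and dyn: "dynamic_state L dp dm \<eta>0 M T u r"
        and opt: "\<And>v q. dynamic_feasible L dp dm \<eta>0 M F T v q \<Longrightarrow>
          dynamic_cost L lam Rb \<nu> T u r \<le> dynamic_cost L lam Rb \<nu> T v q"
        using sol by (auto simp: solves_dynamic_def dynamic_feasible_def)
      obtain c where c: "c \<in> F" "\<And>t. t \<in> {0..T} \<Longrightarrow> u t $ 1 = of_int c"
        using optimal_plus_control_constant[OF sol sp T lam assms(15,16)] by blast
      have w1: "w c $ 1 = c" for c using P by (simp add: P_def)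
      define X where "X = (LINT t|lebesgue_on {0..T}. (norm (u t - w (of_int c)))\<^sup>2)"
      have X0: "0 \<le> X" unfolding X_def by (intro integral_nonneg_AE AE_I2) simp
      have est: "T * jc c - K (of_int c) + lam / 2 * X \<le> J L lam Rb T u r"
        "(LINT t|lebesgue_on {0..T}. LINT x|lebesgue_on {0..L}. (norm (r t x - R (of_int c) x))\<^sup>2) \<le> K (of_int c) * (1 + X)"
        using P[of "of_int c"] T u c(2) dyn unfolding P_def X_def jc_def turnpike_bounds_def Let_def by auto
      have upper: "J L lam Rb T u r \<le> T * jc c' + Km" if c': "c' \<in> F" for c'
      proof -
        let ?w = "w (of_int c')"
        obtain q where q: "dynamic_state L dp dm \<eta>0 M T (\<lambda>_. ?w) q"
          using ex_dynamic_state_constant_control[OF T sp] by blast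
        have "dynamic_feasible L dp dm \<eta>0 M F T (\<lambda>_. ?w) q"
          unfolding dynamic_feasible_def using q L2_on_const c' by (auto simp: w1)
        from opt[OF this] have "dynamic_cost L lam Rb \<nu> T u r \<le> ennreal (J L lam Rb T (\<lambda>_. ?w) q)"
          by (simp add: dynamic_cost_def total_variation_const)
        then have "ennreal (J L lam Rb T u r) \<le> ennreal (J L lam Rb T (\<lambda>_. ?w) q)"
          unfolding dynamic_cost_def by (rule order_trans[rotated]) simp
        then have "J L lam Rb T u r \<le> J L lam Rb T (\<lambda>_. ?w) q"
          using J_nonneg[OF lam] by (simp add: ennreal_le_iff)
        also have "\<dots> \<le> T * jc c' + K (of_int c')"
          using P[of "of_int c'"] T L2_on_const q unfolding P_def jc_def turnpike_bounds_def Let_def by fastforce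
        also have "\<dots> \<le> T * jc c' + Km" using K_le[OF c'] by simp
        finally show ?thesis .
      qed
      \<comment> \<open>Lower and upper bounds for the same plus control give the bound on the distance of the controls.\<close>
      have "lam / 2 * X \<le> 2 * Km" using est(1) upper[OF c(1)] K_le[OF c(1)] by linarith
      then have X: "X \<le> C" using lam by (simp add: C_def field_simps)
      have best: "jc c \<le> jc c'" if c': "c' \<in> F" for c'
      proof (rule ccontr)
        assume "\<not> jc c \<le> jc c'"
        then have "2 * Km < T * (jc c - jc c')" using gap c(1) c' by simp
        moreover have "0 \<le> lam / 2 * X" using lam X0 by simp
        ultimately show False
          using est(1) upper[OF c'] K_le[OF c(1)] unfolding right_diff_distrib by linarith
      qed
      have "solves_static L dp dm \<eta>0 M lam Rb F (w (of_int c)) (R (of_int c))"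
        unfolding solves_static_def static_feasible_def
      proof (intro conjI allI impI)
        show "w (of_int c) $ 1 \<in> of_int ` F" using c(1) by (simp add: w1)
        show "static_state L dp dm \<eta>0 M (w (of_int c)) (R (of_int c))" using P by (simp add: P_def)
        fix v S assume v: "v $ 1 \<in> of_int ` F \<and> static_state L dp dm \<eta>0 M v S"
        then obtain c' where c': "c' \<in> F" "v $ 1 = of_int c'" by blast
        have "jc c' \<le> J0 L lam Rb v S" using P[of "of_int c'"] v c' unfolding P_def jc_def by blast
        then show "J0 L lam Rb (w (of_int c)) (R (of_int c)) \<le> J0 L lam Rb v S"
          using best[OF c'(1)] unfolding jc_def by linarith
      qed
      moreover have "\<forall>t\<in>{0..T}. u t $ 1 = w (of_int c) $ 1" using c(2) by (simp add: w1)
      moreover have "1 / T * X \<le> C / T" using X T by (simp add: divide_right_mono)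
      moreover have "K (of_int c) * (1 + X) \<le> Km * (1 + C)"
        using K_le[OF c(1)] X X0 Km by (intro mult_mono) auto
      ultimately show "\<exists>us Rs. solves_static L dp dm \<eta>0 M lam Rb F us Rs \<and>
       (\<forall>t\<in>{0..T}. u t $ 1 = us $ 1) \<and>
       1 / T * (LINT t|lebesgue_on {0..T}. (norm (u t - us))\<^sup>2) \<le> C / T \<and>
       (LINT \<tau>|lebesgue_on {0..T}. LINT x|lebesgue_on {0..L}. (norm (r \<tau> x - Rs x))\<^sup>2) \<le> Km * (1 + C)"
        using est(2) unfolding X_def by (intro exI[of _ "w (of_int c)"] exI[of _ "R (of_int c)"]) auto
    qed
  qed
  have D: "0 < Km * (1 + C)" using Km C by (intro mult_pos_pos) auto
  show ?thesis using C D main by blast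
qed

end
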